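(* Let $R=\mathbb Z_{(2)}$. The localisation $\Lambda_{(2)}\subseteq A_R$ of $\Lambda$ at $2$ is the set of all $$\begin{bmatrix} s_{1,1}&s_{1,2}&s_{1,3}&0&0&t_1\\ s_{2,1}&s_{2,2}&s_{2,3}&0&0&t_2\\ s_{3,1}&s_{3,2}&s_{3,3}&0&0&t_3\\ 0&0&0&u&0&v\\ 0&0&0&0&w&0\\ x_1&x_2&x_3&y&0&z_1+z_2\bar\eta+z_3\bar\xi\end{bmatrix}\in A_R$$ (all of $s_{i,j},t_i,u,v,w,x_i,y,z_i$ in $R$) satisfying the following congruences in $R$: - $2w-2z_1\equiv z_2\pmod 8$, $z_2\equiv z_3\pmod 4$, $z_3\equiv0\pmod 4$; - $x_1\equiv x_2\equiv x_3\equiv0\pmod 4$; - $y\equiv t_1\equiv t_2\equiv t_3\equiv v\equiv0\pmod 2$. In particular, $\mathrm{B}_R(S_3,S_3)\cong\Lambda_{(2)}$ as $R$-algebras.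
   Context: **Double Burnside algebra.** For a finite group $G$ and a commutative ring $R$, $\mathrm{B}_R(G,G)$ is the $R$-module generated by the isomorphism classes $[M]$ of finite $(G,G)$-bisets (finite sets with commuting left and right $G$-actions) modulo $[M\sqcup N]=[M]+[N]$, with multiplication induced by $[M]\cdot[N]=[M\times_G N]$, where $M\times_G N$ is the set of $G$-orbits on $M\times N$ under $g(m,n)=(mg^{-1},gn)$, with biset structure induced by $h(m,n)p=(hm,np)$. **The algebra $A$.** Let $\mathbb Q[\bar\eta,\bar\xi]=\mathbb Q[\eta,\xi]/(\eta^2,\eta\xi,\xi^2)$, with $\mathbb Q$-basis $1,\bar\eta,\bar\xi$. $A$ consists of arrays $[a_{i,j}]_{i,j\in\{1,2,3,4\}}$ with $a_{i,j}\in A_{i,j}$, where $A_{1,1}=\mathbb Q^{3\times3}$, $A_{1,4}=\mathbb Q^{3\times1}$, $A_{4,1}=\mathbb Q^{1\times3}$, $A_{2,2}=A_{2,4}=A_{3,3}=A_{4,2}=\mathbb Q$, $A_{4,4}=\mathbb Q[\bar\eta,\bar\xi]$, and all other $A_{i,j}=0$. Addition is entrywise; the product of $[a_{i,j}]$ and $[a'_{i,j}]$ has $(i,j)$ entry $\sum_r\alpha_{i,r,j}(a_{i,r},a'_{r,j})$, where the bilinear maps $\alpha_{i,j,k}:A_{i,j}\times A_{j,k}\to A_{i,k}$ are: zero whenever one of $A_{i,j},A_{j,k},A_{i,k}$ is zero; $\alpha_{1,4,1}=0$, $\alpha_{2,4,2}=0$; $\alpha_{4,1,4}(x,y)=(xy)\bar\eta$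 (row times column); $\alpha_{4,2,4}(x,y)=xy(\bar\xi-12\bar\eta)$; $\alpha_{4,4,4}$ is multiplication in $\mathbb Q[\bar\eta,\bar\xi]$; in $\alpha_{1,4,4},\alpha_{2,4,4},\alpha_{4,4,1},\alpha_{4,4,2}$ an element $a+b\bar\eta+c\bar\xi\in A_{4,4}$ acts as multiplication by its constant term $a$; and $\alpha_{1,1,1},\alpha_{1,1,4},\alpha_{4,1,1},\alpha_{2,2,2},\alpha_{2,2,4},\alpha_{4,2,2},\alpha_{3,3,3}$ are the usual (matrix) products. Elements of $A$ are written as $6\times6$ arrays with block sizes $3,1,1,1$. For a subring $R\subseteq\mathbb Q$, $A_R\subseteq A$ is the subring of arrays all of whose entries lie in $R$, except that the $(6,6)$ entry lies in $R[\bar\eta,\bar\xi]=R+R\bar\eta+R\bar\xi$. **The order $\Lambda$.** $\Lambda\subseteq A_{\mathbb Z}$ is the subring (isomorphic to $\mathrm{B}_{\mathbb Z}(S_3,S_3)$) of all arrays of the shape displayed in the claim, with integer $s_{i,j},t_i,u,v,w,x_i,y,z_i$, satisfying $2w-2z_1\equiv z_2\pmod 8$, $z_2\equiv z_3\pmod4$, $z_3\equiv0\pmod 4$; $x_1\equiv x_2\equiv x_3\equiv0\pmod 4$; $y\equiv t_1\equiv t_2\equiv t_3\equiv v\equiv0\pmod2$; and $x_1\equiv x_2\equiv x_3\equiv z_2\equiv0\pmod 3$. For a prime $p$, $\Lambda_{(p)}$ denotes the localisation of $\Lambda$ at $p$, viewed as the $\mathbb Z_{(p)}$-submodule of $A$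 generated by $\Lambda$. *)

theory Defs
  imports
    "HOL-Analysis.Determinants"
    "HOL-Algebra.Algebraic_Closure_Type"
    "HOL-Algebra.Module"
    "HOL-Algebra.QuotRing"
    "HOL-Algebra.Group_Action"
    "HOL-Algebra.Sym_Groups"
begin

section \<open>Bisets\<close>

record ('g, 'm) biset =
  points :: "'m set"
  lact :: "'g \<Rightarrow> 'm \<Rightarrow> 'm"
  ract :: "'m \<Rightarrow> 'g \<Rightarrow> 'm"

definition finite_biset :: "('g, 'x) monoid_scheme \<Rightarrow> ('g, 'm) biset \<Rightarrow> bool" where
  "finite_biset G M \<longleftrightarrow>
     finite (points M) \<and>
     (\<forall>g\<in>carrier G. \<forall>m\<in>points M. lact M g m \<in> points M) \<and>
     (\<forall>m\<in>points M. lact M \<one>\<^bsub>G\<^esub> m = m) \<and>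
     (\<forall>g\<in>carrier G. \<forall>h\<in>carrier G. \<forall>m\<in>points M.
        lact M (g \<otimes>\<^bsub>G\<^esub> h) m = lact M g (lact M h m)) \<and>
     (\<forall>g\<in>carrier G. \<forall>m\<in>points M. ract M m g \<in> points M) \<and>
     (\<forall>m\<in>points M. ract M m \<one>\<^bsub>G\<^esub> = m) \<and>
     (\<forall>g\<in>carrier G. \<forall>h\<in>carrier G. \<forall>m\<in>points M.
        ract M m (g \<otimes>\<^bsub>G\<^esub> h) = ract M (ract M m g) h) \<and>
     (\<forall>g\<in>carrier G. \<forall>h\<in>carrier G. \<forall>m\<in>points M.
        ract M (lact M g m) h = lact M g (ract M m h))"

definition biset_isomorphic ::
  "('g, 'x) monoid_scheme \<Rightarrow> ('g, 'm) biset \<Rightarrow> ('g, 'n) biset \<Rightarrow> bool" where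
  "biset_isomorphic G M N \<longleftrightarrow>
     (\<exists>f. bij_betw f (points M) (points N) \<and>
        (\<forall>g\<in>carrier G. \<forall>m\<in>points M.
           f (lact M g m) = lact N g (f m) \<and> f (ract M m g) = ract N (f m) g))"

text \<open>The isomorphism class of a biset with points of any type is represented by its members
  with points in \<^typ>\<open>nat\<close>; every finite biset is isomorphic to such a one, so
  nothing is lost.\<close>

definition biset_class ::
  "('g, 'x) monoid_scheme \<Rightarrow> ('g, 'm) biset \<Rightarrow> ('g, nat) biset set" where
  "biset_class G M = {N. finite_biset G N \<and> biset_isomorphic G M N}"

definition biset_classes :: "('g, 'x) monoid_scheme \<Rightarrow> ('g, nat) biset set set" where
  "biset_classes G = {biset_class G M | M :: ('g, nat) biset. finite_biset G M}"

definition disjoint_union_biset ::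
  "('g, 'm) biset \<Rightarrow> ('g, 'n) biset \<Rightarrow> ('g, 'm + 'n) biset" where
  "disjoint_union_biset M N =
     \<lparr>points = points M <+> points N,
      lact = (\<lambda>g. map_sum (lact M g) (lact N g)),
      ract = (\<lambda>p g. map_sum (\<lambda>m. ract M m g) (\<lambda>n. ract N n g) p)\<rparr>"

definition regular_biset :: "('g, 'x) monoid_scheme \<Rightarrow> ('g, 'g) biset" where
  "regular_biset G =
     \<lparr>points = carrier G, lact = (\<lambda>g m. g \<otimes>\<^bsub>G\<^esub> m), ract = (\<lambda>m g. m \<otimes>\<^bsub>G\<^esub> g)\<rparr>"

definition tensor_action ::
  "('g, 'x) monoid_scheme \<Rightarrow> ('g, 'm) biset \<Rightarrow> ('g, 'n) biset \<Rightarrow> 'g \<Rightarrow> 'm \<times> 'n \<Rightarrow> 'm \<times> 'n" where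
  "tensor_action G M N g = (\<lambda>(m, n). (ract M m (inv\<^bsub>G\<^esub> g), lact N g n))"

text \<open>The biset product \<open>M \<times>\<^sub>G N\<close>.\<close>

definition tensor_biset ::
  "('g, 'x) monoid_scheme \<Rightarrow> ('g, 'm) biset \<Rightarrow> ('g, 'n) biset \<Rightarrow> ('g, ('m \<times> 'n) set) biset" where
  "tensor_biset G M N =
     \<lparr>points = orbits G (points M \<times> points N) (tensor_action G M N),
      lact = (\<lambda>h orb. (\<lambda>(m, n). (lact M h m, n)) ` orb),
      ract = (\<lambda>orb p. (\<lambda>(m, n). (m, ract N n p)) ` orb)\<rparr>"

definition class_mult ::
  "('g, 'x) monoid_scheme \<Rightarrow> ('g, nat) biset set \<Rightarrow> ('g, nat) biset set \<Rightarrow> ('g, nat) biset set" where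
  "class_mult G C D = biset_class G (tensor_biset G (SOME M. M \<in> C) (SOME N. N \<in> D))"

section \<open>The double Burnside algebra\<close>

definition class_delta ::
  "('r, 'y) ring_scheme \<Rightarrow> ('g, nat) biset set \<Rightarrow> ('g, nat) biset set \<Rightarrow> 'r" where
  "class_delta R C = (\<lambda>D. if D = C then \<one>\<^bsub>R\<^esub> else \<zero>\<^bsub>R\<^esub>)"

text \<open>The free \<open>R\<close>-module on the isomorphism classes (finitely supported coefficient functions),
  with the \<open>R\<close>-bilinear extension of \<open>[M] \<cdot> [N] = [M \<times>\<^sub>G N]\<close> as multiplication.\<close>

definition free_biset_algebra ::
  "('r, 'y) ring_scheme \<Rightarrow> ('g, 'x) monoid_scheme \<Rightarrow> ('r, ('g, nat) biset set \<Rightarrow> 'r) module" where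
  "free_biset_algebra R G =
     \<lparr>carrier = {f. (\<forall>C. f C \<in> carrier R) \<and> (\<forall>C. C \<notin> biset_classes G \<longrightarrow> f C = \<zero>\<^bsub>R\<^esub>) \<and>
                    finite {C. f C \<noteq> \<zero>\<^bsub>R\<^esub>}},
      monoid.mult = (\<lambda>f g E. finsum R (\<lambda>(C, D). f C \<otimes>\<^bsub>R\<^esub> g D)
        {(C, D). f C \<noteq> \<zero>\<^bsub>R\<^esub> \<and> g D \<noteq> \<zero>\<^bsub>R\<^esub> \<and> class_mult G C D = E}),
      one = class_delta R (biset_class G (regular_biset G)),
      ring.zero = (\<lambda>C. \<zero>\<^bsub>R\<^esub>),
      add = (\<lambda>f g C. f C \<oplus>\<^bsub>R\<^esub> g C),
      module.smult = (\<lambda>r f C. r \<otimes>\<^bsub>R\<^esub> f C)\<rparr>"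

definition biset_relations ::
  "('r, 'y) ring_scheme \<Rightarrow> ('g, 'x) monoid_scheme \<Rightarrow> (('g, nat) biset set \<Rightarrow> 'r) set" where
  "biset_relations R G =
     {class_delta R (biset_class G (disjoint_union_biset M N))
        \<ominus>\<^bsub>free_biset_algebra R G\<^esub>
          (class_delta R (biset_class G M) \<oplus>\<^bsub>free_biset_algebra R G\<^esub> class_delta R (biset_class G N))
      | (M :: ('g, nat) biset) (N :: ('g, nat) biset). finite_biset G M \<and> finite_biset G N}"

definition generated_submodule ::
  "('r, 'y) ring_scheme \<Rightarrow> ('r, 'a, 'z) module_scheme \<Rightarrow> 'a set \<Rightarrow> 'a set" where
  "generated_submodule R M S = (\<lambda>H. submodule H R M) hull S"

text \<open>The quotient of an algebra by a two-sided ideal: the factor ring together with the scalar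
  multiplication on cosets induced from representatives.\<close>

definition quotient_algebra ::
  "('r, 'a, 'z) module_scheme \<Rightarrow> 'a set \<Rightarrow> ('r, 'a set) module" where
  "quotient_algebra M I =
     \<lparr>carrier = carrier (M Quot I), monoid.mult = monoid.mult (M Quot I), one = monoid.one (M Quot I),
      ring.zero = ring.zero (M Quot I), add = ring.add (M Quot I),
      module.smult = (\<lambda>r coset. \<Union>x\<in>coset. I +>\<^bsub>M\<^esub> (r \<odot>\<^bsub>M\<^esub> x))\<rparr>"

definition double_burnside ::
  "('r, 'y) ring_scheme \<Rightarrow> ('g, 'x) monoid_scheme \<Rightarrow>
     ('r, (('g, nat) biset set \<Rightarrow> 'r) set) module" where
  "double_burnside R G =
     quotient_algebra (free_biset_algebra R G)
       (generated_submodule R (free_biset_algebra R G) (biset_relations R G))"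

definition algebra_isomorphic ::
  "('r, 'y) ring_scheme \<Rightarrow> ('r, 'a, 'z) module_scheme \<Rightarrow> ('r, 'b, 'w) module_scheme \<Rightarrow> bool" where
  "algebra_isomorphic R M N \<longleftrightarrow>
     (\<exists>h\<in>ring_iso M N. \<forall>r\<in>carrier R. \<forall>x\<in>carrier M. h (r \<odot>\<^bsub>M\<^esub> x) = r \<odot>\<^bsub>N\<^esub> h x)"

section \<open>The algebra \<open>A\<close>\<close>

text \<open>\<open>Eta_Xi a b c\<close> is \<open>a + b \<eta> + c \<xi>\<close> in the quotient of the polynomial ring
  \<open>\<rat>[\<eta>, \<xi>]\<close> by the ideal generated by \<open>\<eta>\<^sup>2\<close>, \<open>\<eta>\<xi>\<close>, \<open>\<xi>\<^sup>2\<close>.\<close>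

datatype eta_xi = Eta_Xi (const_part: rat) (eta_part: rat) (xi_part: rat)

instantiation eta_xi :: comm_ring_1
begin

definition "0 = Eta_Xi 0 0 0"
definition "1 = Eta_Xi 1 0 0"
definition "p + q = Eta_Xi (const_part p + const_part q) (eta_part p + eta_part q) (xi_part p + xi_part q)"
definition "p - q = Eta_Xi (const_part p - const_part q) (eta_part p - eta_part q) (xi_part p - xi_part q)"
definition "- p = Eta_Xi (- const_part p) (- eta_part p) (- xi_part p)"
definition "p * q = Eta_Xi (const_part p * const_part q)
  (const_part p * eta_part q + eta_part p * const_part q)
  (const_part p * xi_part q + xi_part p * const_part q)"

instance
  by standard
    (auto simp: zero_eta_xi_def one_eta_xi_def plus_eta_xi_def minus_eta_xi_def uminus_eta_xi_def
      times_eta_xi_def algebra_simps intro: eta_xi.expand)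

end

lemmas eta_xi_arith = zero_eta_xi_def one_eta_xi_def plus_eta_xi_def minus_eta_xi_def
  uminus_eta_xi_def times_eta_xi_def

text \<open>\<^typ>\<open>eta_xi\<close> is that quotient: \<open>\<rat>[\<eta>, \<xi>]\<close> is \<^typ>\<open>rat poly poly\<close>, with \<open>\<eta>\<close> the
  inner and \<open>\<xi>\<close> the outer variable.\<close>

definition eta_xi_of_poly :: "rat poly poly \<Rightarrow> eta_xi" where
  "eta_xi_of_poly p = Eta_Xi (Polynomial.coeff (Polynomial.coeff p 0) 0)
     (Polynomial.coeff (Polynomial.coeff p 0) 1) (Polynomial.coeff (Polynomial.coeff p 1) 0)"

lemma eta_xi_of_poly_hom:
  "eta_xi_of_poly 1 = 1"
  "eta_xi_of_poly (p + q) = eta_xi_of_poly p + eta_xi_of_poly q"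
  "eta_xi_of_poly (p * q) = eta_xi_of_poly p * eta_xi_of_poly q"
  by (simp_all add: eta_xi_of_poly_def eta_xi_arith coeff_mult algebra_simps)

lemma surj_eta_xi_of_poly: "surj eta_xi_of_poly"
proof (rule surjI)
  fix z show "eta_xi_of_poly [:[:const_part z, eta_part z:], [:xi_part z:]:] = z"
    by (simp add: eta_xi_of_poly_def)
qed

lemma kernel_eta_xi_of_poly:
  fixes eta xi :: "rat poly poly"
  defines "eta \<equiv> [:[:0, 1:]:]" and "xi \<equiv> [:0, 1:]"
  shows "eta_xi_of_poly p = 0 \<longleftrightarrow> (\<exists>a b c. p = a * eta\<^sup>2 + b * (eta * xi) + c * xi\<^sup>2)"
proof
  assume p: "eta_xi_of_poly p = 0"
  obtain p0 p1 p2 where p_eq: "p = pCons p0 (pCons p1 p2)"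
    by (metis pCons_cases)
  obtain a0 a1 a2 where p0_eq: "p0 = pCons a0 (pCons a1 a2)"
    by (metis pCons_cases)
  obtain b0 b1 where p1_eq: "p1 = pCons b0 b1"
    by (metis pCons_cases)
  have "a0 = 0" "a1 = 0" "b0 = 0"
    using p by (simp_all add: eta_xi_of_poly_def eta_xi_arith p_eq p0_eq p1_eq)
  then have "p = [:a2:] * eta\<^sup>2 + [:b1:] * (eta * xi) + p2 * xi\<^sup>2"
    by (simp add: p_eq p0_eq p1_eq eta_def xi_def power2_eq_square)
  then show "\<exists>a b c. p = a * eta\<^sup>2 + b * (eta * xi) + c * xi\<^sup>2"
    by blast
next
  have "eta_xi_of_poly (eta\<^sup>2) = 0" "eta_xi_of_poly (eta * xi) = 0" "eta_xi_of_poly (xi\<^sup>2) = 0"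
    by (simp_all add: eta_xi_of_poly_def eta_xi_arith eta_def xi_def power2_eq_square)
  moreover assume "\<exists>a b c. p = a * eta\<^sup>2 + b * (eta * xi) + c * xi\<^sup>2"
  ultimately show "eta_xi_of_poly p = 0"
    by (auto simp: eta_xi_of_poly_hom)
qed

text \<open>\<open>Arr s t u v w x y z\<close> is the array with entries \<open>s, t, u, v, w, x, y, z\<close> at the positions
  \<open>(1,1), (1,4), (2,2), (2,4), (3,3), (4,1), (4,2), (4,4)\<close>; these are the positions with
  \<open>A\<^sub>i\<^sub>j \<noteq> 0\<close>. Both the column space \<open>A\<^sub>1\<^sub>4\<close> and the row space \<open>A\<^sub>4\<^sub>1\<close> are written as
  \<^typ>\<open>rat^3\<close>.\<close>

datatype arr = Arr
  (a11: "rat^3^3") (a14: "rat^3") (a22: rat) (a24: rat) (a33: rat)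
  (a41: "rat^3") (a42: rat) (a44: eta_xi)

text \<open>The entries of a product are the sums over \<open>r\<close> of \<open>\<alpha>\<^sub>i\<^sub>r\<^sub>j (a\<^sub>i\<^sub>r, b\<^sub>r\<^sub>j)\<close>; besides the summands
  that are zero for lack of a nonzero space, those for \<open>\<alpha>\<^sub>1\<^sub>4\<^sub>1 = 0\<close> and \<open>\<alpha>\<^sub>2\<^sub>4\<^sub>2 = 0\<close> are omitted.
  The constant term of the \<open>(4,4)\<close> entry is what acts in \<open>\<alpha>\<^sub>1\<^sub>4\<^sub>4, \<alpha>\<^sub>2\<^sub>4\<^sub>4, \<alpha>\<^sub>4\<^sub>4\<^sub>1, \<alpha>\<^sub>4\<^sub>4\<^sub>2\<close>.\<close>

definition arr_mult :: "arr \<Rightarrow> arr \<Rightarrow> arr" where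
  "arr_mult a b = Arr
     (a11 a ** a11 b)
     (a11 a *v a14 b + (\<chi> i. a14 a $ i * const_part (a44 b)))
     (a22 a * a22 b)
     (a22 a * a24 b + a24 a * const_part (a44 b))
     (a33 a * a33 b)
     (a41 a v* a11 b + (\<chi> i. const_part (a44 a) * a41 b $ i))
     (a42 a * a22 b + const_part (a44 a) * a42 b)
     (Eta_Xi 0 (\<Sum>i\<in>UNIV. a41 a $ i * a14 b $ i) 0
       + Eta_Xi 0 (-12 * (a42 a * a24 b)) (a42 a * a24 b)
       + a44 a * a44 b)"

definition arr_add :: "arr \<Rightarrow> arr \<Rightarrow> arr" where
  "arr_add a b = Arr (a11 a + a11 b) (a14 a + a14 b) (a22 a + a22 b) (a24 a + a24 b)
     (a33 a + a33 b) (a41 a + a41 b) (a42 a + a42 b) (a44 a + a44 b)"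

definition arr_smult :: "rat \<Rightarrow> arr \<Rightarrow> arr" where
  "arr_smult r a = Arr (\<chi> i j. r * a11 a $ i $ j) (\<chi> i. r * a14 a $ i) (r * a22 a) (r * a24 a)
     (r * a33 a) (\<chi> i. r * a41 a $ i) (r * a42 a) (Eta_Xi r 0 0 * a44 a)"

definition alg_A :: "(rat, arr) module" where
  "alg_A = \<lparr>carrier = UNIV, monoid.mult = arr_mult, one = Arr (mat 1) 0 1 0 1 0 0 1,
     ring.zero = Arr 0 0 0 0 0 0 0 0, add = arr_add, module.smult = arr_smult\<rparr>"

lemmas arr_ops = arr_mult_def arr_add_def arr_smult_def eta_xi_arith

lemma arr_mult_assoc: "arr_mult (arr_mult a b) c = arr_mult a (arr_mult b c)"
  by (cases a; cases b; cases c)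
    (simp add: arr_ops vec_eq_iff matrix_matrix_mult_def matrix_vector_mult_def
      vector_matrix_mult_def sum_3 algebra_simps)

lemma arr_mult_distrib:
  "arr_mult (arr_add a b) c = arr_add (arr_mult a c) (arr_mult b c)"
  "arr_mult a (arr_add b c) = arr_add (arr_mult a b) (arr_mult a c)"
  by (cases a; cases b; cases c;
    simp add: arr_ops vec_eq_iff matrix_matrix_mult_def matrix_vector_mult_def
      vector_matrix_mult_def sum_3 algebra_simps)+

lemma arr_mult_one:
  "arr_mult (Arr (mat 1) 0 1 0 1 0 0 1) a = a"
  "arr_mult a (Arr (mat 1) 0 1 0 1 0 0 1) = a"
  by (cases a; simp add: arr_ops vec_eq_iff matrix_matrix_mult_def matrix_vector_mult_def
      vector_matrix_mult_def mat_def forall_3 sum_3)+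

lemma ring_alg_A: "ring alg_A"
proof (rule ringI)
  show "abelian_group alg_A"
  proof (rule abelian_groupI)
    fix a assume "a \<in> carrier alg_A"
    have "arr_add (arr_smult (-1) a) a = Arr 0 0 0 0 0 0 0 0"
      by (cases a) (simp add: arr_ops vec_eq_iff)
    then show "\<exists>b\<in>carrier alg_A. b \<oplus>\<^bsub>alg_A\<^esub> a = \<zero>\<^bsub>alg_A\<^esub>"
      by (auto simp: alg_A_def)
  qed (auto simp: alg_A_def arr_ops algebra_simps intro: arr.expand eta_xi.expand)
  show "Group.monoid alg_A"
    by (rule monoidI) (simp_all add: alg_A_def arr_mult_assoc arr_mult_one)
qed (auto simp: alg_A_def arr_mult_distrib)

definition A_over :: "rat set \<Rightarrow> arr set" where
  "A_over S = {Arr s t u v w x y (Eta_Xi z1 z2 z3) | s t u v w x y z1 z2 z3.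
     (\<forall>i j. s $ i $ j \<in> S) \<and> (\<forall>i. t $ i \<in> S) \<and> u \<in> S \<and> v \<in> S \<and> w \<in> S \<and>
     (\<forall>i. x $ i \<in> S) \<and> y \<in> S \<and> z1 \<in> S \<and> z2 \<in> S \<and> z3 \<in> S}"

section \<open>The order \<open>\<Lambda>\<close> and its localisations\<close>

text \<open>Congruence in a subring \<open>S\<close> of the rationals, that is, modulo the ideal \<open>m S\<close>.\<close>

definition cong_in :: "rat set \<Rightarrow> rat \<Rightarrow> rat \<Rightarrow> rat \<Rightarrow> bool" where
  "cong_in S m a b \<longleftrightarrow> (\<exists>r\<in>S. a - b = m * r)"

definition Lambda :: "arr set" where
  "Lambda = {Arr s t u v w x y (Eta_Xi z1 z2 z3) | s t u v w x y z1 z2 z3.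
     Arr s t u v w x y (Eta_Xi z1 z2 z3) \<in> A_over \<int> \<and>
     cong_in \<int> 8 (2 * w - 2 * z1) z2 \<and> cong_in \<int> 4 z2 z3 \<and> cong_in \<int> 4 z3 0 \<and>
     (\<forall>i. cong_in \<int> 4 (x $ i) 0) \<and>
     cong_in \<int> 2 y 0 \<and> (\<forall>i. cong_in \<int> 2 (t $ i) 0) \<and> cong_in \<int> 2 v 0 \<and>
     (\<forall>i. cong_in \<int> 3 (x $ i) 0) \<and> cong_in \<int> 3 z2 0}"

definition Z_loc :: "nat \<Rightarrow> rat set" where
  "Z_loc p = {of_int a / of_int b | a b. \<not> int p dvd b}"

definition Z_loc_ring :: "nat \<Rightarrow> rat ring" where
  "Z_loc_ring p = ring_of_type_algebra\<lparr>carrier := Z_loc p\<rparr>"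

definition Lambda_loc :: "nat \<Rightarrow> arr set" where
  "Lambda_loc p = generated_submodule (Z_loc_ring p) alg_A Lambda"

end

theory Submission
  imports Defs
begin

text \<open>Send a biset \<open>M\<close> to the sum over its points \<open>m\<close> of a conjugation invariant weight \<open>\<psi>\<close> of the
  stabiliser \<open>stab m = {(g, h). g m = m h}\<close>, a subgroup of \<open>G \<times> G\<close>. The stabiliser of the class of
  \<open>(m, n)\<close> in \<open>M \<times>\<^sub>G N\<close> is the relational composition of \<open>stab m\<close> and \<open>stab n\<close>, so such a map is
  multiplicative as soon as \<open>\<psi>\<close> satisfies a Mackey formula for pairs of subgroups. For \<open>G = S\<^sub>3\<close> the
  22 conjugacy classes of subgroups of \<open>S\<^sub>3 \<times> S\<^sub>3\<close> are described by their Sylow subgroups, the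
  values of \<open>\<psi>\<close> in \<open>A\<close> are given by a table, and the Mackey formula is a computation with integers.
  The table spans \<open>\<Lambda>\<^sub>(\<^sub>2\<^sub>)\<close> freely over \<open>\<int>\<^sub>(\<^sub>2\<^sub>)\<close>. Since every biset is a disjoint union of orbits,
  the map is injective modulo the relations \<open>[M \<squnion> N] = [M] + [N]\<close>.\<close>

text \<open>The map sums over points rather than over orbits, so no orbit representatives are
  chosen. A transitive biset with stabiliser \<open>U\<close> has 36/|U| points, hence the weight
  |U|/36 times its tabulated image. The factors 6 and 36 that appear when products are counted by
  points cancel at the end because \<open>A\<close> is a rational vector space.

  The table needs to be correct only locally at 2. Some of its values, such as the one with
  \<open>x1 = 4\<close> and \<open>z2 = 8\<close> for the trivial stabiliser, violate the
  congruences modulo 3 and lie in \<Lambda> only after multiplication by 3, a unit of the local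
  ring.

  The free biset algebra is a record of operations, and \<open>J\<close> is a generated submodule of
  it, that is, an intersection of submodules. So \<open>J\<close> is identified directly with the
  kernel of the linear extension \<open>lin_theta\<close>: relations die there, and conversely a
  kernel element, written as a combination of 22 transitive classes modulo any submodule containing
  the relations, has zero coefficients by independence of the table. Cosets of \<open>J\<close> then
  are the fibres of \<open>lin_theta\<close>, and the operations of the quotient are compared on
  representatives.\<close>

no_notation fps_nth (infixl \<open>$\<close> 75)

section \<open>Relations on a finite group\<close>

lemmas group_simps = add.assoc minus_add diff_conv_add_uminus

definition conj_rel :: "'a::group_add \<Rightarrow> 'a \<Rightarrow> 'a rel \<Rightarrow> 'a rel" where
  "conj_rel a b U = {(x, y). (- a + x + a, - b + y + b) \<in> U}"

text \<open>For \<open>U = stab M m\<close> and \<open>V = stab N n\<close> this is the order of the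
  stabiliser of \<open>(m, n)\<close> under the middle action of the group, see
  \<open>overlap_stab\<close>.\<close>

definition overlap :: "'a::group_add rel \<Rightarrow> 'a rel \<Rightarrow> nat" where
  "overlap U V = card {k. (0, k) \<in> U \<and> (k, 0) \<in> V}"

definition subgroup_rel :: "'a::group_add rel \<Rightarrow> bool" where
  "subgroup_rel U \<longleftrightarrow> (0, 0) \<in> U \<and>
     (\<forall>x y x' y'. (x, y) \<in> U \<longrightarrow> (x', y') \<in> U \<longrightarrow> (x + x', y + y') \<in> U) \<and>
     (\<forall>x y. (x, y) \<in> U \<longrightarrow> (- x, - y) \<in> U)"

lemma subgroup_relD:
  assumes "subgroup_rel U"
  shows "(0, 0) \<in> U"
    "\<And>x y x' y'. (x, y) \<in> U \<Longrightarrow> (x', y') \<in> U \<Longrightarrow> (x + x', y + y') \<in> U"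
    "\<And>x y. (x, y) \<in> U \<Longrightarrow> (- x, - y) \<in> U"
  using assms unfolding subgroup_rel_def by blast+

lemma mem_conj_rel [simp]: "(x, y) \<in> conj_rel a b U \<longleftrightarrow> (- a + x + a, - b + y + b) \<in> U"
  by (simp add: conj_rel_def)

lemma conj_rel_conj_rel: "conj_rel a b (conj_rel c d U) = conj_rel (a + c) (b + d) U"
  by (auto simp: group_simps simp del: add_uminus_conv_diff)

lemma conj_rel_0 [simp]: "conj_rel 0 0 U = U"
  by auto

lemma conj_rel_swap: "conj_rel a b U = V \<Longrightarrow> U = conj_rel (- a) (- b) V"
  using conj_rel_conj_rel[of "- a" "- b" a b U] by simp

lemma conj_add: "- a + (x + y) + a = (- a + x + a) + (- a + y + a)" for a :: "'a::group_add"
  by (simp add: group_simps del: add_uminus_conv_diff)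

lemma conj_minus: "- a + - x + a = - (- a + x + a)" for a :: "'a::group_add"
  by (simp add: group_simps del: add_uminus_conv_diff)

lemma subgroup_rel_conj:
  assumes "subgroup_rel U"
  shows "subgroup_rel (conj_rel a b U)"
  unfolding subgroup_rel_def mem_conj_rel conj_add conj_minus
  using subgroup_relD[OF assms] by simp

lemma relcomp_conj: "conj_rel a b U O conj_rel b c V = conj_rel a c (U O V)"
proof -
  have "(x, z) \<in> conj_rel a b U O conj_rel b c V" if "(x, z) \<in> conj_rel a c (U O V)" for x z
  proof -
    from that obtain y where "(- a + x + a, y) \<in> U" "(y, - c + z + c) \<in> V"
      by auto
    then have "(x, b + y - b) \<in> conj_rel a b U" "(b + y - b, z) \<in> conj_rel b c V"
      by (simp_all add: group_simps del: add_uminus_conv_diff)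
    then show ?thesis by blast
  qed
  then show ?thesis by auto
qed

lemma overlap_conj: "overlap (conj_rel a b U) (conj_rel b c V) = overlap U V"
proof -
  have "bij_betw (\<lambda>k. - b + k + b) {k. (0, k) \<in> conj_rel a b U \<and> (k, 0) \<in> conj_rel b c V}
      {k. (0, k) \<in> U \<and> (k, 0) \<in> V}"
    by (rule bij_betw_byWitness[where f' = "\<lambda>k. b + k - b"]) (auto simp: group_simps simp del: add_uminus_conv_diff)
  then show ?thesis
    unfolding overlap_def by (rule bij_betw_same_card)
qed

text \<open>For \<open>\<psi> U\<close> the class of the transitive biset with point stabiliser \<open>U\<close>, scaled by the inverse of
  its size, this is the Mackey formula for the product of two such classes.\<close>

definition mackey :: "('a::{group_add,finite} rel \<Rightarrow> 'b::ring_1) \<Rightarrow> 'a rel \<Rightarrow> 'a rel \<Rightarrow> bool" where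
  "mackey \<psi> U V \<longleftrightarrow> of_nat (CARD('a) * CARD('a)) * (\<psi> U * \<psi> V) =
     (\<Sum>g\<in>UNIV. of_nat (overlap U (conj_rel g 0 V)) * \<psi> (U O conj_rel g 0 V))"

text \<open>Reindexing the sum by \<open>g \<mapsto> - b + g + c\<close> absorbs the two
  conjugations in the middle, and the outer ones merely conjugate the composition, which \<psi> does
  not see. The formula therefore has to be checked on one representative per conjugacy
  class.\<close>

lemma mackey_conj:
  assumes inv: "\<And>a b W. \<psi> (conj_rel a b W) = \<psi> W" and UV: "mackey \<psi> U V"
  shows "mackey \<psi> (conj_rel a b U) (conj_rel c d V)"
proof -
  let ?F = "\<lambda>U V. of_nat (overlap U V) * \<psi> (U O V)"
  have "(\<Sum>g\<in>UNIV. ?F (conj_rel a b U) (conj_rel g 0 (conj_rel c d V))) =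
      (\<Sum>g\<in>UNIV. ?F U (conj_rel g 0 V))"
  proof (rule sum.reindex_bij_witness[where i = "\<lambda>h. b + h - c" and j = "\<lambda>g. - b + g + c"])
    fix g
    have "conj_rel g 0 (conj_rel c d V) = conj_rel b d (conj_rel (- b + g + c) 0 V)"
      by (simp add: conj_rel_conj_rel group_simps del: add_uminus_conv_diff)
    then show "?F U (conj_rel (- b + g + c) 0 V) =
        ?F (conj_rel a b U) (conj_rel g 0 (conj_rel c d V))"
      by (simp add: relcomp_conj overlap_conj inv)
  qed (simp_all add: group_simps del: add_uminus_conv_diff)
  with UV show ?thesis
    by (simp add: mackey_def inv)
qed

section \<open>Bisets\<close>

text \<open>The map \<open>e\<close> replaces the carrier set by a finite type of class
  \<open>group_add\<close>, so that stabilisers are relations on a type and sums over the group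
  range over \<open>UNIV\<close>.\<close>

locale group_model =
  fixes G :: "('g, 'x) monoid_scheme" (structure) and e :: "'a::{group_add,finite} \<Rightarrow> 'g"
  assumes group_G: "group G" and bij_e: "bij_betw e UNIV (carrier G)"
    and e_add: "e (x + y) = e x \<otimes> e y"
begin

lemma range_e: "carrier G = range e"
  using bij_e by (auto simp: bij_betw_def)

lemma e_closed [simp]: "e x \<in> carrier G"
  by (simp add: range_e)

lemma e_zero: "e 0 = \<one>"
proof -
  have "e 0 \<otimes> e 0 = e 0"
    by (simp flip: e_add)
  then show ?thesis
    using group.l_cancel_one'[OF group_G, of "e 0" "e 0"] by simp
qed

lemma e_uminus: "e (- x) = inv e x"
proof (rule group.inv_equality[OF group_G, symmetric])
  show "e (- x) \<otimes> e x = \<one>"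
    by (simp add: e_zero flip: e_add)
qed simp_all

lemma finite_biset_iff:
  "finite_biset G M \<longleftrightarrow> finite (points M) \<and>
     (\<forall>x. \<forall>m\<in>points M. lact M (e x) m \<in> points M) \<and>
     (\<forall>m\<in>points M. lact M (e 0) m = m) \<and>
     (\<forall>x y. \<forall>m\<in>points M. lact M (e (x + y)) m = lact M (e x) (lact M (e y) m)) \<and>
     (\<forall>x. \<forall>m\<in>points M. ract M m (e x) \<in> points M) \<and>
     (\<forall>m\<in>points M. ract M m (e 0) = m) \<and>
     (\<forall>x y. \<forall>m\<in>points M. ract M m (e (x + y)) = ract M (ract M m (e x)) (e y)) \<and>
     (\<forall>x y. \<forall>m\<in>points M. ract M (lact M (e x) m) (e y) = lact M (e x) (ract M m (e y)))"
  unfolding finite_biset_def by (simp add: range_e e_add e_zero)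

lemma finite_bisetD:
  assumes "finite_biset G M"
  shows "finite (points M)"
    "\<And>x m. m \<in> points M \<Longrightarrow> lact M (e x) m \<in> points M"
    "\<And>m. m \<in> points M \<Longrightarrow> lact M (e 0) m = m"
    "\<And>x y m. m \<in> points M \<Longrightarrow> lact M (e (x + y)) m = lact M (e x) (lact M (e y) m)"
    "\<And>x m. m \<in> points M \<Longrightarrow> ract M m (e x) \<in> points M"
    "\<And>m. m \<in> points M \<Longrightarrow> ract M m (e 0) = m"
    "\<And>x y m. m \<in> points M \<Longrightarrow> ract M m (e (x + y)) = ract M (ract M m (e x)) (e y)"
    "\<And>x y m. m \<in> points M \<Longrightarrow> ract M (lact M (e x) m) (e y) = lact M (e x) (ract M m (e y))"
  using assms unfolding finite_biset_iff by blast+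

lemma finite_biset_cancel:
  assumes "finite_biset G M" and "m \<in> points M"
  shows "lact M (e (- x)) (lact M (e x) m) = m" "lact M (e x) (lact M (e (- x)) m) = m"
    "ract M (ract M m (e x)) (e (- x)) = m" "ract M (ract M m (e (- x))) (e x) = m"
  using assms by (simp_all add: finite_bisetD(3,6) flip: finite_bisetD(4,7))

lemma biset_isomorphic_iff:
  "biset_isomorphic G M N \<longleftrightarrow> (\<exists>f. bij_betw f (points M) (points N) \<and>
     (\<forall>x. \<forall>m\<in>points M. f (lact M (e x) m) = lact N (e x) (f m) \<and>
        f (ract M m (e x)) = ract N (f m) (e x)))"
  unfolding biset_isomorphic_def by (simp add: range_e)

section \<open>Stabilisers and weighted point counts\<close>

definition stab :: "('g, 'm) biset \<Rightarrow> 'm \<Rightarrow> 'a rel" where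
  "stab M m = {(x, y). lact M (e x) m = ract M m (e y)}"

lemma subgroup_rel_stab:
  assumes M: "finite_biset G M" and m: "m \<in> points M"
  shows "subgroup_rel (stab M m)"
  unfolding subgroup_rel_def
proof (intro conjI allI impI)
  note D = finite_bisetD[OF M] and C = finite_biset_cancel[OF M]
  show "(0, 0) \<in> stab M m"
    using m by (simp add: stab_def D)
  show "(x + x', y + y') \<in> stab M m" if "(x, y) \<in> stab M m" "(x', y') \<in> stab M m" for x y x' y'
    using that m by (simp add: stab_def D flip: D(8))
  show "(- x, - y) \<in> stab M m" if "(x, y) \<in> stab M m" for x y
  proof -
    have "lact M (e x) (ract M m (e (- y))) = m"
      using that m by (simp add: stab_def C flip: D(8))
    then have "lact M (e (- x)) m = lact M (e (- x)) (lact M (e x) (ract M m (e (- y))))"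
      by simp
    also have "\<dots> = ract M m (e (- y))"
      using m by (simp add: C D)
    finally show ?thesis
      by (simp add: stab_def)
  qed
qed

lemma stab_act:
  assumes M: "finite_biset G M" and m: "m \<in> points M"
  shows "stab M (ract M (lact M (e a) m) (e b)) = conj_rel a (- b) (stab M m)"
proof -
  note D = finite_bisetD[OF M] and C = finite_biset_cancel[OF M]
  have "lact M (e x) (ract M (lact M (e a) m) (e b)) = ract M (ract M (lact M (e a) m) (e b)) (e y)
      \<longleftrightarrow> lact M (e (- a + x + a)) m = ract M m (e (b + y - b))" (is "?l = ?r \<longleftrightarrow> ?l' = ?r'") for x y
  proof
    have mm: "lact M (e z) m \<in> points M" for z using m D by blast
    have l: "ract M (lact M (e (- a)) ?l) (e (- b)) = ?l'"
      using m mm by (simp add: D C group_simps del: add_uminus_conv_diff)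
    have r: "ract M (lact M (e (- a)) ?r) (e (- b)) = ?r'"
      using m by (simp add: D C flip: D(8)) (simp add: D C flip: D(7) add: group_simps del: add_uminus_conv_diff)
    show "?l = ?r \<Longrightarrow> ?l' = ?r'"
      using l r by simp
    have l: "ract M (lact M (e a) ?l') (e b) = ?l"
      using m mm by (simp add: D C group_simps del: add_uminus_conv_diff)
    have r: "ract M (lact M (e a) ?r') (e b) = ?r"
      using m by (simp add: D C flip: D(8)) (simp add: D C flip: D(7) add: group_simps del: add_uminus_conv_diff)
    show "?l' = ?r' \<Longrightarrow> ?l = ?r"
      using l r by simp
  qed
  then show ?thesis
    by (auto simp: stab_def)
qed

definition theta :: "('a rel \<Rightarrow> 'b::comm_monoid_add) \<Rightarrow> ('g, 'm) biset \<Rightarrow> 'b" where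
  "theta \<psi> M = (\<Sum>m\<in>points M. \<psi> (stab M m))"

lemma theta_isomorphic:
  assumes M: "finite_biset G M" and iso: "biset_isomorphic G M N"
  shows "theta \<psi> M = theta \<psi> N"
proof -
  note D = finite_bisetD[OF M]
  obtain f where f: "bij_betw f (points M) (points N)"
    "\<And>x m. m \<in> points M \<Longrightarrow> f (lact M (e x) m) = lact N (e x) (f m)"
    "\<And>x m. m \<in> points M \<Longrightarrow> f (ract M m (e x)) = ract N (f m) (e x)"
    using iso unfolding biset_isomorphic_iff by blast
  have "stab N (f m) = stab M m" if m: "m \<in> points M" for m
    using m bij_betw_imp_inj_on[OF f(1)]
    by (auto simp: stab_def D inj_on_eq_iff simp flip: f(2,3))
  then show ?thesis
    unfolding theta_def by (subst sum.reindex_bij_betw[OF f(1), symmetric]) simp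
qed

lemma finite_biset_disjoint_union:
  assumes "finite_biset G M" "finite_biset G N"
  shows "finite_biset G (disjoint_union_biset M N)"
  using finite_bisetD[OF assms(1)] finite_bisetD[OF assms(2)]
  unfolding finite_biset_iff disjoint_union_biset_def by auto

lemma theta_disjoint_union:
  assumes "finite_biset G M" "finite_biset G N"
  shows "theta \<psi> (disjoint_union_biset M N) = theta \<psi> M + theta \<psi> N"
proof -
  have "stab (disjoint_union_biset M N) (Inl m) = stab M m"
    "stab (disjoint_union_biset M N) (Inr n) = stab N n" for m n
    by (simp_all add: stab_def disjoint_union_biset_def)
  then show ?thesis
    using finite_bisetD(1)[OF assms(1)] finite_bisetD(1)[OF assms(2)]
    by (simp add: theta_def sum.Plus disjoint_union_biset_def)
qed

subsection \<open>The product of bisets\<close>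

definition tact :: "('g, 'm) biset \<Rightarrow> ('g, 'n) biset \<Rightarrow> 'a \<Rightarrow> 'm \<times> 'n \<Rightarrow> 'm \<times> 'n" where
  "tact M N x p = (ract M (fst p) (e (- x)), lact N (e x) (snd p))"

definition torbit :: "('g, 'm) biset \<Rightarrow> ('g, 'n) biset \<Rightarrow> 'm \<times> 'n \<Rightarrow> ('m \<times> 'n) set" where
  "torbit M N p = range (\<lambda>x. tact M N x p)"

lemma orbit_tensor_action: "orbit G (tensor_action G M N) p = torbit M N p"
  by (cases p) (auto simp: orbit_def tensor_action_def torbit_def tact_def range_e e_uminus)

lemma points_tensor_biset:
  "points (tensor_biset G M N) = torbit M N ` (points M \<times> points N)"
  by (auto simp: tensor_biset_def orbits_def orbit_tensor_action)

context
  fixes M :: "('g, 'm) biset" and N :: "('g, 'n) biset"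
  assumes M: "finite_biset G M" and N: "finite_biset G N"
begin

lemmas MD = finite_bisetD[OF M] and ND = finite_bisetD[OF N]
lemmas MC = finite_biset_cancel[OF M] and NC = finite_biset_cancel[OF N]

lemma tact_closed: "p \<in> points M \<times> points N \<Longrightarrow> tact M N x p \<in> points M \<times> points N"
  by (auto simp: tact_def MD ND)

lemma tact_zero: "p \<in> points M \<times> points N \<Longrightarrow> tact M N 0 p = p"
  by (auto simp: tact_def MD ND)

lemma tact_add: "p \<in> points M \<times> points N \<Longrightarrow> tact M N (x + y) p = tact M N x (tact M N y p)"
  by (auto simp: tact_def MD ND group_simps simp del: add_uminus_conv_diff)

lemma torbit_tact:
  assumes "p \<in> points M \<times> points N"
  shows "torbit M N (tact M N x p) = torbit M N p"
proof -
  have "tact M N y (tact M N x p) = tact M N (y + x) p" for y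
    using assms by (simp add: tact_add)
  moreover have "tact M N y p = tact M N (y - x) (tact M N x p)" for y
    using assms by (simp add: tact_add[symmetric])
  ultimately show ?thesis
    unfolding torbit_def by blast
qed

lemma torbit_eq_iff:
  assumes "p \<in> points M \<times> points N" "q \<in> points M \<times> points N"
  shows "torbit M N p = torbit M N q \<longleftrightarrow> p \<in> torbit M N q"
proof
  have "p \<in> torbit M N p"
    using tact_zero[OF assms(1)] unfolding torbit_def by (metis rangeI)
  then show "torbit M N p = torbit M N q \<Longrightarrow> p \<in> torbit M N q"
    by simp
  show "p \<in> torbit M N q \<Longrightarrow> torbit M N p = torbit M N q"
    using torbit_tact[OF assms(2)] by (auto simp: torbit_def[of M N q])
qed

lemma lact_tensor_biset:
  assumes "m \<in> points M" "n \<in> points N"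
  shows "lact (tensor_biset G M N) (e x) (torbit M N (m, n)) = torbit M N (lact M (e x) m, n)"
  using assms by (simp add: tensor_biset_def torbit_def tact_def image_image MD)

lemma ract_tensor_biset:
  assumes "m \<in> points M" "n \<in> points N"
  shows "ract (tensor_biset G M N) (torbit M N (m, n)) (e x) = torbit M N (m, ract N n (e x))"
  using assms by (simp add: tensor_biset_def torbit_def tact_def image_image ND)

lemma finite_biset_tensor: "finite_biset G (tensor_biset G M N)"
proof -
  have torbit: "torbit M N (m, n) \<in> torbit M N ` (points M \<times> points N)"
    if "m \<in> points M" "n \<in> points N" for m n
    using that by blast
  show ?thesis
    unfolding finite_biset_iff points_tensor_biset ball_simps(9) split_paired_Ball_Sigma
    by (simp add: torbit lact_tensor_biset ract_tensor_biset MD ND del: image_eqI)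
qed

text \<open>The pair \<open>(x, y)\<close> fixes the orbit of \<open>(m, n)\<close> iff some group
  element carries one representative to the other, and that element is, up to inversion, the
  intermediate point of the composition.\<close>

lemma stab_tensor:
  assumes m: "m \<in> points M" and n: "n \<in> points N"
  shows "stab (tensor_biset G M N) (torbit M N (m, n)) = stab M m O stab N n"
proof -
  have "torbit M N (lact M (e x) m, n) = torbit M N (m, ract N n (e y)) \<longleftrightarrow>
      (\<exists>k. (x, k) \<in> stab M m \<and> (k, y) \<in> stab N n)" for x y
  proof -
    have *: "n = lact N (e (- k)) (ract N n (e y)) \<longleftrightarrow> lact N (e k) n = ract N n (e y)" for k
      using n NC[of n k] NC[of "ract N n (e y)" k] ND(5)[of n y] by metis
    have "torbit M N (lact M (e x) m, n) = torbit M N (m, ract N n (e y)) \<longleftrightarrow>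
        (\<exists>k. lact M (e x) m = ract M m (e (- k)) \<and> n = lact N (e k) (ract N n (e y)))"
      using m n by (subst torbit_eq_iff) (auto simp: MD ND torbit_def tact_def)
    \<comment> \<open>The middle action on \<open>M\<close> uses the inverse, hence the substitution
      of \<open>- k\<close> for \<open>k\<close>.\<close>
    also have "\<dots> \<longleftrightarrow> (\<exists>k. lact M (e x) m = ract M m (e k) \<and> n = lact N (e (- k)) (ract N n (e y)))"
      by (metis minus_minus)
    finally show ?thesis
      by (simp add: stab_def *)
  qed
  then show ?thesis
    using m n by (auto simp: stab_def[of "tensor_biset G M N"] lact_tensor_biset ract_tensor_biset)
qed

lemma overlap_stab:
  assumes p: "p \<in> points M \<times> points N"
  shows "overlap (stab M (fst p)) (stab N (snd p)) = card {k. tact M N k p = p}"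
proof -
  obtain m n where mn: "p = (m, n)" "m \<in> points M" "n \<in> points N"
    using p by blast
  have "m = ract M m (e k) \<longleftrightarrow> ract M m (e (- k)) = m" for k
    using mn(2) MC(3)[of m k] MC(4)[of m k] by metis
  then have "{k. (0, k) \<in> stab M m \<and> (k, 0) \<in> stab N n} = {k. tact M N k p = p}"
    using mn by (intro Collect_cong) (simp add: mn(1) stab_def tact_def MD(3) ND(6))
  then show ?thesis
    by (simp add: overlap_def mn(1))
qed

text \<open>The stabiliser of a point \<open>q\<close> of the orbit has as many elements as the set
  of group elements taking \<open>p\<close> to \<open>q\<close>, and these sets partition the
  group.\<close>

lemma sum_overlap_torbit:
  assumes p: "p \<in> points M \<times> points N"
  shows "(\<Sum>q\<in>torbit M N p. overlap (stab M (fst q)) (stab N (snd q))) = CARD('a)"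
proof -
  have "overlap (stab M (fst q)) (stab N (snd q)) = card {x. tact M N x p = q}"
    if q: "q \<in> torbit M N p" for q
  proof -
    obtain z where z: "q = tact M N z p"
      using q by (auto simp: torbit_def)
    have "bij_betw (\<lambda>k. k + z) {k. tact M N k q = q} {x. tact M N x p = q}"
      by (rule bij_betw_byWitness[where f' = "\<lambda>x. x - z"])
        (use p in \<open>auto simp: z tact_add[symmetric]\<close>)
    then show ?thesis
      using overlap_stab[of q] tact_closed[OF p] bij_betw_same_card by (metis z)
  qed
  then have "(\<Sum>q\<in>torbit M N p. overlap (stab M (fst q)) (stab N (snd q))) =
      (\<Sum>q\<in>range (\<lambda>x. tact M N x p). card {x\<in>UNIV. tact M N x p = q})"
    by (simp add: torbit_def)
  also have "\<dots> = card (UNIV :: 'a set)"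
    using sum.image_gen[of "UNIV :: 'a set" "\<lambda>_. 1 :: nat" "\<lambda>x. tact M N x p"] by simp
  finally show ?thesis .
qed

text \<open>Points of the product are orbits of pairs. Weighting each pair by the order of its
  stabiliser makes every orbit count exactly \<open>CARD('a)\<close> times, which turns the sum over
  orbits into a sum over pairs.\<close>

lemma theta_tensor:
  fixes \<psi> :: "'a rel \<Rightarrow> 'b::ring_1"
  shows "of_nat CARD('a) * theta \<psi> (tensor_biset G M N) =
    (\<Sum>m\<in>points M. \<Sum>n\<in>points N. of_nat (overlap (stab M m) (stab N n)) * \<psi> (stab M m O stab N n))"
proof -
  let ?P = "points M \<times> points N" and ?T = "tensor_biset G M N"
  let ?k = "\<lambda>p. overlap (stab M (fst p)) (stab N (snd p))"
  have fin: "finite ?P"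
    using MD(1) ND(1) by simp
  have "(\<Sum>p\<in>?P. of_nat (?k p) * \<psi> (stab ?T (torbit M N p))) =
      (\<Sum>Y\<in>(torbit M N ` ?P). (\<Sum>p\<in>{p. p \<in> ?P \<and> torbit M N p = Y}. of_nat (?k p) * \<psi> (stab ?T (torbit M N p))))"
    by (rule sum.image_gen[OF fin])
  also have "\<dots> = (\<Sum>Y\<in>torbit M N ` ?P. of_nat CARD('a) * \<psi> (stab ?T Y))"
  proof (rule sum.cong[OF refl])
    fix Y assume "Y \<in> torbit M N ` ?P"
    then obtain q where q: "q \<in> ?P" "Y = torbit M N q" by blast
    have "{p \<in> ?P. torbit M N p = Y} = torbit M N q"
    proof -
      have "torbit M N q \<subseteq> ?P"
        using tact_closed[OF q(1)] unfolding torbit_def by blast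
      with q torbit_eq_iff[OF _ q(1)] show ?thesis by blast
    qed
    then have "(\<Sum>p\<in>{p \<in> ?P. torbit M N p = Y}. of_nat (?k p) * \<psi> (stab ?T (torbit M N p))) =
        (\<Sum>p\<in>torbit M N q. of_nat (?k p) * \<psi> (stab ?T Y))"
      by (intro sum.cong) auto
    also have "\<dots> = of_nat CARD('a) * \<psi> (stab ?T Y)"
      by (simp add: sum_overlap_torbit[OF q(1), symmetric] sum_distrib_right)
    finally show "(\<Sum>p\<in>{p \<in> ?P. torbit M N p = Y}. of_nat (?k p) * \<psi> (stab ?T (torbit M N p))) =
        of_nat CARD('a) * \<psi> (stab ?T Y)" .
  qed
  also have "\<dots> = of_nat CARD('a) * theta \<psi> ?T"
    by (simp add: theta_def points_tensor_biset sum_distrib_left)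
  finally have "of_nat CARD('a) * theta \<psi> ?T =
      (\<Sum>p\<in>?P. of_nat (?k p) * \<psi> (stab ?T (torbit M N p)))" by simp
  also have "\<dots> = (\<Sum>p\<in>?P. of_nat (?k p) * \<psi> (stab M (fst p) O stab N (snd p)))"
    by (rule sum.cong) (auto simp: stab_tensor)
  finally show ?thesis
    by (simp add: sum.cartesian_product case_prod_beta)
qed

text \<open>The Mackey formula for each pair of points produces an extra sum over \<open>g\<close>.
  For fixed \<open>g\<close>, conjugating \<open>stab N n\<close> amounts to replacing
  \<open>n\<close> by its translate, which permutes the points of \<open>N\<close>, so all
  \<open>g\<close> contribute equally.\<close>

lemma theta_mult:
  fixes \<psi> :: "'a rel \<Rightarrow> 'b::ring_1"
  assumes mackey: "\<And>U V. subgroup_rel U \<Longrightarrow> subgroup_rel V \<Longrightarrow> mackey \<psi> U V"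
  shows "of_nat (CARD('a) * CARD('a)) * (theta \<psi> M * theta \<psi> N) =
    of_nat (CARD('a) * CARD('a)) * theta \<psi> (tensor_biset G M N)"
proof -
  let ?F = "\<lambda>U V. of_nat (overlap U V) * \<psi> (U O V)"
  have stab_l: "conj_rel g 0 (stab N n) = stab N (lact N (e g) n)" if "n \<in> points N" for g n
    using stab_act[OF N that, of g 0] that by (simp add: ND)
  have shift: "(\<Sum>n\<in>points N. ?F U (conj_rel g 0 (stab N n))) = (\<Sum>n\<in>points N. ?F U (stab N n))" for U g
    by (rule sum.reindex_bij_witness[where i = "lact N (e (- g))" and j = "lact N (e g)"])
      (auto simp: stab_l ND NC)
  have "of_nat (CARD('a) * CARD('a)) * (theta \<psi> M * theta \<psi> N) =
      (\<Sum>m\<in>points M. \<Sum>n\<in>points N. of_nat (CARD('a) * CARD('a)) * (\<psi> (stab M m) * \<psi> (stab N n)))"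
    by (simp only: theta_def sum_product) (simp only: sum_distrib_left)
  also have "\<dots> = (\<Sum>m\<in>points M. \<Sum>n\<in>points N. \<Sum>g\<in>UNIV. ?F (stab M m) (conj_rel g 0 (stab N n)))"
    using mackey[OF subgroup_rel_stab[OF M] subgroup_rel_stab[OF N]]
    by (intro sum.cong refl) (simp add: mackey_def)
  also have "\<dots> = (\<Sum>m\<in>points M. \<Sum>g\<in>(UNIV :: 'a set). \<Sum>n\<in>points N. ?F (stab M m) (conj_rel g 0 (stab N n)))"
    by (intro sum.cong refl sum.swap)
  also have "\<dots> = of_nat CARD('a) * (of_nat CARD('a) * theta \<psi> (tensor_biset G M N))"
    by (simp add: shift theta_tensor sum_distrib_left)
  finally show ?thesis
    by (simp add: mult.assoc)
qed

end

end

section \<open>The ring \<open>A\<close>\<close>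

text \<open>\<open>theta\<close> and \<open>mackey\<close> take values in a type of class
  \<open>ring_1\<close>, whereas \<open>alg_A\<close> is a record; \<open>alg_A_simps\<close>
  identifies the two structures.\<close>

instantiation arr :: ring_1
begin

definition "0 = Arr 0 0 0 0 0 0 0 0"
definition "1 = Arr (mat 1) 0 1 0 1 0 0 1"
definition "a + b = arr_add a b"
definition "a * b = arr_mult a b"
definition "- a = arr_smult (- 1) a"
definition "a - b = arr_add a (arr_smult (- 1) b)"

instance
proof
  fix a b c :: arr
  show "a + b + c = a + (b + c)" "a + b = b + a" "0 + a = a" "- a + a = 0" "a - b = a + - b"
    by (cases a; cases b; cases c; simp add: zero_arr_def plus_arr_def uminus_arr_def minus_arr_def
      arr_add_def arr_smult_def eta_xi_arith vec_eq_iff)+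
  show "a * b * c = a * (b * c)" "1 * a = a" "a * 1 = a"
    "(a + b) * c = a * c + b * c" "a * (b + c) = a * b + a * c"
    by (simp_all add: times_arr_def one_arr_def plus_arr_def arr_mult_assoc arr_mult_one arr_mult_distrib)
  show "(0 :: arr) \<noteq> 1"
    by (simp add: zero_arr_def one_arr_def)
qed

end

interpretation arr: vector_space arr_smult
proof
  fix x y :: arr and r s :: rat
  show "arr_smult r (x + y) = arr_smult r x + arr_smult r y"
    "arr_smult (r + s) x = arr_smult r x + arr_smult s x"
    "arr_smult r (arr_smult s x) = arr_smult (r * s) x" "arr_smult 1 x = x"
    by (cases x; cases y; simp add: plus_arr_def arr_add_def arr_smult_def eta_xi_arith vec_eq_iff
      algebra_simps)+
qed

lemma arr_smult_mult:
  "arr_smult r x * y = arr_smult r (x * y)" "x * arr_smult r y = arr_smult r (x * y)"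
  by (cases x; cases y; simp add: times_arr_def arr_ops vec_eq_iff matrix_matrix_mult_def
    matrix_vector_mult_def vector_matrix_mult_def sum_distrib_left algebra_simps)+

lemma of_nat_mult_arr: "of_nat n * x = arr_smult (of_nat n) x" for x :: arr
  by (induction n) (simp_all add: distrib_right arr.scale_left_distrib)

section \<open>The symmetric group of degree three\<close>

text \<open>\<open>Ri\<close> is the \<open>i\<close>-th power of a three-cycle, \<open>Si\<close> its product with a fixed transposition.
  The group is written additively to have the type class \<^class>\<open>group_add\<close> at hand.\<close>

datatype s3 = R0 | R1 | R2 | S0 | S1 | S2

instantiation s3 :: "{group_add, finite}"
begin

definition "0 = R0"

fun uminus_s3 where
  "uminus_s3 R1 = R2" | "uminus_s3 R2 = R1" | "uminus_s3 x = x"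

fun plus_s3 where
  "plus_s3 R0 y = y" | "plus_s3 x R0 = x"
| "plus_s3 R1 R1 = R2" | "plus_s3 R1 R2 = R0" | "plus_s3 R1 S0 = S1" | "plus_s3 R1 S1 = S2" | "plus_s3 R1 S2 = S0"
| "plus_s3 R2 R1 = R0" | "plus_s3 R2 R2 = R1" | "plus_s3 R2 S0 = S2" | "plus_s3 R2 S1 = S0" | "plus_s3 R2 S2 = S1"
| "plus_s3 S0 R1 = S2" | "plus_s3 S0 R2 = S1" | "plus_s3 S0 S0 = R0" | "plus_s3 S0 S1 = R2" | "plus_s3 S0 S2 = R1"
| "plus_s3 S1 R1 = S0" | "plus_s3 S1 R2 = S2" | "plus_s3 S1 S0 = R1" | "plus_s3 S1 S1 = R0" | "plus_s3 S1 S2 = R2"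
| "plus_s3 S2 R1 = S1" | "plus_s3 S2 R2 = S0" | "plus_s3 S2 S0 = R2" | "plus_s3 S2 S1 = R1" | "plus_s3 S2 S2 = R0"

definition "x - y = x + - (y :: s3)"

instance
proof
  fix a b c :: s3
  show "a + b + c = a + (b + c)"
    by (cases a; cases b; cases c; simp)
  show "0 + a = a" "a + 0 = a" "- a + a = 0"
    by (cases a; simp add: zero_s3_def)+
  show "a + - b = a - b"
    by (simp add: minus_s3_def)
  have "(UNIV :: s3 set) = {R0, R1, R2, S0, S1, S2}"
    using s3.exhaust by auto
  then show "finite (UNIV :: s3 set)"
    by (metis finite.emptyI finite_insert)
qed

end

lemma UNIV_s3: "(UNIV :: s3 set) = {R0, R1, R2, S0, S1, S2}"
  using s3.exhaust by auto

lemma card_s3: "CARD(s3) = 6"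
  by (simp add: UNIV_s3)

lemma sum_s3: "(\<Sum>x\<in>UNIV. f x) = f R0 + (f R1 + (f R2 + (f S0 + (f S1 + f S2))))"
  by (simp add: UNIV_s3)

lemma ex_s3: "(\<exists>x. P x) \<longleftrightarrow> P R0 \<or> P R1 \<or> P R2 \<or> P S0 \<or> P S1 \<or> P S2"
  using s3.exhaust by metis

subsection \<open>Subgroups of \<open>S\<^sub>3 \<times> S\<^sub>3\<close>\<close>

text \<open>Up to conjugation, a subgroup of \<open>S\<^sub>3 \<times> S\<^sub>3\<close> is the product of its Sylow 3-subgroup
  \<open>P \<subseteq> C\<^sub>3 \<times> C\<^sub>3\<close> and of a Sylow 2-subgroup \<open>Q \<subseteq> \<langle>S0\<rangle> \<times> \<langle>S0\<rangle>\<close>. The six bits of its type tell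
  whether \<open>P\<close> meets, apart from the identity, the left factor, the right factor and the diagonal
  or antidiagonal, and correspondingly for \<open>Q\<close>.\<close>

type_synonym rel_type = "(bool \<times> bool \<times> bool) \<times> bool \<times> bool \<times> bool"

fun rotation :: "s3 \<Rightarrow> s3" where
  "rotation R0 = R0" | "rotation R1 = R1" | "rotation R2 = R2"
| "rotation S0 = R0" | "rotation S1 = R1" | "rotation S2 = R2"

fun reflects :: "s3 \<Rightarrow> bool" where
  "reflects S0 = True" | "reflects S1 = True" | "reflects S2 = True" | "reflects _ = False"

fun in_sylow3 :: "bool \<times> bool \<times> bool \<Rightarrow> s3 \<Rightarrow> s3 \<Rightarrow> bool" where
  "in_sylow3 (a, b, c) R0 R0 = True" | "in_sylow3 (a, b, c) R0 y = b" | "in_sylow3 (a, b, c) x R0 = a"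
| "in_sylow3 (a, b, c) R1 R1 = c" | "in_sylow3 (a, b, c) R2 R2 = c" | "in_sylow3 (a, b, c) _ _ = (a \<and> b)"

fun in_sylow2 :: "bool \<times> bool \<times> bool \<Rightarrow> bool \<Rightarrow> bool \<Rightarrow> bool" where
  "in_sylow2 (a, b, c) False False = True" | "in_sylow2 (a, b, c) False True = b"
| "in_sylow2 (a, b, c) True False = a" | "in_sylow2 (a, b, c) True True = c"

fun in_std :: "rel_type \<Rightarrow> s3 \<Rightarrow> s3 \<Rightarrow> bool" where
  "in_std (p, q) x y = (in_sylow2 q (reflects x) (reflects y) \<and> in_sylow3 p (rotation x) (rotation y))"

definition std_rel :: "rel_type \<Rightarrow> s3 rel" where
  "std_rel \<tau> = {(x, y). in_std \<tau> x y}"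

text \<open>Each bit asks whether the relation meets one conjugacy class of the product group, hence
  the invariance under conjugation. The two classes pairing a reflection with a nontrivial rotation
  are omitted: such a pair has order 6, and its third and fourth powers lie in classes that are
  tested.\<close>

definition type_of :: "(s3 \<Rightarrow> s3 \<Rightarrow> bool) \<Rightarrow> rel_type" where
  "type_of W =
     ((W R1 R0 \<or> W R2 R0, W R0 R1 \<or> W R0 R2, W R1 R1 \<or> W R1 R2 \<or> W R2 R1 \<or> W R2 R2),
      (W S0 R0 \<or> W S1 R0 \<or> W S2 R0, W R0 S0 \<or> W R0 S1 \<or> W R0 S2,
       W S0 S0 \<or> W S0 S1 \<or> W S0 S2 \<or> W S1 S0 \<or> W S1 S1 \<or> W S1 S2 \<or> W S2 S0 \<or> W S2 S1 \<or> W S2 S2))"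

definition sylow_types :: "(bool \<times> bool \<times> bool) list" where
  "sylow_types = [(False, False, False), (True, False, False), (False, True, False),
     (False, False, True), (True, True, True)]"

text \<open>Of the 25 pairs of Sylow types three are impossible: a reflection in one factor alone
  inverts one coordinate of the diagonal subgroup of order 3, so that the antidiagonal is present as
  well.\<close>

definition rel_types :: "rel_type list" where
  "rel_types = filter (\<lambda>(p, q). p = (False, False, True) \<longrightarrow>
       q = (False, False, False) \<or> q = (False, False, True))
     (List.product sylow_types sylow_types)"

lemma mem_rel_types:
  "(p, q) \<in> set rel_types \<longleftrightarrow> p \<in> set sylow_types \<and> q \<in> set sylow_types \<and>
     (p = (False, False, True) \<longrightarrow> q = (False, False, False) \<or> q = (False, False, True))"
  by (auto simp: rel_types_def)

lemma type_of_conj: "type_of (\<lambda>x y. (x, y) \<in> conj_rel a b U) = type_of (\<lambda>x y. (x, y) \<in> U)"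
  by (cases a; cases b; simp add: type_of_def; blast)

lemma type_of_std_rel:
  assumes "\<tau> \<in> set rel_types"
  shows "type_of (\<lambda>x y. (x, y) \<in> std_rel \<tau>) = \<tau>"
  using assms unfolding rel_types_def sylow_types_def
  by (auto simp: type_of_def std_rel_def split: if_splits)

definition s3_elems :: "s3 list" where
  "s3_elems = [R0, R1, R2, S0, S1, S2]"

lemma set_s3_elems: "set s3_elems = UNIV"
  by (simp add: s3_elems_def UNIV_s3)

definition std_closed :: "rel_type \<Rightarrow> bool" where
  "std_closed \<tau> \<longleftrightarrow>
     (let ps = filter (\<lambda>(x, y). in_std \<tau> x y) (List.product s3_elems s3_elems)
      in list_all (\<lambda>(x, y). in_std \<tau> (- x) (- y) \<and>
           list_all (\<lambda>(x', y'). in_std \<tau> (x + x') (y + y')) ps) ps)"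

lemma std_closed: "list_all std_closed rel_types"
  by code_simp

lemma subgroup_rel_std_rel:
  assumes "\<tau> \<in> set rel_types"
  shows "subgroup_rel (std_rel \<tau>)"
proof -
  have "in_std \<tau> R0 R0"
    by (cases \<tau>) auto
  moreover have "std_closed \<tau>"
    using assms std_closed by (simp add: list_all_iff)
  ultimately show ?thesis
    by (auto simp: subgroup_rel_def std_rel_def zero_s3_def list_all_iff std_closed_def Let_def
        set_s3_elems simp del: in_std.simps)
qed

lemma reflects_conj [simp]: "reflects (- a + x + a) \<longleftrightarrow> reflects x"
  by (cases a; cases x; simp)

lemma conj_rotation: "reflects x \<Longrightarrow> - rotation x + S0 + rotation x = x"
  by (cases x; simp)

lemma reflects_simps:
  "reflects x \<Longrightarrow> x + x = R0" "reflects x \<Longrightarrow> x + S0 = rotation x"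
  "reflects x \<Longrightarrow> rotation x + S0 = x" "reflects S0"
  "\<not> reflects x \<Longrightarrow> x + (x + x) = R0" "\<not> reflects x \<Longrightarrow> rotation x = x"
  "x + R0 = x" "R0 + x = x"
  by (cases x; simp)+

lemma reflects_add: "reflects (x + y) \<longleftrightarrow> reflects x \<noteq> reflects y"
  by (cases x; cases y; simp)

text \<open>The case in which \<open>U\<close> has a Sylow 2-subgroup in \<open>\<langle>S0\<rangle> \<times> \<langle>S0\<rangle>\<close>.\<close>

lemma subgroup_rel_conj_std_aux:
  assumes U: "subgroup_rel U"
    and c1: "\<And>x. reflects x \<Longrightarrow> (x, R0) \<in> U \<Longrightarrow> (S0, R0) \<in> U"
    and c2: "\<And>y. reflects y \<Longrightarrow> (R0, y) \<in> U \<Longrightarrow> (R0, S0) \<in> U"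
    and c3: "\<And>x y. reflects x \<Longrightarrow> reflects y \<Longrightarrow> (x, y) \<in> U \<Longrightarrow> (S0, S0) \<in> U"
  shows "\<exists>a. \<exists>\<tau>\<in>set rel_types. U = conj_rel a R0 (std_rel \<tau>)"
proof -
  note cl = subgroup_relD(2)[OF U]
  have zero: "(R0, R0) \<in> U"
    using subgroup_relD(1)[OF U] by (simp add: zero_s3_def)
  have neg: "(- x, - y) \<in> U \<longleftrightarrow> (x, y) \<in> U" for x y
    using subgroup_relD(3)[OF U] by (metis minus_minus)
  define q1 where "q1 \<longleftrightarrow> (S0, R0) \<in> U"
  define q2 where "q2 \<longleftrightarrow> (R0, S0) \<in> U"
  define q3 where "q3 \<longleftrightarrow> (S0, S0) \<in> U"
  note q_defs = q1_def q2_def q3_def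
  have left: "(x, y) \<in> U \<longleftrightarrow> q1 \<and> (rotation x, y) \<in> U" if x: "reflects x" "\<not> reflects y" for x y
  proof
    assume xy: "(x, y) \<in> U"
    \<comment> \<open>The third power of \<open>(x, y)\<close>: a reflection is its own cube, a
      rotation has trivial cube.\<close>
    have "(x, R0) \<in> U"
      using cl[OF xy cl[OF xy xy]] x by (simp add: reflects_simps)
    then have "q1"
      using c1 x by (simp add: q1_def)
    then show "q1 \<and> (rotation x, y) \<in> U"
      using cl[OF xy, of S0 R0] x by (simp add: q1_def reflects_simps)
  next
    assume "q1 \<and> (rotation x, y) \<in> U"
    then show "(x, y) \<in> U"
      using cl[of "rotation x" y S0 R0] x by (simp add: q1_def reflects_simps)
  qed
  have right: "(x, y) \<in> U \<longleftrightarrow> q2 \<and> (x, rotation y) \<in> U" if x: "\<not> reflects x" "reflects y" for x y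
  proof
    assume xy: "(x, y) \<in> U"
    have "(R0, y) \<in> U"
      using cl[OF xy cl[OF xy xy]] x by (simp add: reflects_simps)
    then have "q2"
      using c2 x by (simp add: q2_def)
    then show "q2 \<and> (x, rotation y) \<in> U"
      using cl[OF xy, of R0 S0] x by (simp add: q2_def reflects_simps)
  next
    assume "q2 \<and> (x, rotation y) \<in> U"
    then show "(x, y) \<in> U"
      using cl[of x "rotation y" R0 S0] x by (simp add: q2_def reflects_simps)
  qed
  have both: "(x, y) \<in> U \<longleftrightarrow> q3 \<and> (rotation x, rotation y) \<in> U" if x: "reflects x" "reflects y" for x y
  proof
    assume xy: "(x, y) \<in> U"
    then have "q3"
      using c3 x by (auto simp: q3_def)
    then show "q3 \<and> (rotation x, rotation y) \<in> U"
      using cl[OF xy, of S0 S0] x by (simp add: q3_def reflects_simps)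
  next
    assume "q3 \<and> (rotation x, rotation y) \<in> U"
    then show "(x, y) \<in> U"
      using cl[of "rotation x" "rotation y" S0 S0] x by (simp add: q3_def reflects_simps)
  qed
  have split: "(x, y) \<in> U \<longleftrightarrow> in_sylow2 (q1, q2, q3) (reflects x) (reflects y) \<and> (rotation x, rotation y) \<in> U"
    for x y
  proof (cases "reflects x"; cases "reflects y")
    assume r: "reflects x" "reflects y"
    show ?thesis unfolding both[OF r] using r by simp
  next
    assume r: "reflects x" "\<not> reflects y"
    show ?thesis unfolding left[OF r] using r by (simp add: reflects_simps(6))
  next
    assume r: "\<not> reflects x" "reflects y"
    show ?thesis unfolding right[OF r] using r by (simp add: reflects_simps(6))
  next
    assume "\<not> reflects x" "\<not> reflects y"
    then show ?thesis by (simp add: reflects_simps(6))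
  qed
  have q: "(q1, q2, q3) \<in> set sylow_types"
    using cl[of S0 R0 R0 S0] cl[of S0 R0 S0 S0] cl[of R0 S0 S0 S0]
    by (auto simp: sylow_types_def q_defs)
  define a where "a \<longleftrightarrow> (R1, R0) \<in> U"
  define b where "b \<longleftrightarrow> (R0, R1) \<in> U"
  define c where "c \<longleftrightarrow> (R1, R1) \<in> U"
  define d where "d \<longleftrightarrow> (R1, R2) \<in> U"
  have mem: "(R1, R0) \<in> U \<longleftrightarrow> a" "(R2, R0) \<in> U \<longleftrightarrow> a" "(R0, R1) \<in> U \<longleftrightarrow> b" "(R0, R2) \<in> U \<longleftrightarrow> b"
    "(R1, R1) \<in> U \<longleftrightarrow> c" "(R2, R2) \<in> U \<longleftrightarrow> c" "(R1, R2) \<in> U \<longleftrightarrow> d" "(R2, R1) \<in> U \<longleftrightarrow> d"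
    "(R0, R0) \<in> U"
    using neg[of R1 R0] neg[of R0 R1] neg[of R1 R1] neg[of R1 R2] zero
    by (simp_all add: a_def b_def c_def d_def)
  \<comment> \<open>Two different subgroups of order 3 generate the whole rotation group;
    \<open>c\<close> and \<open>d\<close> stand for the diagonal and the antidiagonal.\<close>
  have gen: "a \<Longrightarrow> b \<Longrightarrow> c \<and> d" "a \<Longrightarrow> c \<Longrightarrow> b" "b \<Longrightarrow> c \<Longrightarrow> a" "a \<Longrightarrow> d \<Longrightarrow> b" "b \<Longrightarrow> d \<Longrightarrow> a" "c \<Longrightarrow> d \<Longrightarrow> a"
    using cl[of R1 R0 R0 R1] cl[of R1 R0 R0 R2] cl[of R2 R0 R1 R1] cl[of R0 R2 R1 R1]
      cl[of R2 R0 R1 R2] cl[of R0 R1 R1 R2] cl[of R1 R1 R1 R2]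
    by (simp_all add: mem)
  \<comment> \<open>Conjugation by \<open>S0\<close> in a single factor exchanges the diagonal and
    the antidiagonal.\<close>
  have mixed: "q1 \<Longrightarrow> c \<longleftrightarrow> d" "q2 \<Longrightarrow> c \<longleftrightarrow> d"
    using cl[of S0 R0 R1 R1] cl[of S2 R1 S0 R0] cl[of S0 R0 R1 R2] cl[of S2 R2 S0 R0]
      cl[of R0 S0 R1 R1] cl[of R1 S2 R0 S0] cl[of R0 S0 R1 R2] cl[of R1 S1 R0 S0]
    unfolding q_defs by (simp_all add: mem) blast+
  show ?thesis
  proof (cases "d \<and> \<not> a")
    case False
    then have "d \<longleftrightarrow> a \<and> b"
      using gen by blast
    then have rot: "(rotation x, rotation y) \<in> U \<longleftrightarrow> in_sylow3 (a, b, c) (rotation x) (rotation y)" for x y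
      using mem by (cases x; cases y; simp)
    have U_eq: "U = conj_rel R0 R0 (std_rel ((a, b, c), (q1, q2, q3)))"
      using split rot by (auto simp: std_rel_def reflects_simps)
    have "(a, b, c) \<in> set sylow_types"
      unfolding sylow_types_def list.set insert_iff prod.inject empty_iff using gen by blast
    moreover have "\<not> q1 \<and> \<not> q2" if "(a, b, c) = (False, False, True)"
      using that mixed \<open>d \<longleftrightarrow> a \<and> b\<close> unfolding prod.inject by blast
    ultimately have "((a, b, c), (q1, q2, q3)) \<in> set rel_types"
      unfolding mem_rel_types using q by (auto simp: sylow_types_def)
    with U_eq show ?thesis by blast
  next
    case True
    then have abc: "d" "\<not> a" "\<not> b" "\<not> c"
      using gen by blast+
    then have q: "\<not> q1" "\<not> q2"
      using mixed by blast+
    \<comment> \<open>Here the Sylow 3-subgroup is the antidiagonal; conjugating the left factor by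
      \<open>S0\<close> inverts that coordinate and makes it the standard diagonal.\<close>
    have rot: "(rotation x, rotation y) \<in> U \<longleftrightarrow>
        in_sylow3 (False, False, True) (rotation (S0 + x + S0)) (rotation y)" for x y
      using mem abc by (cases x; cases y; simp)
    have "reflects (S0 + x + S0) \<longleftrightarrow> reflects x" for x
      by (cases x; simp)
    then have U_eq: "U = conj_rel S0 R0 (std_rel ((False, False, True), (q1, q2, q3)))"
      using split rot by (auto simp: std_rel_def reflects_simps)
    have "((False, False, True), (q1, q2, q3)) \<in> set rel_types"
      unfolding mem_rel_types using q by (auto simp: sylow_types_def)
    with U_eq show ?thesis by blast
  qed
qed

text \<open>Sylow conjugacy done by hand: conjugation by a rotation in each factor moves suitable
  reflections \<open>x0\<close> and \<open>y0\<close> to \<open>S0\<close>, after which the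
  preceding case applies.\<close>

lemma subgroup_rel_conj_std:
  assumes U: "subgroup_rel U"
  shows "\<exists>a b. \<exists>\<tau>\<in>set rel_types. U = conj_rel a b (std_rel \<tau>)"
proof -
  note cl = subgroup_relD(2)[OF U]
  define A where "A x \<longleftrightarrow> reflects x \<and> (x, R0) \<in> U" for x
  define B where "B y \<longleftrightarrow> reflects y \<and> (R0, y) \<in> U" for y
  define C where "C x y \<longleftrightarrow> reflects x \<and> reflects y \<and> (x, y) \<in> U" for x y
  have AB: "A x \<Longrightarrow> B y \<Longrightarrow> C x y" for x y
    using cl[of x R0 R0 y] by (auto simp: A_def B_def C_def reflects_simps)
  have AC: "B y" if "A z" "C x y" for x y z
  proof -
    from that have zx: "(z + x, y) \<in> U" "\<not> reflects (z + x)" "reflects y"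
      using cl[of z R0 x y] by (auto simp: A_def C_def reflects_simps reflects_add)
    from cl[OF zx(1) cl[OF zx(1) zx(1)]] zx(2,3) show ?thesis
      by (simp add: B_def reflects_simps)
  qed
  have BC: "A x" if "B z" "C x y" for x y z
  proof -
    from that have zy: "(x, z + y) \<in> U" "\<not> reflects (z + y)" "reflects x"
      using cl[of R0 z x y] by (auto simp: B_def C_def reflects_simps reflects_add)
    from cl[OF zy(1) cl[OF zy(1) zy(1)]] zy(2,3) show ?thesis
      by (simp add: A_def reflects_simps)
  qed
  have refl: "A x \<Longrightarrow> reflects x" "B y \<Longrightarrow> reflects y" "C x y \<Longrightarrow> reflects x \<and> reflects y" for x y
    by (auto simp: A_def B_def C_def)
  \<comment> \<open>A single choice serves all three conditions, because any two of
    \<open>A\<close>, \<open>B\<close>, \<open>C\<close> being inhabited forces the third: take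
    \<open>x0\<close> from \<open>A\<close> and \<open>y0\<close> from \<open>B\<close> if both are
    inhabited, a pair from \<open>C\<close> if only \<open>C\<close> is, and \<open>S0\<close>
    wherever nothing is prescribed.\<close>
  obtain x0 y0 where xy: "reflects x0" "reflects y0" "\<And>x. A x \<Longrightarrow> A x0" "\<And>y. B y \<Longrightarrow> B y0"
    "\<And>x y. C x y \<Longrightarrow> C x0 y0"
    using AB AC BC refl reflects_simps(4) by metis
  let ?U = "conj_rel (rotation x0) (rotation y0) U"
  have x0: "(S0, R0) \<in> ?U \<longleftrightarrow> (x0, R0) \<in> U" "(R0, S0) \<in> ?U \<longleftrightarrow> (R0, y0) \<in> U"
    "(S0, S0) \<in> ?U \<longleftrightarrow> (x0, y0) \<in> U"
    using xy(1,2) conj_rotation by (simp_all add: reflects_simps flip: zero_s3_def)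
  have "\<exists>a. \<exists>\<tau>\<in>set rel_types. ?U = conj_rel a R0 (std_rel \<tau>)"
  proof (rule subgroup_rel_conj_std_aux)
    show "subgroup_rel ?U"
      by (rule subgroup_rel_conj[OF U])
    show "(S0, R0) \<in> ?U" if "reflects x" "(x, R0) \<in> ?U" for x
      unfolding x0 using that xy(3)[of "- rotation x0 + x + rotation x0"]
      by (simp add: A_def flip: zero_s3_def)
    show "(R0, S0) \<in> ?U" if "reflects y" "(R0, y) \<in> ?U" for y
      unfolding x0 using that xy(4)[of "- rotation y0 + y + rotation y0"]
      by (simp add: B_def flip: zero_s3_def)
    show "(S0, S0) \<in> ?U" if "reflects x" "reflects y" "(x, y) \<in> ?U" for x y
      unfolding x0 using that xy(5)[of "- rotation x0 + x + rotation x0" "- rotation y0 + y + rotation y0"]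
      by (simp add: C_def)
  qed
  then show ?thesis
    by (metis conj_rel_swap conj_rel_conj_rel)
qed

subsection \<open>The Mackey formula in \<open>A\<close>\<close>

text \<open>The integers \<open>s\<^sub>1\<^sub>1, \<dots>, s\<^sub>3\<^sub>3, t\<^sub>1, t\<^sub>2, t\<^sub>3, u, v, w, x\<^sub>1, x\<^sub>2, x\<^sub>3, y, z\<^sub>1, z\<^sub>2, z\<^sub>3\<close>
  of an array.\<close>

datatype coords = Coords int int int int int int int int int int int int int int int int int int int int int int

fun arr_of :: "coords \<Rightarrow> arr" where
  "arr_of (Coords s11 s12 s13 s21 s22 s23 s31 s32 s33 t1 t2 t3 u v w x1 x2 x3 y z1 z2 z3) =
     Arr (vector [vector [of_int s11, of_int s12, of_int s13],
                  vector [of_int s21, of_int s22, of_int s23],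
                  vector [of_int s31, of_int s32, of_int s33]])
       (vector [of_int t1, of_int t2, of_int t3]) (of_int u) (of_int v) (of_int w)
       (vector [of_int x1, of_int x2, of_int x3]) (of_int y)
       (Eta_Xi (of_int z1) (of_int z2) (of_int z3))"

fun coords_mult :: "coords \<Rightarrow> coords \<Rightarrow> coords" where
  "coords_mult
     (Coords s11 s12 s13 s21 s22 s23 s31 s32 s33 t1 t2 t3 u v w x1 x2 x3 y z1 z2 z3)
     (Coords s11' s12' s13' s21' s22' s23' s31' s32' s33' t1' t2' t3' u' v' w' x1' x2' x3' y' z1' z2' z3') =
   Coords (s11 * s11' + s12 * s21' + s13 * s31') (s11 * s12' + s12 * s22' + s13 * s32') (s11 * s13' + s12 * s23' + s13 * s33')
     (s21 * s11' + s22 * s21' + s23 * s31') (s21 * s12' + s22 * s22' + s23 * s32') (s21 * s13' + s22 * s23' + s23 * s33')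
     (s31 * s11' + s32 * s21' + s33 * s31') (s31 * s12' + s32 * s22' + s33 * s32') (s31 * s13' + s32 * s23' + s33 * s33')
     (s11 * t1' + s12 * t2' + s13 * t3' + t1 * z1') (s21 * t1' + s22 * t2' + s23 * t3' + t2 * z1') (s31 * t1' + s32 * t2' + s33 * t3' + t3 * z1')
     (u * u') (u * v' + v * z1') (w * w')
     (x1 * s11' + x2 * s21' + x3 * s31' + z1 * x1') (x1 * s12' + x2 * s22' + x3 * s32' + z1 * x2') (x1 * s13' + x2 * s23' + x3 * s33' + z1 * x3')
     (y * u' + z1 * y') (z1 * z1') (x1 * t1' + x2 * t2' + x3 * t3' - 12 * (y * v') + z1 * z2' + z2 * z1') (y * v' + z1 * z3' + z3 * z1')"

fun coords_add :: "coords \<Rightarrow> coords \<Rightarrow> coords" where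
  "coords_add
     (Coords s11 s12 s13 s21 s22 s23 s31 s32 s33 t1 t2 t3 u v w x1 x2 x3 y z1 z2 z3)
     (Coords s11' s12' s13' s21' s22' s23' s31' s32' s33' t1' t2' t3' u' v' w' x1' x2' x3' y' z1' z2' z3') =
   Coords (s11 + s11') (s12 + s12') (s13 + s13') (s21 + s21') (s22 + s22') (s23 + s23') (s31 + s31') (s32 + s32') (s33 + s33')
     (t1 + t1') (t2 + t2') (t3 + t3') (u + u') (v + v') (w + w') (x1 + x1') (x2 + x2') (x3 + x3') (y + y') (z1 + z1') (z2 + z2') (z3 + z3')"

fun coords_scale :: "int \<Rightarrow> coords \<Rightarrow> coords" where
  "coords_scale c (Coords s11 s12 s13 s21 s22 s23 s31 s32 s33 t1 t2 t3 u v w x1 x2 x3 y z1 z2 z3) =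
   Coords (c * s11) (c * s12) (c * s13) (c * s21) (c * s22) (c * s23) (c * s31) (c * s32) (c * s33)
     (c * t1) (c * t2) (c * t3) (c * u) (c * v) (c * w) (c * x1) (c * x2) (c * x3) (c * y) (c * z1) (c * z2) (c * z3)"

lemma arr_of_mult: "arr_of (coords_mult a b) = arr_of a * arr_of b"
  by (cases a; cases b; simp add: times_arr_def arr_ops vec_eq_iff forall_3 matrix_matrix_mult_def
    matrix_vector_mult_def vector_matrix_mult_def sum_3 algebra_simps)

lemma arr_of_add: "arr_of (coords_add a b) = arr_of a + arr_of b"
  by (cases a; cases b; simp add: plus_arr_def arr_ops vec_eq_iff forall_3)

lemma arr_of_scale: "arr_of (coords_scale c a) = arr_smult (of_int c) (arr_of a)"
  by (cases a; simp add: arr_ops vec_eq_iff forall_3)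

text \<open>The homomorphism \<open>B(S\<^sub>3, S\<^sub>3) \<rightarrow> A\<close> on the transitive bisets. Those with point stabiliser
  \<open>H \<times> K\<close> go to matrices of rank one in the rows and columns 1, 2, 3 and 6; in the first three
  entries of \<open>perm_char\<close> are the multiplicities of the irreducible characters in \<open>1\<^sub>H\<close> induced to \<open>S\<^sub>3\<close>,
  and the last one tells whether \<open>H\<close> is trivial. The remaining images are found by solving the
  linear equations for a homomorphism.\<close>

definition perm_char :: "bool \<Rightarrow> bool \<Rightarrow> int \<times> int \<times> int \<times> int" where
  "perm_char a c = (if a then if c then (1, 0, 0, 0) else (1, 1, 0, 0)
     else if c then (1, 0, 1, 0) else (1, 1, 2, 1))"

text \<open>The outer product of the column \<open>(f1, f2, f3, 4 * f4)\<close> and the row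
  \<open>(g1, g2, g3, 2 * g4)\<close>, whose corner entry multiplies \<open>\<eta>\<close>. Pairing
  the first three entries of two permutation characters counts double cosets, as the product of
  bisets with stabilisers \<open>H \<times> K\<close> requires.\<close>

definition rank_one :: "int \<times> int \<times> int \<times> int \<Rightarrow> int \<times> int \<times> int \<times> int \<Rightarrow> coords" where
  "rank_one f g = (case f of (f1, f2, f3, f4) \<Rightarrow> case g of (g1, g2, g3, g4) \<Rightarrow>
     Coords (f1 * g1) (f1 * g2) (f1 * g3) (f2 * g1) (f2 * g2) (f2 * g3) (f3 * g1) (f3 * g2) (f3 * g3)
       (2 * f1 * g4) (2 * f2 * g4) (2 * f3 * g4) 0 0 0 (4 * f4 * g1) (4 * f4 * g2) (4 * f4 * g3) 0 0 (8 * f4 * g4) 0)"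

text \<open>The first test recognises the 16 types for which both Sylow subgroups, and hence the
  whole group, are products \<open>H \<times> K\<close>. In the six explicit cases at least one of
  them is diagonal; the full diagonal group, the stabiliser in the regular biset, gets the unit of
  \<open>A\<close>.\<close>

definition class_coords :: "rel_type \<Rightarrow> coords" where
  "class_coords \<tau> = (case \<tau> of ((a1, a2, a3), (c1, c2, c3)) \<Rightarrow>
     if a3 = (a1 \<and> a2) \<and> c3 = (c1 \<and> c2) then rank_one (perm_char a1 c1) (perm_char a2 c2)
     else if a1 then if a2
       then Coords 1 0 0 0 1 0 0 0 0 0 0 0 1 0 0 0 0 0 0 0 0 0
       else Coords 1 0 1 0 1 1 0 0 0 0 2 0 1 2 0 0 0 0 0 0 0 0
     else if a2
       then Coords 1 0 0 0 1 0 1 1 0 0 0 0 1 0 0 0 4 0 2 0 0 0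
     else if a3 then if c3
       then Coords 1 0 0 0 1 0 0 0 1 0 0 0 1 0 1 0 0 0 0 1 0 0
       else Coords 1 1 0 1 1 0 0 0 2 0 0 2 0 0 2 0 0 4 0 0 4 0
     else Coords 1 0 1 0 1 1 1 1 2 0 2 2 1 2 0 0 4 4 2 0 (- 40) 4)"

fun sylow3_size :: "bool \<times> bool \<times> bool \<Rightarrow> int" where
  "sylow3_size (False, False, False) = 1" | "sylow3_size (True, True, True) = 9" | "sylow3_size _ = 3"

fun sylow2_size :: "bool \<times> bool \<times> bool \<Rightarrow> int" where
  "sylow2_size (False, False, False) = 1" | "sylow2_size (True, True, True) = 4" | "sylow2_size _ = 2"

fun std_size :: "rel_type \<Rightarrow> int" where
  "std_size (p, q) = sylow3_size p * sylow2_size q"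

text \<open>Quantifiers, cardinalities and sums over the group are spelled out in six terms so that
  \<open>code_simp\<close> can evaluate the Mackey check.\<close>

definition exists_s3 :: "(s3 \<Rightarrow> bool) \<Rightarrow> bool" where
  "exists_s3 P \<longleftrightarrow> P R0 \<or> P R1 \<or> P R2 \<or> P S0 \<or> P S1 \<or> P S2"

fun int_of_bool :: "bool \<Rightarrow> int" where
  "int_of_bool True = 1" | "int_of_bool False = 0"

definition count_s3 :: "(s3 \<Rightarrow> bool) \<Rightarrow> int" where
  "count_s3 P = int_of_bool (P R0) + (int_of_bool (P R1) + (int_of_bool (P R2) +
     (int_of_bool (P S0) + (int_of_bool (P S1) + int_of_bool (P S2)))))"

definition coords_sum_s3 :: "(s3 \<Rightarrow> coords) \<Rightarrow> coords" where
  "coords_sum_s3 f = coords_add (f R0) (coords_add (f R1) (coords_add (f R2)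
     (coords_add (f S0) (coords_add (f S1) (f S2)))))"

text \<open>Since \<open>psi\<close> depends on the type alone, it suffices to compute the type of
  the composition; no conjugating element to a standard subgroup has to be found.\<close>

definition mackey_term :: "rel_type \<Rightarrow> rel_type \<Rightarrow> s3 \<Rightarrow> coords" where
  "mackey_term \<tau> \<sigma> g =
     (let \<rho> = type_of (\<lambda>x y. exists_s3 (\<lambda>k. in_std \<tau> x k \<and> in_std \<sigma> (- g + k + g) y))
      in coords_scale (count_s3 (\<lambda>k. in_std \<tau> R0 k \<and> in_std \<sigma> (- g + k + g) R0) * std_size \<rho>)
           (class_coords \<rho>))"

text \<open>The Mackey formula multiplied by 36, which clears the denominators of the weights and
  leaves an identity between integers.\<close>

definition mackey_check :: "rel_type \<Rightarrow> rel_type \<Rightarrow> bool" where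
  "mackey_check \<tau> \<sigma> \<longleftrightarrow>
     coords_scale (std_size \<tau> * std_size \<sigma>) (coords_mult (class_coords \<tau>) (class_coords \<sigma>)) =
     coords_sum_s3 (mackey_term \<tau> \<sigma>)"

lemma mackey_check: "list_all (\<lambda>\<tau>. list_all (mackey_check \<tau>) rel_types) rel_types"
  by code_simp

text \<open>The factor is the inverse of the number of points 36/|U| of the transitive biset, so
  that \<open>theta psi\<close> takes the tabulated value on it.\<close>

definition psi :: "s3 rel \<Rightarrow> arr" where
  "psi U = (let \<tau> = type_of (\<lambda>x y. (x, y) \<in> U)
     in arr_smult (of_int (std_size \<tau>) / 36) (arr_of (class_coords \<tau>)))"

lemma psi_conj: "psi (conj_rel a b U) = psi U"
  by (simp only: psi_def type_of_conj)

lemma psi_std_rel: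
  "\<tau> \<in> set rel_types \<Longrightarrow>
     psi (std_rel \<tau>) = arr_smult (of_int (std_size \<tau>) / 36) (arr_of (class_coords \<tau>))"
  by (simp only: psi_def type_of_std_rel Let_def)

lemma count_s3: "count_s3 P = int (card {x. P x})"
proof -
  have int_of_bool: "int_of_bool b = (if b then 1 else 0)" for b
    by (cases b) simp_all
  have "int (card {x. P x}) = (\<Sum>x\<in>UNIV. int_of_bool (P x))"
    by (simp add: int_of_bool sum.If_cases)
  then show ?thesis
    by (simp add: sum_s3 count_s3_def)
qed

lemma exists_s3: "exists_s3 P \<longleftrightarrow> (\<exists>x. P x)"
  by (simp only: exists_s3_def ex_s3)

lemma mackey_term_psi:
  "of_nat (overlap (std_rel \<tau>) (conj_rel g 0 (std_rel \<sigma>))) * psi (std_rel \<tau> O conj_rel g 0 (std_rel \<sigma>)) =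
     arr_smult (1 / 36) (arr_of (mackey_term \<tau> \<sigma> g))"
proof -
  let ?V = "conj_rel g 0 (std_rel \<sigma>)"
  have V: "(k, y) \<in> ?V \<longleftrightarrow> in_std \<sigma> (- g + k + g) y" for k y
    by (simp add: std_rel_def)
  have ex: "(\<lambda>x y. exists_s3 (\<lambda>k. in_std \<tau> x k \<and> in_std \<sigma> (- g + k + g) y)) =
      (\<lambda>x y. (x, y) \<in> std_rel \<tau> O ?V)"
    unfolding exists_s3 relcomp_unfold V mem_Collect_eq case_prod_conv by (simp add: std_rel_def)
  have count: "count_s3 (\<lambda>k. in_std \<tau> R0 k \<and> in_std \<sigma> (- g + k + g) R0) = int (overlap (std_rel \<tau>) ?V)"
    unfolding count_s3 overlap_def V by (simp add: std_rel_def zero_s3_def)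
  show ?thesis
    unfolding mackey_term_def ex count Let_def arr_of_scale psi_def of_nat_mult_arr
    by (simp add: mult.commute)
qed

lemma mackey_std_rel:
  assumes "\<tau> \<in> set rel_types" "\<sigma> \<in> set rel_types"
  shows "mackey psi (std_rel \<tau>) (std_rel \<sigma>)"
proof -
  have check: "mackey_check \<tau> \<sigma>"
    using mackey_check assms by (simp add: list_all_iff)
  have "of_nat (CARD(s3) * CARD(s3)) * (psi (std_rel \<tau>) * psi (std_rel \<sigma>)) =
      arr_smult (1 / 36) (arr_of (coords_scale (std_size \<tau> * std_size \<sigma>)
        (coords_mult (class_coords \<tau>) (class_coords \<sigma>))))"
    unfolding psi_std_rel[OF assms(1)] psi_std_rel[OF assms(2)] of_nat_mult_arr arr_of_scale arr_of_mult
    by (simp add: card_s3 arr_smult_mult)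
  also have "\<dots> = (\<Sum>g\<in>UNIV. arr_smult (1 / 36) (arr_of (mackey_term \<tau> \<sigma> g)))"
    unfolding check[unfolded mackey_check_def] coords_sum_s3_def arr_of_add sum_s3
    by (simp only: arr.scale_right_distrib)
  finally show ?thesis
    by (simp only: mackey_def mackey_term_psi)
qed

lemma mackey_psi:
  assumes "subgroup_rel U" "subgroup_rel V"
  shows "mackey psi U V"
  using subgroup_rel_conj_std[OF assms(1)] subgroup_rel_conj_std[OF assms(2)]
  by (auto intro: mackey_conj psi_conj mackey_std_rel)

section \<open>Isomorphism classes of bisets\<close>

lemma ex_bij_betw_range:
  assumes "\<And>s t. p s = p t \<longleftrightarrow> q s = q t"
  obtains f where "bij_betw f (range p) (range q)" "\<And>t. f (p t) = q t"
proof -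
  define f where "f y = q (SOME t. p t = y)" for y
  have f: "f (p t) = q t" for t
    unfolding f_def using someI[of "\<lambda>s. p s = p t" t] assms by simp
  have "bij_betw f (range p) (range q)"
    unfolding bij_betw_def by (simp add: inj_on_def f image_image assms)
  with f show ?thesis
    using that by blast
qed

definition shift :: "'a::group_add \<Rightarrow> 'a \<Rightarrow> 'a rel \<Rightarrow> 'a rel" where
  "shift a b U = (\<lambda>(u, v). (a + u, b + v)) ` U"

lemma shift_shift: "shift a b (shift c d U) = shift (a + c) (b + d) U"
  by (simp add: shift_def image_image case_prod_beta add.assoc)

lemma shift_zero [simp]: "shift 0 0 U = U"
  by (simp add: shift_def)

lemma shift_mem:
  assumes U: "subgroup_rel U" and xy: "(x, y) \<in> U"
  shows "shift x y U = U"
proof -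
  note D = subgroup_relD[OF U]
  have sub: "shift x y U \<subseteq> U" if "(x, y) \<in> U" for x y
    using D(2)[OF that] by (auto simp: shift_def)
  have "U = shift x y (shift (- x) (- y) U)"
    by (simp add: shift_shift)
  also have "\<dots> \<subseteq> shift x y U"
    using sub[OF D(3)[OF xy]] by (auto simp: shift_def)
  finally show ?thesis
    using sub[OF xy] by blast
qed

text \<open>Lagrange's theorem for \<open>U\<close> in the product group: the translates partition
  it into sets of equal size.\<close>

lemma card_cosets:
  fixes U :: "'a::{group_add,finite} rel"
  assumes U: "subgroup_rel U"
  shows "card U * card (range (\<lambda>(a, b). shift a b U)) = CARD('a) * CARD('a)"
proof -
  let ?P = "range (\<lambda>(a, b). shift a b U)"
  have mem: "(a, b) \<in> shift a b U" for a b
    using subgroup_relD(1)[OF U] by (force simp: shift_def)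
  have eq: "shift a b U = shift c d U" if xy: "(x, y) \<in> shift a b U" "(x, y) \<in> shift c d U" for a b c d x y
  proof -
    have "shift a b U = shift x y U" if ab: "(x, y) \<in> shift a b U" for a b
    proof -
      obtain u v where "(u, v) \<in> U" "x = a + u" "y = b + v"
        using ab by (auto simp: shift_def)
      then show ?thesis
        using shift_mem[OF U] by (simp flip: shift_shift)
    qed
    with xy show ?thesis by metis
  qed
  have "card U * card ?P = card (\<Union> ?P)"
  proof (rule card_partition)
    show "card Y = card U" if "Y \<in> ?P" for Y
      using that by (auto simp: shift_def intro!: card_image inj_onI)
    show "Y \<inter> Z = {}" if "Y \<in> ?P" "Z \<in> ?P" "Y \<noteq> Z" for Y Z
      using that eq by fast
  qed simp_all
  also have "\<Union> ?P = UNIV"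
    using mem by fast
  also have "card (UNIV :: 'a rel) = CARD('a) * CARD('a)"
    by (simp flip: UNIV_Times_UNIV add: card_cartesian_product)
  finally show ?thesis .
qed

context group_model
begin

lemma biset_isomorphic_sym:
  assumes M: "finite_biset G M" and iso: "biset_isomorphic G M N"
  shows "biset_isomorphic G N M"
proof -
  note D = finite_bisetD[OF M]
  obtain f where f: "bij_betw f (points M) (points N)"
    "\<And>x m. m \<in> points M \<Longrightarrow> f (lact M (e x) m) = lact N (e x) (f m)"
    "\<And>x m. m \<in> points M \<Longrightarrow> f (ract M m (e x)) = ract N (f m) (e x)"
    using iso unfolding biset_isomorphic_iff by blast
  let ?g = "inv_into (points M) f"
  have g: "?g (f m) = m" if "m \<in> points M" for m
    using that bij_betw_imp_inj_on[OF f(1)] by simp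
  have N: "points N = f ` points M"
    using f(1) by (simp add: bij_betw_def)
  have "bij_betw ?g (points N) (points M)"
    using f(1) by (rule bij_betw_inv_into)
  then show ?thesis
    unfolding biset_isomorphic_iff
    by (intro exI[of _ ?g]) (auto simp: N g D simp flip: f(2,3))
qed

lemma biset_isomorphic_trans:
  assumes "biset_isomorphic G M N" "biset_isomorphic G N P"
  shows "biset_isomorphic G M P"
proof -
  obtain f g where f: "bij_betw f (points M) (points N)"
    "\<And>x m. m \<in> points M \<Longrightarrow> f (lact M (e x) m) = lact N (e x) (f m) \<and> f (ract M m (e x)) = ract N (f m) (e x)"
    and g: "bij_betw g (points N) (points P)"
    "\<And>x m. m \<in> points N \<Longrightarrow> g (lact N (e x) m) = lact P (e x) (g m) \<and> g (ract N m (e x)) = ract P (g m) (e x)"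
    using assms unfolding biset_isomorphic_iff by blast
  have "f m \<in> points N" if "m \<in> points M" for m
    using f(1) that by (auto simp: bij_betw_def)
  then show ?thesis
    unfolding biset_isomorphic_iff
    by (intro exI[of _ "g \<circ> f"]) (auto simp: f(2) g(2) intro: bij_betw_trans[OF f(1) g(1)])
qed

text \<open>Guarantees that \<open>biset_class\<close> is inhabited for points of any type, so that
  choosing a member of a class by \<open>SOME\<close> is meaningful.\<close>

lemma ex_nat_biset:
  assumes M: "finite_biset G M"
  obtains N :: "('g, nat) biset" where "finite_biset G N" "biset_isomorphic G M N"
proof -
  note D = finite_bisetD[OF M]
  obtain f where f: "bij_betw f (points M) {0..<card (points M)}"
    using ex_bij_betw_finite_nat[OF D(1)] by blast
  let ?g = "inv_into (points M) f"
  have g: "?g (f m) = m" if "m \<in> points M" for m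
    using that bij_betw_imp_inj_on[OF f] by simp
  let ?N = "\<lparr>points = f ` points M, lact = (\<lambda>a n. f (lact M a (?g n))), ract = (\<lambda>n a. f (ract M (?g n) a))\<rparr>"
  have "finite_biset G ?N"
    unfolding finite_biset_iff by (auto simp: g D)
  moreover have "biset_isomorphic G M ?N"
    unfolding biset_isomorphic_iff using f
    by (intro exI[of _ f]) (auto simp: g bij_betw_def)
  ultimately show ?thesis
    by (rule that)
qed

lemma biset_class_eqI:
  assumes "finite_biset G M" "biset_isomorphic G M N"
  shows "biset_class G M = biset_class G N"
  unfolding biset_class_def
proof (intro Collect_cong conj_cong refl iffI)
  fix P :: "('g, nat) biset"
  show "biset_isomorphic G M P \<Longrightarrow> biset_isomorphic G N P"
    by (rule biset_isomorphic_trans[OF biset_isomorphic_sym[OF assms(1,2)]])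
  show "biset_isomorphic G N P \<Longrightarrow> biset_isomorphic G M P"
    by (rule biset_isomorphic_trans[OF assms(2)])
qed

lemma biset_class_mem:
  assumes M: "finite_biset G M"
  shows "biset_class G M \<in> biset_classes G"
proof -
  obtain N :: "('g, nat) biset" where "finite_biset G N" "biset_isomorphic G M N"
    using ex_nat_biset[OF M] .
  then show ?thesis
    unfolding biset_classes_def using biset_class_eqI[OF M] by blast
qed

lemma some_biset_class:
  assumes M: "finite_biset G M"
  shows "finite_biset G (SOME N. N \<in> biset_class G M)"
    "biset_isomorphic G M (SOME N. N \<in> biset_class G M)"
proof -
  obtain N :: "('g, nat) biset" where "finite_biset G N" "biset_isomorphic G M N"
    using ex_nat_biset[OF M] .
  then have "N \<in> biset_class G M"
    by (simp add: biset_class_def)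
  then have some: "(SOME N. N \<in> biset_class G M) \<in> biset_class G M"
    by (rule someI)
  have "finite_biset G P \<and> biset_isomorphic G M P" if "P \<in> biset_class G M" for P
    using that by (simp add: biset_class_def)
  from this[OF some] show "finite_biset G (SOME N. N \<in> biset_class G M)"
    "biset_isomorphic G M (SOME N. N \<in> biset_class G M)"
    by blast+
qed

definition class_theta :: "('a rel \<Rightarrow> 'b::comm_monoid_add) \<Rightarrow> ('g, nat) biset set \<Rightarrow> 'b" where
  "class_theta \<psi> C = theta \<psi> (SOME M. M \<in> C)"

lemma class_theta:
  assumes "finite_biset G M"
  shows "class_theta \<psi> (biset_class G M) = theta \<psi> M"
  unfolding class_theta_def by (rule theta_isomorphic[OF assms some_biset_class(2)[OF assms], symmetric])

lemma finite_biset_some_class: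
  assumes "C \<in> biset_classes G"
  shows "finite_biset G (SOME M. M \<in> C)"
  using assms some_biset_class(1) unfolding biset_classes_def by blast

lemma class_mult_mem:
  assumes "C \<in> biset_classes G" "D \<in> biset_classes G"
  shows "class_mult G C D \<in> biset_classes G"
  unfolding class_mult_def
  by (intro biset_class_mem finite_biset_tensor finite_biset_some_class assms)

text \<open>The factor stays on both sides because the target is an arbitrary ring;
  \<open>arr_of_nat_cancel\<close> removes it in \<open>A\<close>.\<close>

lemma class_theta_mult:
  fixes \<psi> :: "'a rel \<Rightarrow> 'b::ring_1"
  assumes "\<And>U V. subgroup_rel U \<Longrightarrow> subgroup_rel V \<Longrightarrow> mackey \<psi> U V"
    and C: "C \<in> biset_classes G" "D \<in> biset_classes G"
  shows "of_nat (CARD('a) * CARD('a)) * class_theta \<psi> (class_mult G C D) =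
    of_nat (CARD('a) * CARD('a)) * (class_theta \<psi> C * class_theta \<psi> D)"
  unfolding class_mult_def class_theta[OF finite_biset_tensor[OF C[THEN finite_biset_some_class]]]
  using theta_mult[OF C[THEN finite_biset_some_class] assms(1)] by (simp add: class_theta_def)

subsection \<open>Transitive bisets\<close>

definition bact :: "('g, 'm) biset \<Rightarrow> 'm \<Rightarrow> 'a \<times> 'a \<Rightarrow> 'm" where
  "bact M m = (\<lambda>(x, y). ract M (lact M (e x) m) (e y))"

lemma bact_eq_iff:
  assumes M: "finite_biset G M" and m: "m \<in> points M"
  shows "bact M m (x, y) = bact M m (x', y') \<longleftrightarrow> (- x' + x, y' - y) \<in> stab M m"
proof -
  note D = finite_bisetD[OF M] and C = finite_biset_cancel[OF M]
  let ?l = "ract M (lact M (e x) m) (e y)" and ?r = "ract M (lact M (e x') m) (e y')"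
  let ?l' = "lact M (e (- x' + x)) m" and ?r' = "ract M m (e (y' - y))"
  have mm: "lact M (e z) m \<in> points M" "ract M m (e z) \<in> points M" for z using m D by blast+
  have "ract M (lact M (e (- x')) ?l) (e (- y)) = ?l'"
    using m mm by (simp add: D C)
  moreover have "ract M (lact M (e (- x')) ?r) (e (- y)) = ?r'"
    using m mm by (simp add: D C) (simp add: D flip: D(7))
  moreover have "ract M (lact M (e x') ?l') (e y) = ?l"
    using m mm by (simp add: D C)
  moreover have "ract M (lact M (e x') ?r') (e y) = ?r"
    using m mm by (simp add: D C flip: D(8)) (simp add: D flip: D(7))
  ultimately have "?l = ?r \<longleftrightarrow> ?l' = ?r'"
    by metis
  then show ?thesis
    by (simp add: bact_def stab_def)
qed

lemma bact_act:
  assumes M: "finite_biset G M" and m: "m \<in> points M"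
  shows "lact M (e a) (bact M m (x, y)) = bact M m (a + x, y)"
    "ract M (bact M m (x, y)) (e b) = bact M m (x, y + b)"
  using m by (simp_all add: bact_def finite_bisetD[OF M])

text \<open>By \<open>bact_eq_iff\<close> the stabiliser decides which pairs move the base point to
  the same place, so matching these pairs gives a well-defined bijection of the two orbits.\<close>

lemma transitive_isomorphic:
  assumes M: "finite_biset G M" "m \<in> points M" "points M = range (bact M m)"
    and N: "finite_biset G N" "n \<in> points N" "points N = range (bact N n)"
    and stab: "stab M m = stab N n"
  shows "biset_isomorphic G M N"
proof -
  have *: "bact M m s = bact M m t \<longleftrightarrow> bact N n s = bact N n t" for s t
    by (cases s; cases t) (simp add: bact_eq_iff M(1,2) N(1,2) stab)
  obtain f where f: "bij_betw f (range (bact M m)) (range (bact N n))" "\<And>t. f (bact M m t) = bact N n t"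
    using ex_bij_betw_range[of "bact M m" "bact N n", OF *] by blast
  show ?thesis
    unfolding biset_isomorphic_iff M(3) N(3)
    by (intro exI[of _ f])
      (auto simp: f bact_act[OF M(1,2)] bact_act[OF N(1,2)])
qed

text \<open>The cosets of \<open>U\<close> in the product group, with the right action through
  inverses: \<open>stab\<close> records \<open>g m = m h\<close>, and with this sign the stabiliser
  of the base point is \<open>U\<close> itself.\<close>

definition coset_biset :: "'a rel \<Rightarrow> ('g, 'a rel) biset" where
  "coset_biset U =
     \<lparr>points = range (\<lambda>(a, b). shift a b U),
      lact = (\<lambda>g. shift (inv_into UNIV e g) 0), ract = (\<lambda>Y g. shift 0 (- inv_into UNIV e g) Y)\<rparr>"

lemma coset_biset_simps:
  "points (coset_biset U) = range (\<lambda>(a, b). shift a b U)"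
  "lact (coset_biset U) (e x) = shift x 0" "ract (coset_biset U) Y (e x) = shift 0 (- x) Y"
  using bij_betw_imp_inj_on[OF bij_e] by (simp_all add: coset_biset_def)

lemma finite_biset_coset_biset: "finite_biset G (coset_biset U)"
  unfolding finite_biset_iff
  by (auto simp: coset_biset_simps shift_shift minus_add simp del: add_uminus_conv_diff)

lemma base_point_coset_biset: "U \<in> points (coset_biset U)"
  unfolding coset_biset_simps by (rule range_eqI[of _ _ "(0, 0)"]) simp

lemma bact_coset_biset: "bact (coset_biset U) U (x, y) = shift x (- y) U"
  by (simp add: bact_def coset_biset_simps shift_shift)

lemma points_coset_biset: "points (coset_biset U) = range (bact (coset_biset U) U)"
proof -
  have "shift a b U = bact (coset_biset U) U (a, - b)" for a b
    by (simp add: bact_coset_biset)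
  then show ?thesis
    by (auto simp: coset_biset_simps(1)) (simp add: bact_coset_biset, blast)
qed

lemma stab_coset_biset:
  assumes U: "subgroup_rel U"
  shows "stab (coset_biset U) U = U"
proof -
  have "shift x 0 U = shift 0 (- y) U \<longleftrightarrow> (x, y) \<in> U" for x y
  proof
    assume eq: "shift x 0 U = shift 0 (- y) U"
    have "(x, 0) \<in> shift x 0 U"
      using subgroup_relD(1)[OF U] by (force simp: shift_def)
    then obtain v where "(x, v) \<in> U" "0 = - y + v"
      unfolding eq by (auto simp: shift_def)
    then show "(x, y) \<in> U"
      by (metis add.inverse_inverse add_eq_0_iff)
  next
    assume "(x, y) \<in> U"
    then have "shift 0 (- y) U = shift 0 (- y) (shift x y U)"
      by (simp add: shift_mem[OF U])
    then show "shift x 0 U = shift 0 (- y) U"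
      by (simp add: shift_shift)
  qed
  then show ?thesis
    by (auto simp: stab_def coset_biset_simps)
qed

lemma theta_coset_biset:
  fixes \<psi> :: "'a rel \<Rightarrow> 'b::ring_1"
  assumes U: "subgroup_rel U" and conj: "\<And>a b W. \<psi> (conj_rel a b W) = \<psi> W"
  shows "theta \<psi> (coset_biset U) = of_nat (card (range (\<lambda>(a, b). shift a b U))) * \<psi> U"
proof -
  have "\<psi> (stab (coset_biset U) Y) = \<psi> U" if Y: "Y \<in> points (coset_biset U)" for Y
  proof -
    obtain x y where "Y = bact (coset_biset U) U (x, y)"
      using Y unfolding points_coset_biset by auto
    then show ?thesis
      using stab_act[OF finite_biset_coset_biset base_point_coset_biset]
      by (simp add: bact_def conj stab_coset_biset[OF U])
  qed
  then show ?thesis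
    by (simp add: theta_def coset_biset_simps(1))
qed

end

section \<open>The double Burnside algebra over \<open>\<int>\<^sub>(\<^sub>p\<^sub>)\<close>\<close>

context
  fixes p :: nat
  assumes p: "prime p"
begin

lemma Z_loc_of_int: "of_int a \<in> Z_loc p"
proof -
  have "\<not> int p dvd 1"
    using p not_prime_unit by auto
  then show ?thesis
    unfolding Z_loc_def by (intro CollectI exI[of _ a] exI[of _ 1]) simp
qed

lemma Z_loc_add: "x \<in> Z_loc p \<Longrightarrow> y \<in> Z_loc p \<Longrightarrow> x + y \<in> Z_loc p"
proof -
  assume "x \<in> Z_loc p" "y \<in> Z_loc p"
  then obtain a b c d where *: "x = of_int a / of_int b" "y = of_int c / of_int d"
    "\<not> int p dvd b" "\<not> int p dvd d"
    by (auto simp: Z_loc_def)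
  then have bd: "b \<noteq> 0" "d \<noteq> 0" "\<not> int p dvd b * d"
    using p by (auto simp: prime_dvd_mult_iff)
  have "x + y = of_int (a * d + c * b) / of_int (b * d)"
    unfolding *(1,2) using bd(1,2) by (simp add: add_frac_eq)
  with bd(3) show ?thesis
    unfolding Z_loc_def by blast
qed

lemma Z_loc_mult: "x \<in> Z_loc p \<Longrightarrow> y \<in> Z_loc p \<Longrightarrow> x * y \<in> Z_loc p"
proof -
  assume "x \<in> Z_loc p" "y \<in> Z_loc p"
  then obtain a b c d where *: "x = of_int a / of_int b" "y = of_int c / of_int d"
    "\<not> int p dvd b" "\<not> int p dvd d"
    by (auto simp: Z_loc_def)
  then have "\<not> int p dvd b * d" "x * y = of_int (a * c) / of_int (b * d)"
    using p by (auto simp: prime_dvd_mult_iff)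
  then show ?thesis
    unfolding Z_loc_def by blast
qed

lemma Z_loc_closed:
  "0 \<in> Z_loc p" "1 \<in> Z_loc p" "numeral n \<in> Z_loc p" "- 1 \<in> Z_loc p"
  "x \<in> Z_loc p \<Longrightarrow> - x \<in> Z_loc p"
  "x \<in> Z_loc p \<Longrightarrow> y \<in> Z_loc p \<Longrightarrow> x + y \<in> Z_loc p"
  "x \<in> Z_loc p \<Longrightarrow> y \<in> Z_loc p \<Longrightarrow> x - y \<in> Z_loc p"
  "x \<in> Z_loc p \<Longrightarrow> y \<in> Z_loc p \<Longrightarrow> x * y \<in> Z_loc p"
proof -
  show 0: "0 \<in> Z_loc p" "1 \<in> Z_loc p" "numeral n \<in> Z_loc p" "- 1 \<in> Z_loc p"
    using Z_loc_of_int[of 0] Z_loc_of_int[of 1] Z_loc_of_int[of "numeral n"] Z_loc_of_int[of "- 1"]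
    by simp_all
  show neg: "- x \<in> Z_loc p" if "x \<in> Z_loc p" for x
    using Z_loc_mult[OF 0(4) that] by simp
  show "x - y \<in> Z_loc p" if "x \<in> Z_loc p" "y \<in> Z_loc p"
    using Z_loc_add[OF that(1) neg[OF that(2)]] by simp
qed (fact Z_loc_add Z_loc_mult)+

lemma Z_loc_sum: "(\<And>i. i \<in> A \<Longrightarrow> f i \<in> Z_loc p) \<Longrightarrow> sum f A \<in> Z_loc p"
  by (induction A rule: infinite_finite_induct) (auto simp: Z_loc_closed)

end

lemma Z_loc_ring_simps:
  "carrier (Z_loc_ring p) = Z_loc p" "mult (Z_loc_ring p) = (*)" "one (Z_loc_ring p) = 1"
  "ring.zero (Z_loc_ring p) = 0" "add (Z_loc_ring p) = (+)"
  by (simp_all add: Z_loc_ring_def ring_of_type_algebra_def)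

lemma abelian_group_Z_loc_ring:
  assumes "prime p"
  shows "abelian_group (Z_loc_ring p)"
proof (rule abelian_groupI)
  fix x assume "x \<in> carrier (Z_loc_ring p)"
  then show "\<exists>y\<in>carrier (Z_loc_ring p). y \<oplus>\<^bsub>Z_loc_ring p\<^esub> x = \<zero>\<^bsub>Z_loc_ring p\<^esub>"
    by (intro bexI[of _ "- x"]) (simp_all add: Z_loc_ring_simps Z_loc_closed[OF assms])
qed (simp_all add: Z_loc_ring_simps Z_loc_closed[OF assms])

lemma finsum_Z_loc_ring:
  assumes p: "prime p" and "finite A" "\<And>i. i \<in> A \<Longrightarrow> f i \<in> Z_loc p"
  shows "finsum (Z_loc_ring p) f A = sum f A"
  using assms(2,3)
proof (induction A)
  case empty
  show ?case
    using abelian_monoid.finsum_empty[OF abelian_group.axioms(1)[OF abelian_group_Z_loc_ring[OF p]]]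
    by (simp add: Z_loc_ring_simps)
next
  case (insert a A)
  then show ?case
    using abelian_monoid.finsum_insert[OF abelian_group.axioms(1)[OF abelian_group_Z_loc_ring[OF p]], of A a f]
    by (simp add: Z_loc_ring_simps Pi_def)
qed

text \<open>Closure under additive inverses is reduced to closure under scalars, by means of a
  scalar \<open>r\<close> that acts as -1.\<close>

lemma submodule_negI:
  fixes R :: "('r, 'y) ring_scheme" and M :: "('r, 'm, 'z) module_scheme"
  assumes M: "abelian_group M" and sub: "H \<subseteq> carrier M" and zero: "\<zero>\<^bsub>M\<^esub> \<in> H"
    and add: "\<And>x y. x \<in> H \<Longrightarrow> y \<in> H \<Longrightarrow> x \<oplus>\<^bsub>M\<^esub> y \<in> H"
    and smult: "\<And>r x. r \<in> carrier R \<Longrightarrow> x \<in> H \<Longrightarrow> r \<odot>\<^bsub>M\<^esub> x \<in> H"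
    and neg: "r \<in> carrier R" "\<And>x. x \<in> H \<Longrightarrow> (r \<odot>\<^bsub>M\<^esub> x) \<oplus>\<^bsub>M\<^esub> x = \<zero>\<^bsub>M\<^esub>"
  shows "submodule H R M"
proof -
  have "inv\<^bsub>add_monoid M\<^esub> x = r \<odot>\<^bsub>M\<^esub> x" if "x \<in> H" for x
    using abelian_group.minus_equality[OF M, of "r \<odot>\<^bsub>M\<^esub> x" x] neg smult[OF neg(1)] sub that
    by (auto simp: a_inv_def)
  then show ?thesis
    using sub zero add smult neg(1)
    by (auto intro!: submodule.intro subgroup.intro submodule_axioms.intro)
qed

lemma mem_generated_submodule:
  "x \<in> generated_submodule R M S \<longleftrightarrow> (\<forall>H. submodule H R M \<and> S \<subseteq> H \<longrightarrow> x \<in> H)"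
  by (auto simp: generated_submodule_def hull_def)

lemma submoduleD:
  fixes R :: "('r, 'y) ring_scheme" and M :: "('r, 'm, 'z) module_scheme"
  assumes "submodule H R M"
  shows "H \<subseteq> carrier M" "\<zero>\<^bsub>M\<^esub> \<in> H" "\<And>x y. x \<in> H \<Longrightarrow> y \<in> H \<Longrightarrow> x \<oplus>\<^bsub>M\<^esub> y \<in> H"
    "\<And>r x. r \<in> carrier R \<Longrightarrow> x \<in> H \<Longrightarrow> r \<odot>\<^bsub>M\<^esub> x \<in> H"
  using subgroup.subset[OF submodule.axioms(1)[OF assms]]
    subgroup.one_closed[OF submodule.axioms(1)[OF assms]]
    subgroup.m_closed[OF submodule.axioms(1)[OF assms]]
    submodule.smult_closed[OF assms]
  by auto

definition delta :: "'c \<Rightarrow> 'c \<Rightarrow> rat" where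
  "delta C D = (if D = C then 1 else 0)"

lemma class_delta_eq: "class_delta (Z_loc_ring p) C = delta C"
  by (simp add: class_delta_def delta_def fun_eq_iff Z_loc_ring_simps)

section \<open>The free biset algebra in explicit form\<close>

locale burnside_model = group_model G e
  for G :: "('g, 'x) monoid_scheme" (structure) and e :: "'a::{group_add,finite} \<Rightarrow> 'g" +
  fixes p :: nat
  assumes p: "prime p"
begin

abbreviation "B \<equiv> free_biset_algebra (Z_loc_ring p) G"

abbreviation "J \<equiv> generated_submodule (Z_loc_ring p) B (biset_relations (Z_loc_ring p) G)"

lemmas Z_closed = Z_loc_closed[OF p]

lemma carrier_B:
  "f \<in> carrier B \<longleftrightarrow> (\<forall>C. f C \<in> Z_loc p) \<and> (\<forall>C. C \<notin> biset_classes G \<longrightarrow> f C = 0) \<and> finite {C. f C \<noteq> 0}"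
  by (simp add: free_biset_algebra_def Z_loc_ring_simps)

lemma B_support: "f \<in> carrier B \<Longrightarrow> f C \<noteq> 0 \<Longrightarrow> C \<in> biset_classes G"
  by (auto simp: carrier_B)

lemma B_simps:
  "\<zero>\<^bsub>B\<^esub> = (\<lambda>C. 0)" "f \<oplus>\<^bsub>B\<^esub> g = (\<lambda>C. f C + g C)" "r \<odot>\<^bsub>B\<^esub> f = (\<lambda>C. r * f C)"
  "\<one>\<^bsub>B\<^esub> = delta (biset_class G (regular_biset G))"
  by (simp_all add: free_biset_algebra_def Z_loc_ring_simps class_delta_eq)

lemma delta_mem_B: "C \<in> biset_classes G \<Longrightarrow> delta C \<in> carrier B"
  by (auto simp: carrier_B delta_def Z_closed)

lemma add_mem_B: "f \<in> carrier B \<Longrightarrow> g \<in> carrier B \<Longrightarrow> (\<lambda>C. f C + g C) \<in> carrier B"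
  unfolding carrier_B by (auto simp: Z_closed intro: finite_subset[of _ "{C. f C \<noteq> 0} \<union> {C. g C \<noteq> 0}"])

lemma smult_mem_B: "r \<in> Z_loc p \<Longrightarrow> f \<in> carrier B \<Longrightarrow> (\<lambda>C. r * f C) \<in> carrier B"
  unfolding carrier_B by (auto simp: Z_closed intro: finite_subset[of _ "{C. f C \<noteq> 0}"])

lemma abelian_group_B: "abelian_group B"
proof (rule abelian_groupI)
  fix f assume "f \<in> carrier B"
  then show "\<exists>g\<in>carrier B. g \<oplus>\<^bsub>B\<^esub> f = \<zero>\<^bsub>B\<^esub>"
    using smult_mem_B[OF Z_closed(4), of f] by (intro bexI[of _ "\<lambda>C. - 1 * f C"]) (simp_all add: B_simps)
qed (simp_all add: B_simps add_mem_B, auto simp: carrier_B Z_closed algebra_simps)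

lemma minus_B: "f \<in> carrier B \<Longrightarrow> g \<in> carrier B \<Longrightarrow> f \<ominus>\<^bsub>B\<^esub> g = (\<lambda>C. f C - g C)"
  using abelian_group.minus_equality[OF abelian_group_B, of "\<lambda>C. - 1 * g C" g] smult_mem_B[OF Z_closed(4), of g]
  by (simp add: B_simps a_minus_def)

text \<open>The condition on \<open>E\<close> moves from the index set into the summand, so that the
  index set is the same for all \<open>E\<close> and sums can be interchanged in
  \<open>lin_theta_mult\<close>.\<close>

lemma mult_B:
  assumes "f \<in> carrier B" "g \<in> carrier B"
  shows "(f \<otimes>\<^bsub>B\<^esub> g) E =
    (\<Sum>(C, D)\<in>{C. f C \<noteq> 0} \<times> {D. g D \<noteq> 0}. if class_mult G C D = E then f C * g D else 0)"
proof -
  let ?S = "{C. f C \<noteq> 0} \<times> {D. g D \<noteq> 0}"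
  have fin: "finite ?S"
    using assms by (simp add: carrier_B)
  have S: "{(C, D). f C \<noteq> 0 \<and> g D \<noteq> 0 \<and> class_mult G C D = E} = {q \<in> ?S. class_mult G (fst q) (snd q) = E}"
    by auto
  have "(f \<otimes>\<^bsub>B\<^esub> g) E = (\<Sum>q\<in>{q \<in> ?S. class_mult G (fst q) (snd q) = E}. f (fst q) * g (snd q))"
    unfolding free_biset_algebra_def Z_loc_ring_simps monoid.simps S
    using assms by (subst finsum_Z_loc_ring[OF p])
      (auto simp: carrier_B Z_closed case_prod_beta intro: finite_subset[OF _ fin])
  then show ?thesis
    using fin by (simp add: sum.inter_filter case_prod_beta)
qed

lemma mult_mem_B:
  assumes f: "f \<in> carrier B" and g: "g \<in> carrier B"
  shows "f \<otimes>\<^bsub>B\<^esub> g \<in> carrier B"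
proof -
  let ?S = "{C. f C \<noteq> 0} \<times> {D. g D \<noteq> 0}"
  let ?T = "(\<lambda>(C, D). class_mult G C D) ` ?S"
  have T: "finite ?T" "?T \<subseteq> biset_classes G"
    using f g by (simp add: carrier_B) (use f g in \<open>auto intro: class_mult_mem B_support\<close>)
  have "(f \<otimes>\<^bsub>B\<^esub> g) E = 0" if "E \<notin> ?T" for E
    unfolding mult_B[OF f g] using that by (intro sum.neutral) auto
  then have "{E. (f \<otimes>\<^bsub>B\<^esub> g) E \<noteq> 0} \<subseteq> ?T" by blast
  moreover have "(f \<otimes>\<^bsub>B\<^esub> g) E \<in> Z_loc p" for E
    unfolding mult_B[OF f g] using f g by (intro Z_loc_sum[OF p]) (auto simp: carrier_B Z_closed)
  ultimately show ?thesis
    using T unfolding carrier_B by (meson finite_subset mem_Collect_eq subset_iff)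
qed

lemma relation_mem:
  assumes M: "finite_biset G M" and N: "finite_biset G N"
  shows "(\<lambda>D. delta (biset_class G (disjoint_union_biset M N)) D -
      (delta (biset_class G M) D + delta (biset_class G N) D)) \<in> biset_relations (Z_loc_ring p) G"
proof -
  have mem: "delta (biset_class G P) \<in> carrier B" if "finite_biset G P" for P
    by (rule delta_mem_B[OF biset_class_mem[OF that]])
  obtain M' :: "('g, nat) biset" where M': "finite_biset G M'" "biset_isomorphic G M M'"
    using ex_nat_biset[OF M] .
  obtain N' :: "('g, nat) biset" where N': "finite_biset G N'" "biset_isomorphic G N N'"
    using ex_nat_biset[OF N] .
  have "biset_isomorphic G (disjoint_union_biset M N) (disjoint_union_biset M' N')"
  proof -
    obtain f where f: "bij_betw f (points M) (points M')"
      "\<forall>x. \<forall>m\<in>points M. f (lact M (e x) m) = lact M' (e x) (f m) \<and> f (ract M m (e x)) = ract M' (f m) (e x)"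
      using M'(2) unfolding biset_isomorphic_iff by blast
    obtain g where g: "bij_betw g (points N) (points N')"
      "\<forall>x. \<forall>m\<in>points N. g (lact N (e x) m) = lact N' (e x) (g m) \<and> g (ract N m (e x)) = ract N' (g m) (e x)"
      using N'(2) unfolding biset_isomorphic_iff by blast
    have fg: "inj_on f (points M)" "f ` points M = points M'" "inj_on g (points N)" "g ` points N = points N'"
      using f(1) g(1) by (auto simp: bij_betw_def)
    have "inj_on (map_sum f g) (Sum_Type.Plus (points M) (points N))"
      by (rule inj_onI, elim PlusE) (simp_all add: inj_on_eq_iff[OF fg(1)] inj_on_eq_iff[OF fg(3)])
    moreover have "map_sum f g ` Sum_Type.Plus (points M) (points N) = Sum_Type.Plus (points M') (points N')"
      by (simp add: Plus_def image_Un image_image flip: fg(2,4))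
    ultimately have "bij_betw (map_sum f g) (Sum_Type.Plus (points M) (points N)) (Sum_Type.Plus (points M') (points N'))"
      by (simp add: bij_betw_def)
    then show ?thesis
      unfolding biset_isomorphic_iff disjoint_union_biset_def
      using f(2) g(2) by (intro exI[of _ "map_sum f g"]) auto
  qed
  from biset_class_eqI[OF finite_biset_disjoint_union[OF M N] this]
    biset_class_eqI[OF M M'(2)] biset_class_eqI[OF N N'(2)]
  show ?thesis
    unfolding biset_relations_def class_delta_eq
    using M' N' finite_biset_disjoint_union[OF M'(1) N'(1)]
    by (intro CollectI exI[of _ M'] exI[of _ N'])
      (simp add: B_simps minus_B mem add_mem_B)
qed

text \<open>An orbit and its complement are both closed under the actions, the complement because
  the actions are invertible.\<close>

lemma split_orbit:
  assumes M: "finite_biset G M" and m: "m \<in> points M"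
  defines "M1 \<equiv> M\<lparr>points := range (bact M m)\<rparr>"
    and "M2 \<equiv> M\<lparr>points := points M - range (bact M m)\<rparr>"
  shows "finite_biset G M1" "finite_biset G M2" "biset_isomorphic G M (disjoint_union_biset M1 M2)"
proof -
  note D = finite_bisetD[OF M] and C = finite_biset_cancel[OF M]
  let ?P = "range (bact M m)"
  have P: "?P \<subseteq> points M"
    using m by (auto simp: bact_def D)
  have inP: "lact M (e x) q \<in> ?P" "ract M q (e x) \<in> ?P" if "q \<in> ?P" for q x
    using that bact_act[OF M m] by auto
  have outP: "lact M (e x) q \<notin> ?P" "ract M q (e x) \<notin> ?P" if "q \<in> points M" "q \<notin> ?P" for q x
    using that inP[of "lact M (e x) q" "- x"] inP[of "ract M q (e x)" "- x"] by (auto simp: C)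
  show "finite_biset G M1" "finite_biset G M2"
    using P unfolding finite_biset_iff M1_def M2_def
    by (auto simp: D inP outP finite_subset[OF P] subset_iff)
  let ?f = "\<lambda>q. if q \<in> ?P then Inl q else Inr q"
  have "bij_betw ?f (points M) (Sum_Type.Plus ?P (points M - ?P))"
    using P unfolding bij_betw_def Plus_def by (intro conjI inj_onI) (auto split: if_splits)
  then show "biset_isomorphic G M (disjoint_union_biset M1 M2)"
    unfolding biset_isomorphic_iff disjoint_union_biset_def M1_def M2_def
    by (intro exI[of _ ?f]) (auto simp: inP outP)
qed

end

section \<open>The localisation of \<open>\<Lambda>\<close> at 2\<close>

definition class_arr :: "rel_type \<Rightarrow> arr" where
  "class_arr \<tau> = arr_of (class_coords \<tau>)"

definition Lambda_two :: "arr set" where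
  "Lambda_two = {Arr s t u v w x y (Eta_Xi z1 z2 z3) | s t u v w x y z1 z2 z3.
        Arr s t u v w x y (Eta_Xi z1 z2 z3) \<in> A_over (Z_loc 2) \<and>
        cong_in (Z_loc 2) 8 (2 * w - 2 * z1) z2 \<and>
        cong_in (Z_loc 2) 4 z2 z3 \<and>
        cong_in (Z_loc 2) 4 z3 0 \<and>
        (\<forall>i. cong_in (Z_loc 2) 4 (x $ i) 0) \<and>
        cong_in (Z_loc 2) 2 y 0 \<and>
        (\<forall>i. cong_in (Z_loc 2) 2 (t $ i) 0) \<and>
        cong_in (Z_loc 2) 2 v 0}"

section \<open>The table as a basis: explicit linear algebra\<close>

lemmas Z2_closed = Z_loc_closed[OF two_is_prime_nat]

lemma rel_types_eq: "rel_types = List.product [(False, False, False), (True, False, False), (False, True, False)] sylow_types @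
    [((False, False, True), False, False, False), ((False, False, True), False, False, True)] @
    List.product [(True, True, True)] sylow_types"
  by code_simp

lemma distinct_rel_types: "distinct rel_types"
  by code_simp

lemma sum_rel_types: "(\<Sum>\<tau>\<in>set rel_types. f \<tau>) = sum_list (map f rel_types)" for f :: "_ \<Rightarrow> arr"
  using distinct_rel_types by (simp add: sum_list_distinct_conv_sum_set)

lemma ex_map_eq:
  assumes "distinct xs" "length ys = length xs"
  shows "\<exists>f. map f xs = ys"
proof (intro exI nth_equalityI)
  show "length (map (the \<circ> map_of (zip xs ys)) xs) = length ys"
    using assms by simp
  show "map (the \<circ> map_of (zip xs ys)) xs ! i = ys ! i"
    if "i < length (map (the \<circ> map_of (zip xs ys)) xs)" for i
    using assms that by (simp add: map_of_zip_nth)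
qed

lemma arr_smult_arr_of:
  "arr_smult r (arr_of (Coords s11 s12 s13 s21 s22 s23 s31 s32 s33 t1 t2 t3 u v w x1 x2 x3 y z1 z2 z3)) =
     Arr (vector [vector [r * of_int s11, r * of_int s12, r * of_int s13],
                  vector [r * of_int s21, r * of_int s22, r * of_int s23],
                  vector [r * of_int s31, r * of_int s32, r * of_int s33]])
       (vector [r * of_int t1, r * of_int t2, r * of_int t3]) (r * of_int u) (r * of_int v) (r * of_int w)
       (vector [r * of_int x1, r * of_int x2, r * of_int x3]) (r * of_int y)
       (Eta_Xi (r * of_int z1) (r * of_int z2) (r * of_int z3))"
  by (simp add: arr_smult_def times_eta_xi_def vec_eq_iff forall_3)

lemma vector_3_add: "vector [a, b, c] + vector [a', b', c'] = (vector [a + a', b + b', c + c'] :: 'a::ab_group_add ^ 3)"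
  by (simp add: vec_eq_iff forall_3)

lemma arr_add_Arr:
  "Arr s t u v w x y (Eta_Xi z1 z2 z3) + Arr s' t' u' v' w' x' y' (Eta_Xi z1' z2' z3') =
     Arr (s + s') (t + t') (u + u') (v + v') (w + w') (x + x') (y + y') (Eta_Xi (z1 + z1') (z2 + z2') (z3 + z3'))"
  by (simp add: plus_arr_def arr_add_def plus_eta_xi_def)

lemma map_class_coords: "map class_coords rel_types =
   [Coords 1 1 2 1 1 2 2 2 4 2 2 4 0 0 0 4 4 8 0 0 8 0,
    Coords 1 1 2 0 0 0 1 1 2 2 0 2 0 0 0 0 0 0 0 0 0 0,
    Coords 1 0 1 1 0 1 2 0 2 0 0 0 0 0 0 4 0 4 0 0 0 0,
    Coords 1 0 1 0 1 1 1 1 2 0 2 2 1 2 0 0 4 4 2 0 (- 40) 4,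
    Coords 1 0 1 0 0 0 1 0 1 0 0 0 0 0 0 0 0 0 0 0 0 0,
    Coords 1 1 2 1 1 2 0 0 0 2 2 0 0 0 0 0 0 0 0 0 0 0,
    Coords 1 1 2 0 0 0 0 0 0 2 0 0 0 0 0 0 0 0 0 0 0 0,
    Coords 1 0 1 1 0 1 0 0 0 0 0 0 0 0 0 0 0 0 0 0 0 0,
    Coords 1 0 1 0 1 1 0 0 0 0 2 0 1 2 0 0 0 0 0 0 0 0,
    Coords 1 0 1 0 0 0 0 0 0 0 0 0 0 0 0 0 0 0 0 0 0 0,
    Coords 1 1 0 1 1 0 2 2 0 0 0 0 0 0 0 4 4 0 0 0 0 0,
    Coords 1 1 0 0 0 0 1 1 0 0 0 0 0 0 0 0 0 0 0 0 0 0,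
    Coords 1 0 0 1 0 0 2 0 0 0 0 0 0 0 0 4 0 0 0 0 0 0,
    Coords 1 0 0 0 1 0 1 1 0 0 0 0 1 0 0 0 4 0 2 0 0 0,
    Coords 1 0 0 0 0 0 1 0 0 0 0 0 0 0 0 0 0 0 0 0 0 0,
    Coords 1 1 0 1 1 0 0 0 2 0 0 2 0 0 2 0 0 4 0 0 4 0,
    Coords 1 0 0 0 1 0 0 0 1 0 0 0 1 0 1 0 0 0 0 1 0 0,
    Coords 1 1 0 1 1 0 0 0 0 0 0 0 0 0 0 0 0 0 0 0 0 0,
    Coords 1 1 0 0 0 0 0 0 0 0 0 0 0 0 0 0 0 0 0 0 0 0,
    Coords 1 0 0 1 0 0 0 0 0 0 0 0 0 0 0 0 0 0 0 0 0 0,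
    Coords 1 0 0 0 1 0 0 0 0 0 0 0 1 0 0 0 0 0 0 0 0 0,
    Coords 1 0 0 0 0 0 0 0 0 0 0 0 0 0 0 0 0 0 0 0 0 0]"
  by code_simp

text \<open>The letters \<open>a\<close>, \<open>b\<close>, \<open>c\<close>, \<open>d\<close>,
  \<open>f\<close> stand for a trivial, left, right, diagonal and full Sylow 3-subgroup. The digits
  number the Sylow 2-subgroups in the order of \<open>sylow_types\<close>, except that
  \<open>d1\<close> and \<open>d2\<close> are the trivial and the diagonal one.\<close>

lemma class_arr_combination:
  assumes "map r rel_types =
    [a1, a2, a3, a4, a5, b1, b2, b3, b4, b5, c1, c2, c3, c4, c5, d1, d2, f1, f2, f3, f4, f5]"
  shows "(\<Sum>\<tau>\<in>set rel_types. arr_smult (r \<tau>) (class_arr \<tau>)) =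
   Arr (vector [vector [a1 + a2 + a3 + a4 + a5 + b1 + b2 + b3 + b4 + b5 + c1 + c2 + c3 + c4 + c5 + d1 + d2 + f1 + f2 + f3 + f4 + f5,
       a1 + a2 + b1 + b2 + c1 + c2 + d1 + f1 + f2,
       2 * a1 + 2 * a2 + a3 + a4 + a5 + 2 * b1 + 2 * b2 + b3 + b4 + b5],
      vector [a1 + a3 + b1 + b3 + c1 + c3 + d1 + f1 + f3,
       a1 + a4 + b1 + b4 + c1 + c4 + d1 + d2 + f1 + f4,
       2 * a1 + a3 + a4 + 2 * b1 + b3 + b4],
      vector [2 * a1 + a2 + 2 * a3 + a4 + a5 + 2 * c1 + c2 + 2 * c3 + c4 + c5,
       2 * a1 + a2 + a4 + 2 * c1 + c2 + c4,
       4 * a1 + 2 * a2 + 2 * a3 + 2 * a4 + a5 + 2 * d1 + d2]])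
     (vector [2 * a1 + 2 * a2 + 2 * b1 + 2 * b2,
       2 * a1 + 2 * a4 + 2 * b1 + 2 * b4,
       4 * a1 + 2 * a2 + 2 * a4 + 2 * d1])
     (a4 + b4 + c4 + d2 + f4) (2 * a4 + 2 * b4) (2 * d1 + d2)
     (vector [4 * a1 + 4 * a3 + 4 * c1 + 4 * c3,
       4 * a1 + 4 * a4 + 4 * c1 + 4 * c4,
       8 * a1 + 4 * a3 + 4 * a4 + 4 * d1])
     (2 * a4 + 2 * c4)
     (Eta_Xi d2 (8 * a1 - 40 * a4 + 4 * d1) (4 * a4))"
proof -
  have "(\<Sum>\<tau>\<in>set rel_types. arr_smult (r \<tau>) (class_arr \<tau>)) =
      sum_list (map2 arr_smult (map r rel_types) (map class_arr rel_types))"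
    by (simp add: sum_rel_types map2_map_map)
  also have "map class_arr rel_types = map arr_of (map class_coords rel_types)"
    by (simp add: class_arr_def)
  finally show ?thesis
    unfolding assms map_class_coords
    by (simp add: arr_smult_arr_of arr_add_Arr vector_3_add del: arr_of.simps) (simp add: algebra_simps)
qed

lemma Lambda_two_span:
  assumes "a \<in> Lambda_two"
  shows "\<exists>r. (\<forall>\<tau>\<in>set rel_types. r \<tau> \<in> Z_loc 2) \<and> a = (\<Sum>\<tau>\<in>set rel_types. arr_smult (r \<tau>) (class_arr \<tau>))"
proof -
  obtain s t u v w x y z1 z2 z3 where a: "a = Arr s t u v w x y (Eta_Xi z1 z2 z3)"
    and A: "Arr s t u v w x y (Eta_Xi z1 z2 z3) \<in> A_over (Z_loc 2)"
    and cong: "cong_in (Z_loc 2) 8 (2 * w - 2 * z1) z2" "cong_in (Z_loc 2) 4 z2 z3" "cong_in (Z_loc 2) 4 z3 0"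
      "\<And>i. cong_in (Z_loc 2) 4 ((x :: rat^3) $ i) 0" "cong_in (Z_loc 2) 2 y 0" "\<And>i. cong_in (Z_loc 2) 2 ((t :: rat^3) $ i) 0"
      "cong_in (Z_loc 2) 2 v 0"
    using assms unfolding Lambda_two_def by blast
  have mem: "s $ i $ j \<in> Z_loc 2" "u \<in> Z_loc 2" "z1 \<in> Z_loc 2" for i j
    using A unfolding A_over_def by auto
  obtain r q z3' v' y' where *: "r \<in> Z_loc 2" "2 * w - 2 * z1 - z2 = 8 * r" "q \<in> Z_loc 2" "z2 - z3 = 4 * q"
    "z3' \<in> Z_loc 2" "z3 = 4 * z3'" "v' \<in> Z_loc 2" "v = 2 * v'" "y' \<in> Z_loc 2" "y = 2 * y'"
    using cong(1-3,5,7) unfolding cong_in_def by auto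
  have "\<exists>t'\<in>Z_loc 2. t $ i = 2 * t'" "\<exists>x'\<in>Z_loc 2. x $ i = 4 * x'" for i
    using cong(4)[of i] cong(6)[of i] unfolding cong_in_def by auto
  then obtain t1 t2 t3 x1 x2 x3 where tx: "t1 \<in> Z_loc 2" "t2 \<in> Z_loc 2" "t3 \<in> Z_loc 2"
    "x1 \<in> Z_loc 2" "x2 \<in> Z_loc 2" "x3 \<in> Z_loc 2"
    "t $ 1 = 2 * t1" "t $ 2 = 2 * t2" "t $ 3 = 2 * t3" "x $ 1 = 4 * x1" "x $ 2 = 4 * x2" "x $ 3 = 4 * x3"
    by metis
  \<comment> \<open>This is the coefficient \<open>d1\<close>, forced by
    \<open>w = 2 * d1 + d2\<close> and \<open>z1 = d2\<close>. The equation
    \<open>z2 = 8 * a1 - 40 * a4 + 4 * d1\<close> with \<open>a4 = z3'\<close> is then solved by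
    \<open>a1 = 5 * z3' - r\<close>, which is where the congruence modulo 8 enters.\<close>
  define w' where "w' = 2 * r + q + z3'"
  have w': "w' \<in> Z_loc 2" "w = z1 + 2 * w'" "z2 = 4 * w' - 8 * r"
    using * by (simp_all add: w'_def Z2_closed)
  define vs where "vs =
    [- r + 5 * z3',
        t3 - w' + 2 * r - 11 * z3',
        - w' + x3 + 2 * r - 11 * z3',
        z3',
        s $ 3 $ 3 - 2 * t3 + 2 * w' - 2 * x3 - z1 - 4 * r + 22 * z3',
        t2 - v' + r - 5 * z3',
        t1 - t2 - t3 + v' + w' - 2 * r + 11 * z3',
        s $ 2 $ 3 - 2 * t2 + v' + w' - x3 - 2 * r + 11 * z3',
        v' - z3',
        s $ 1 $ 3 - s $ 2 $ 3 - s $ 3 $ 3 - 2 * t1 + 2 * t2 + 2 * t3 - 2 * v' - 2 * w' + 2 * x3 + z1 + 4 * r - 22 * z3',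
        x2 - y' + r - 5 * z3',
        s $ 3 $ 2 - t3 + w' - 2 * x2 + y' - 2 * r + 11 * z3',
        w' + x1 - x2 - x3 + y' - 2 * r + 11 * z3',
        y' - z3',
        s $ 3 $ 1 - s $ 3 $ 2 - s $ 3 $ 3 + 2 * t3 - 2 * w' - 2 * x1 + 2 * x2 + 2 * x3 - 2 * y' + z1 + 4 * r - 22 * z3',
        w',
        z1,
        s $ 2 $ 2 - t2 - u + v' - w' - x2 + y' - r + 5 * z3',
        s $ 1 $ 2 - s $ 2 $ 2 - s $ 3 $ 2 - t1 + t2 + t3 + u - v' - w' + 2 * x2 - y' + 2 * r - 11 * z3',
        s $ 2 $ 1 - s $ 2 $ 2 - s $ 2 $ 3 + 2 * t2 + u - v' - w' - x1 + x2 + x3 - y' + 2 * r - 11 * z3',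
        u - v' - y' - z1 + z3',
        s $ 1 $ 1 - s $ 1 $ 2 - s $ 1 $ 3 - s $ 2 $ 1 + s $ 2 $ 2 + s $ 2 $ 3 - s $ 3 $ 1 + s $ 3 $ 2 + s $ 3 $ 3 + 2 * t1 - 2 * t2 - 2 * t3 - 2 * u + 2 * v' + 2 * w' + 2 * x1 - 2 * x2 - 2 * x3 + 2 * y' - z1 - 4 * r + 22 * z3']"
  have "length vs = length rel_types"
    by (simp add: vs_def rel_types_eq sylow_types_def)
  then obtain f where f: "map f rel_types = vs"
    using ex_map_eq[OF distinct_rel_types] by blast
  have "\<forall>c\<in>set vs. c \<in> Z_loc 2"
    using mem *(1,5,7,9) tx(1-6) w'(1) by (simp add: vs_def Z2_closed)
  then have "\<forall>\<tau>\<in>set rel_types. f \<tau> \<in> Z_loc 2"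
    unfolding f[symmetric] by simp
  moreover have "a = (\<Sum>\<tau>\<in>set rel_types. arr_smult (f \<tau>) (class_arr \<tau>))"
    unfolding class_arr_combination[OF f[unfolded vs_def]] a
    by (simp add: vec_eq_iff forall_3 tx(7-12) *(6,8,10) w'(2,3))
  ultimately show ?thesis by blast
qed

lemma class_arr_independent:
  assumes eq: "(\<Sum>\<tau>\<in>set rel_types. arr_smult (r \<tau>) (class_arr \<tau>)) = 0" and "\<tau> \<in> set rel_types"
  shows "r \<tau> = 0"
proof -
  obtain a1 a2 a3 a4 a5 b1 b2 b3 b4 b5 c1 c2 c3 c4 c5 d1 d2 f1 f2 f3 f4 f5 where r: "map r rel_types = [a1, a2, a3, a4, a5, b1, b2, b3, b4, b5, c1, c2, c3, c4, c5, d1, d2, f1, f2, f3, f4, f5]"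
    by (simp add: rel_types_eq sylow_types_def)
  \<comment> \<open>The same triangular system with right-hand side zero.\<close>
  have "\<forall>c\<in>set (map r rel_types). c = 0"
    using eq unfolding class_arr_combination[OF r] r zero_arr_def zero_eta_xi_def
    by (simp add: vec_eq_iff forall_3)
  then show ?thesis
    using assms(2) by simp
qed

section \<open>The congruences define a submodule that agrees with the localisation\<close>

lemma Arr_mem_A_over:
  "Arr s t u v w x y (Eta_Xi z1 z2 z3) \<in> A_over S \<longleftrightarrow>
     (\<forall>i j. s $ i $ j \<in> S) \<and> (\<forall>i. t $ i \<in> S) \<and> u \<in> S \<and> v \<in> S \<and> w \<in> S \<and>
     (\<forall>i. x $ i \<in> S) \<and> y \<in> S \<and> z1 \<in> S \<and> z2 \<in> S \<and> z3 \<in> S"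
  unfolding A_over_def by blast

lemma Arr_mem_Lambda_two:
  "Arr s t u v w x y (Eta_Xi z1 z2 z3) \<in> Lambda_two \<longleftrightarrow>
     Arr s t u v w x y (Eta_Xi z1 z2 z3) \<in> A_over (Z_loc 2) \<and>
     cong_in (Z_loc 2) 8 (2 * w - 2 * z1) z2 \<and> cong_in (Z_loc 2) 4 z2 z3 \<and> cong_in (Z_loc 2) 4 z3 0 \<and>
     (\<forall>i. cong_in (Z_loc 2) 4 (x $ i) 0) \<and> cong_in (Z_loc 2) 2 y 0 \<and>
     (\<forall>i. cong_in (Z_loc 2) 2 (t $ i) 0) \<and> cong_in (Z_loc 2) 2 v 0"
  unfolding Lambda_two_def by blast

lemma Arr_mem_Lambda:
  "Arr s t u v w x y (Eta_Xi z1 z2 z3) \<in> Lambda \<longleftrightarrow>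
     Arr s t u v w x y (Eta_Xi z1 z2 z3) \<in> A_over \<int> \<and>
     cong_in \<int> 8 (2 * w - 2 * z1) z2 \<and> cong_in \<int> 4 z2 z3 \<and> cong_in \<int> 4 z3 0 \<and>
     (\<forall>i. cong_in \<int> 4 (x $ i) 0) \<and> cong_in \<int> 2 y 0 \<and>
     (\<forall>i. cong_in \<int> 2 (t $ i) 0) \<and> cong_in \<int> 2 v 0 \<and>
     (\<forall>i. cong_in \<int> 3 (x $ i) 0) \<and> cong_in \<int> 3 z2 0"
  unfolding Lambda_def by blast

lemma arr_cases:
  obtains s t u v w x y z1 z2 z3 where "a = Arr s t u v w x y (Eta_Xi z1 z2 z3)"
  by (metis arr.exhaust eta_xi.exhaust)

lemma cong_in_Z2_add:
  assumes "cong_in (Z_loc 2) m a b" "cong_in (Z_loc 2) m a' b'" "c = a + a'" "d = b + b'"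
  shows "cong_in (Z_loc 2) m c d"
proof -
  obtain r r' where "r \<in> Z_loc 2" "a - b = m * r" "r' \<in> Z_loc 2" "a' - b' = m * r'"
    using assms(1,2) by (auto simp: cong_in_def)
  then show ?thesis
    unfolding cong_in_def assms(3,4) by (intro bexI[of _ "r + r'"]) (simp_all add: Z2_closed algebra_simps)
qed

lemma cong_in_Z2_mult:
  assumes "cong_in (Z_loc 2) m a b" "k \<in> Z_loc 2" "c = k * a" "d = k * b"
  shows "cong_in (Z_loc 2) m c d"
proof -
  obtain r where "r \<in> Z_loc 2" "a - b = m * r"
    using assms(1) by (auto simp: cong_in_def)
  then show ?thesis
    unfolding cong_in_def assms(3,4) using assms(2)
    by (intro bexI[of _ "k * r"]) (simp_all add: Z2_closed mult.left_commute flip: right_diff_distrib)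
qed

lemma Lambda_two_add:
  assumes "a \<in> Lambda_two" "b \<in> Lambda_two"
  shows "a + b \<in> Lambda_two"
proof -
  obtain s t u v w x y z1 z2 z3 where a: "a = Arr s t u v w x y (Eta_Xi z1 z2 z3)"
    by (rule arr_cases)
  obtain s' t' u' v' w' x' y' z1' z2' z3' where b: "b = Arr s' t' u' v' w' x' y' (Eta_Xi z1' z2' z3')"
    by (rule arr_cases)
  have add0: "cong_in (Z_loc 2) m (c + d) 0" if "cong_in (Z_loc 2) m c 0" "cong_in (Z_loc 2) m d 0" for m c d
    using cong_in_Z2_add[OF that] by simp
  show ?thesis
    using assms unfolding a b arr_add_Arr Arr_mem_Lambda_two Arr_mem_A_over
    by (auto simp: Z2_closed add0 elim: cong_in_Z2_add)
qed

lemma arr_smult_Arr: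
  "arr_smult r (Arr s t u v w x y (Eta_Xi z1 z2 z3)) = Arr (\<chi> i j. r * s $ i $ j) (\<chi> i. r * t $ i)
     (r * u) (r * v) (r * w) (\<chi> i. r * x $ i) (r * y) (Eta_Xi (r * z1) (r * z2) (r * z3))"
  by (simp add: arr_smult_def times_eta_xi_def)

lemma Lambda_two_smult:
  assumes "a \<in> Lambda_two" and r: "r \<in> Z_loc 2"
  shows "arr_smult r a \<in> Lambda_two"
proof -
  obtain s t u v w x y z1 z2 z3 where a: "a = Arr s t u v w x y (Eta_Xi z1 z2 z3)"
    by (rule arr_cases)
  have mult0: "cong_in (Z_loc 2) m (r * c) 0" if "cong_in (Z_loc 2) m c 0" for m c
    using cong_in_Z2_mult[OF that r] by simp
  show ?thesis
    using assms(1) cong_in_Z2_mult[of 8 "2 * w - 2 * z1" z2 r "2 * (r * w) - 2 * (r * z1)"]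
    unfolding a arr_smult_Arr Arr_mem_Lambda_two Arr_mem_A_over
    by (auto simp: Z2_closed r mult0 algebra_simps intro: cong_in_Z2_mult[of 4 z2 z3 r])
qed

lemma Lambda_subset: "Lambda \<subseteq> Lambda_two"
proof -
  have Ints: "x \<in> Z_loc 2" if "x \<in> \<int>" for x :: rat
    using that Z_loc_of_int[OF two_is_prime_nat] by (auto elim: Ints_cases)
  have cong: "cong_in (Z_loc 2) m a b" if "cong_in \<int> m a b" for m a b
    using that Ints unfolding cong_in_def by blast
  show ?thesis
  proof
    fix a assume a: "a \<in> Lambda"
    obtain s t u v w x y z1 z2 z3 where "a = Arr s t u v w x y (Eta_Xi z1 z2 z3)"
      by (rule arr_cases)
    with a show "a \<in> Lambda_two"
      by (simp add: Arr_mem_Lambda Arr_mem_Lambda_two Arr_mem_A_over Ints cong)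
  qed
qed

lemma alg_A_simps:
  "carrier alg_A = UNIV" "x \<oplus>\<^bsub>alg_A\<^esub> y = x + y" "\<zero>\<^bsub>alg_A\<^esub> = 0" "x \<otimes>\<^bsub>alg_A\<^esub> y = x * y"
  "\<one>\<^bsub>alg_A\<^esub> = 1" "r \<odot>\<^bsub>alg_A\<^esub> x = arr_smult r x"
  by (simp_all add: alg_A_def plus_arr_def zero_arr_def times_arr_def one_arr_def)

lemma submodule_Lambda_two: "submodule Lambda_two (Z_loc_ring 2) alg_A"
proof (rule submodule_negI)
  have "cong_in (Z_loc 2) m 0 0" for m
    by (auto simp: cong_in_def Z2_closed intro!: bexI[of _ 0])
  then show "\<zero>\<^bsub>alg_A\<^esub> \<in> Lambda_two"
    unfolding alg_A_simps zero_arr_def zero_eta_xi_def Arr_mem_Lambda_two Arr_mem_A_over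
    by (simp add: Z2_closed)
  have "arr_smult (- 1) x + x = 0" for x
    using arr.scale_left_distrib[of "- 1" 1 x] by simp
  then show "(- 1 \<odot>\<^bsub>alg_A\<^esub> x) \<oplus>\<^bsub>alg_A\<^esub> x = \<zero>\<^bsub>alg_A\<^esub>" for x
    by (simp add: alg_A_simps)
qed (simp_all add: alg_A_simps Z_loc_ring_simps Lambda_two_add Lambda_two_smult Z2_closed
      ring.is_abelian_group[OF ring_alg_A])

text \<open>Locally at 2 the congruences modulo 3 are void, as \<open>3\<close> times each of the 22 basis elements lies
  in \<open>\<Lambda>\<close>.\<close>

fun in_Lambda :: "coords \<Rightarrow> bool" where
  "in_Lambda (Coords s11 s12 s13 s21 s22 s23 s31 s32 s33 t1 t2 t3 u v w x1 x2 x3 y z1 z2 z3) \<longleftrightarrow>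
     8 dvd 2 * w - 2 * z1 - z2 \<and> 4 dvd z2 - z3 \<and> 4 dvd z3 \<and> 4 dvd x1 \<and> 4 dvd x2 \<and> 4 dvd x3 \<and>
     2 dvd y \<and> 2 dvd t1 \<and> 2 dvd t2 \<and> 2 dvd t3 \<and> 2 dvd v \<and> 3 dvd x1 \<and> 3 dvd x2 \<and> 3 dvd x3 \<and> 3 dvd z2"

lemma arr_of_mem_Lambda:
  assumes "in_Lambda c"
  shows "arr_of c \<in> Lambda"
proof -
  have cong: "cong_in \<int> (of_int m) (of_int a) (of_int b)" if dvd: "m dvd a - b" for m a b
  proof -
    obtain k where "a - b = m * k"
      using dvd by blast
    then have "of_int a - of_int b = (of_int m * of_int k :: rat)"
      by (metis of_int_diff of_int_mult)
    then show ?thesis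
      unfolding cong_in_def by (intro bexI[of _ "of_int k"]) simp_all
  qed
  have cong0: "cong_in \<int> (of_int m) (of_int a) 0" if "m dvd a" for m a
    using cong[of m a 0] that by simp
  show ?thesis
    using assms
  proof (cases c)
    case (Coords s11 s12 s13 s21 s22 s23 s31 s32 s33 t1 t2 t3 u v w x1 x2 x3 y z1 z2 z3)
    then show ?thesis
      using assms cong[of 8 "2 * w - 2 * z1" z2] cong[of 4 z2 z3] cong0[of 4] cong0[of 2] cong0[of 3]
      by (simp add: Arr_mem_Lambda Arr_mem_A_over forall_3)
  qed
qed

lemma three_class_coords: "list_all (\<lambda>\<tau>. in_Lambda (coords_scale 3 (class_coords \<tau>))) rel_types"
  by code_simp

lemma combination_mem_Lambda_loc:
  assumes r: "\<And>\<tau>. \<tau> \<in> set rel_types \<Longrightarrow> r \<tau> \<in> Z_loc 2"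
  shows "(\<Sum>\<tau>\<in>set rel_types. arr_smult (r \<tau>) (class_arr \<tau>)) \<in> Lambda_loc 2"
  unfolding Lambda_loc_def mem_generated_submodule
proof (intro allI impI, elim conjE)
  fix H assume H: "submodule H (Z_loc_ring 2) alg_A" and L: "Lambda \<subseteq> H"
  note D = submoduleD[OF H, unfolded alg_A_simps Z_loc_ring_simps]
  have third: "1 / 3 \<in> Z_loc 2"
    unfolding Z_loc_def by (intro CollectI exI[of _ 1] exI[of _ 3]) simp
  have "arr_smult (r \<tau>) (class_arr \<tau>) \<in> H" if \<tau>: "\<tau> \<in> set rel_types" for \<tau>
  proof -
    have "arr_smult 3 (class_arr \<tau>) \<in> H"
      using three_class_coords \<tau> L arr_of_mem_Lambda[of "coords_scale 3 (class_coords \<tau>)"]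
      by (auto simp: list_all_iff arr_of_scale class_arr_def)
    from D(4)[OF Z2_closed(8)[OF r[OF \<tau>] third] this] show ?thesis
      by simp
  qed
  then have "sum (\<lambda>\<tau>. arr_smult (r \<tau>) (class_arr \<tau>)) A \<in> H" if "A \<subseteq> set rel_types" for A
    using that by (induction A rule: infinite_finite_induct) (auto intro: D(2,3))
  then show "(\<Sum>\<tau>\<in>set rel_types. arr_smult (r \<tau>) (class_arr \<tau>)) \<in> H"
    by blast
qed

lemma Lambda_loc_two: "Lambda_loc 2 = Lambda_two"
proof
  show "Lambda_loc 2 \<subseteq> Lambda_two"
    using submodule_Lambda_two Lambda_subset by (auto simp: Lambda_loc_def mem_generated_submodule)
  show "Lambda_two \<subseteq> Lambda_loc 2"
    using Lambda_two_span combination_mem_Lambda_loc by fastforce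
qed

section \<open>The isomorphism\<close>

lemma card_std_rel:
  assumes "\<tau> \<in> set rel_types"
  shows "int (card (std_rel \<tau>)) = std_size \<tau>"
proof -
  have check: "list_all (\<lambda>\<tau>. int (length (filter (\<lambda>(x, y). in_std \<tau> x y) (List.product s3_elems s3_elems))) =
      std_size \<tau>) rel_types"
    by code_simp
  let ?xs = "filter (\<lambda>(x, y). in_std \<tau> x y) (List.product s3_elems s3_elems)"
  have "distinct ?xs"
    by (intro distinct_filter distinct_product) (simp_all add: s3_elems_def)
  moreover have "std_rel \<tau> = set ?xs"
    by (auto simp: std_rel_def set_s3_elems simp del: in_std.simps)
  ultimately have "card (std_rel \<tau>) = length ?xs"
    by (metis distinct_card)
  with check assms show ?thesis
    by (simp add: list_all_iff)
qed

lemma class_arr_one: "class_arr ((False, False, True), (False, False, True)) = 1"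
  by (simp add: class_arr_def class_coords_def one_arr_def one_eta_xi_def vec_eq_iff forall_3 mat_def)

lemma arr_of_nat_cancel:
  assumes "of_nat n * a = of_nat n * b" "n > 0"
  shows "a = (b :: arr)"
  using assms by (simp add: of_nat_mult_arr)

locale s3_model = burnside_model G e p
  for G :: "('g, 'x) monoid_scheme" (structure) and e :: "s3 \<Rightarrow> 'g" and p :: nat
begin

lemma theta_std:
  assumes \<tau>: "\<tau> \<in> set rel_types"
  shows "theta psi (coset_biset (std_rel \<tau>)) = class_arr \<tau>"
proof -
  let ?n = "card (range (\<lambda>(a, b). shift a b (std_rel \<tau>)))"
  have "card (std_rel \<tau>) * ?n = 36"
    using card_cosets[OF subgroup_rel_std_rel[OF \<tau>]] by (simp add: card_s3)
  then have "int (card (std_rel \<tau>)) * int ?n = 36"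
    by (metis of_nat_mult of_nat_numeral)
  then have "of_int (std_size \<tau> * int ?n) = (of_int 36 :: rat)"
    unfolding card_std_rel[OF \<tau>] by (simp only:)
  then have "of_nat ?n * (of_int (std_size \<tau>) / 36) = (1 :: rat)"
    by (simp add: mult.commute)
  then show ?thesis
    unfolding theta_coset_biset[OF subgroup_rel_std_rel[OF \<tau>], of psi, OF psi_conj] psi_std_rel[OF \<tau>]
    by (simp add: of_nat_mult_arr class_arr_def)
qed

lemma class_theta_mult_psi:
  assumes "C \<in> biset_classes G" "D \<in> biset_classes G"
  shows "class_theta psi (class_mult G C D) = class_theta psi C * class_theta psi D"
  by (rule arr_of_nat_cancel[OF class_theta_mult[OF mackey_psi assms]]) (simp_all add: card_s3)

lemma finite_biset_regular: "finite_biset G (regular_biset G)"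
proof -
  interpret group G by (rule group_G)
  have "finite (carrier G)"
    by (simp add: range_e)
  then show ?thesis
    by (simp add: finite_biset_iff regular_biset_def e_zero e_add m_assoc)
qed

text \<open>The group acts transitively on itself, and \<open>(g, h)\<close> satisfies
  \<open>g 1 = 1 h\<close> iff \<open>g = h\<close>; the stabiliser is therefore the full diagonal
  group, whose table entry is the unit.\<close>

lemma class_theta_regular: "class_theta psi (biset_class G (regular_biset G)) = 1"
proof -
  interpret group G by (rule group_G)
  let ?\<tau> = "((False, False, True), (False, False, True))"
  have \<tau>: "?\<tau> \<in> set rel_types"
    by (simp add: mem_rel_types sylow_types_def)
  have std: "std_rel ?\<tau> = Id"
  proof -
    have "in_std ?\<tau> x y \<longleftrightarrow> x = y" for x y
      by (cases x; cases y; simp)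
    then show ?thesis
      by (auto simp: std_rel_def)
  qed
  have bact: "bact (regular_biset G) \<one> (x, y) = e (x + y)" for x y
    by (simp add: bact_def regular_biset_def e_add)
  have "range (bact (regular_biset G) \<one>) = range e"
  proof (intro subset_antisym subsetI)
    show "z \<in> range e" if "z \<in> range (bact (regular_biset G) \<one>)" for z
      using that by (auto simp: bact)
    fix z assume "z \<in> range e"
    then obtain x where "z = bact (regular_biset G) \<one> (x, 0)"
      by (auto simp: bact)
    then show "z \<in> range (bact (regular_biset G) \<one>)"
      by (rule range_eqI)
  qed
  moreover have "points (regular_biset G) = range e"
    by (simp add: regular_biset_def range_e)
  ultimately have "points (regular_biset G) = range (bact (regular_biset G) \<one>)"
    by simp
  moreover have "stab (regular_biset G) \<one> = Id"
    using bij_betw_imp_inj_on[OF bij_e] by (auto simp: stab_def regular_biset_def inj_eq)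
  ultimately have iso: "biset_isomorphic G (regular_biset G) (coset_biset (std_rel ?\<tau>))"
    using stab_coset_biset[OF subgroup_rel_std_rel[OF \<tau>]]
    by (intro transitive_isomorphic[OF finite_biset_regular _ _ finite_biset_coset_biset
          base_point_coset_biset points_coset_biset]) (simp_all add: std, simp add: regular_biset_def)
  show ?thesis
    unfolding class_theta[OF finite_biset_regular] theta_isomorphic[OF finite_biset_regular iso]
      theta_std[OF \<tau>] by (rule class_arr_one)
qed

section \<open>The linear extension to the free biset algebra\<close>

definition lin_theta :: "(('g, nat) biset set \<Rightarrow> rat) \<Rightarrow> arr" where
  "lin_theta f = (\<Sum>C | f C \<noteq> 0. arr_smult (f C) (class_theta psi C))"

lemma lin_theta_eq:
  assumes "finite S" "\<And>C. f C \<noteq> 0 \<Longrightarrow> C \<in> S"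
  shows "lin_theta f = (\<Sum>C\<in>S. arr_smult (f C) (class_theta psi C))"
  unfolding lin_theta_def using assms by (intro sum.mono_neutral_left) auto

lemma lin_theta_delta: "lin_theta (delta C) = class_theta psi C"
  by (subst lin_theta_eq[of "{C}"]) (auto simp: delta_def split: if_splits)

lemma finite_support: "f \<in> carrier B \<Longrightarrow> finite {C. f C \<noteq> 0}"
  by (simp add: carrier_B)

lemma lin_theta_add:
  assumes "f \<in> carrier B" "g \<in> carrier B"
  shows "lin_theta (\<lambda>C. f C + g C) = lin_theta f + lin_theta g"
proof -
  let ?S = "{C. f C \<noteq> 0} \<union> {C. g C \<noteq> 0}"
  have S: "finite ?S"
    using assms finite_support by blast
  show ?thesis
    by (subst (1 2 3) lin_theta_eq[OF S]) (auto simp: arr.scale_left_distrib sum.distrib)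
qed

lemma lin_theta_smult:
  assumes "f \<in> carrier B"
  shows "lin_theta (\<lambda>C. r * f C) = arr_smult r (lin_theta f)"
  by (subst (1 2) lin_theta_eq[OF finite_support[OF assms]]) (auto simp: arr.scale_sum_right)

lemma lin_theta_mult:
  assumes f: "f \<in> carrier B" and g: "g \<in> carrier B"
  shows "lin_theta (f \<otimes>\<^bsub>B\<^esub> g) = lin_theta f * lin_theta g"
proof -
  let ?S = "{C. f C \<noteq> 0} \<times> {D. g D \<noteq> 0}"
  let ?m = "\<lambda>(C, D). class_mult G C D"
  let ?T = "?m ` ?S"
  have S: "finite ?S"
    using f g finite_support by blast
  have supp: "E \<in> ?T" if "(f \<otimes>\<^bsub>B\<^esub> g) E \<noteq> 0" for E
  proof (rule ccontr)
    assume "E \<notin> ?T"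
    then have "(f \<otimes>\<^bsub>B\<^esub> g) E = 0"
      unfolding mult_B[OF f g] by (intro sum.neutral) auto
    with that show False by contradiction
  qed
  have "lin_theta (f \<otimes>\<^bsub>B\<^esub> g) = (\<Sum>E\<in>?T. arr_smult ((f \<otimes>\<^bsub>B\<^esub> g) E) (class_theta psi E))"
    using S supp by (intro lin_theta_eq) blast+
  also have "\<dots> = (\<Sum>E\<in>?T. \<Sum>(C, D)\<in>?S. if class_mult G C D = E then arr_smult (f C * g D) (class_theta psi E) else 0)"
    unfolding mult_B[OF f g] arr.scale_sum_left
    by (intro sum.cong refl) (auto split: prod.splits)
  also have "\<dots> = (\<Sum>(C, D)\<in>?S. \<Sum>E\<in>?T. if class_mult G C D = E then arr_smult (f C * g D) (class_theta psi E) else 0)"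
    unfolding case_prod_beta by (rule sum.swap)
  also have "\<dots> = (\<Sum>(C, D)\<in>?S. arr_smult (f C * g D) (class_theta psi (class_mult G C D)))"
    using S by (intro sum.cong refl) (auto simp: sum.delta')
  also have "\<dots> = (\<Sum>(C, D)\<in>?S. arr_smult (f C) (class_theta psi C) * arr_smult (g D) (class_theta psi D))"
    using B_support[OF f] B_support[OF g]
    by (intro sum.cong refl) (auto simp: class_theta_mult_psi arr_smult_mult mult.commute)
  also have "\<dots> = lin_theta f * lin_theta g"
    unfolding lin_theta_def sum_product by (simp add: sum.cartesian_product)
  finally show ?thesis .
qed

definition combination :: "(rel_type \<Rightarrow> rat) \<Rightarrow> ('g, nat) biset set \<Rightarrow> rat" where
  "combination r C = (\<Sum>\<tau>\<in>set rel_types. r \<tau> * delta (biset_class G (coset_biset (std_rel \<tau>))) C)"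

lemma sum_mem_B:
  assumes "finite A" "\<And>i. i \<in> A \<Longrightarrow> f i \<in> carrier B"
  shows "(\<lambda>C. \<Sum>i\<in>A. f i C) \<in> carrier B \<and> lin_theta (\<lambda>C. \<Sum>i\<in>A. f i C) = (\<Sum>i\<in>A. lin_theta (f i))"
  using assms
proof (induction A)
  case empty
  then show ?case
    by (simp add: carrier_B Z_closed lin_theta_def)
next
  case (insert a A)
  then show ?case
    using lin_theta_add[of "f a" "\<lambda>C. \<Sum>i\<in>A. f i C"] add_mem_B[of "f a" "\<lambda>C. \<Sum>i\<in>A. f i C"] by simp
qed

lemma combination:
  assumes r: "\<And>\<tau>. \<tau> \<in> set rel_types \<Longrightarrow> r \<tau> \<in> Z_loc p"
  shows "combination r \<in> carrier B" "lin_theta (combination r) = (\<Sum>\<tau>\<in>set rel_types. arr_smult (r \<tau>) (class_arr \<tau>))"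
proof -
  let ?f = "\<lambda>\<tau> C. r \<tau> * delta (biset_class G (coset_biset (std_rel \<tau>))) C"
  have d: "delta (biset_class G (coset_biset (std_rel \<tau>))) \<in> carrier B" for \<tau>
    by (rule delta_mem_B[OF biset_class_mem[OF finite_biset_coset_biset]])
  then have f: "?f \<tau> \<in> carrier B" if "\<tau> \<in> set rel_types" for \<tau>
    using smult_mem_B r that by blast
  have comb: "combination r = (\<lambda>C. \<Sum>\<tau>\<in>set rel_types. ?f \<tau> C)"
    by (simp add: combination_def fun_eq_iff)
  note * = sum_mem_B[of "set rel_types" ?f, OF finite_set f]
  show "combination r \<in> carrier B"
    using * unfolding comb by blast
  have "lin_theta (combination r) = (\<Sum>\<tau>\<in>set rel_types. lin_theta (?f \<tau>))"
    using * unfolding comb by blast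
  also have "\<dots> = (\<Sum>\<tau>\<in>set rel_types. arr_smult (r \<tau>) (class_arr \<tau>))"
    by (intro sum.cong refl)
      (simp add: lin_theta_smult[OF d] lin_theta_delta class_theta[OF finite_biset_coset_biset] theta_std)
  finally show "lin_theta (combination r) = (\<Sum>\<tau>\<in>set rel_types. arr_smult (r \<tau>) (class_arr \<tau>))" .
qed

section \<open>Decomposition into transitive classes modulo the relations\<close>

context
  fixes L
  assumes L: "submodule L (Z_loc_ring p) B" and rels: "biset_relations (Z_loc_ring p) G \<subseteq> L"
begin

lemmas LD = submoduleD[OF L, unfolded B_simps Z_loc_ring_simps]

lemma L_sum:
  assumes "finite A" "\<And>i. i \<in> A \<Longrightarrow> f i \<in> L"
  shows "(\<lambda>C. \<Sum>i\<in>A. f i C) \<in> L"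
  using assms
proof (induction A)
  case (insert a A)
  then show ?case
    using LD(3)[of "f a" "\<lambda>C. \<Sum>i\<in>A. f i C"] by simp
qed (simp add: LD(2))

text \<open>Orbits are split off one at a time, by induction on the number of points. The submodule
  \<open>L\<close> is arbitrary because membership in the generated submodule is tested against
  every submodule containing the relations.\<close>

lemma decompose_class:
  fixes M :: "('g, nat) biset"
  assumes "finite_biset G M"
  shows "\<exists>r. (\<forall>\<tau>\<in>set rel_types. r \<tau> \<in> Z_loc p) \<and>
    (\<lambda>C. delta (biset_class G M) C - combination r C) \<in> L"
  using assms
proof (induction "card (points M)" arbitrary: M rule: less_induct)
  case (less M)
  note M = \<open>finite_biset G M\<close>
  show ?case
  proof (cases "points M = {}")
    case True
    \<comment> \<open>The empty biset is isomorphic to its own double, so the relation for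
      \<open>M\<close> and \<open>M\<close> is minus its class.\<close>
    have "biset_isomorphic G (disjoint_union_biset M M) M"
      unfolding biset_isomorphic_def disjoint_union_biset_def by (auto simp: True bij_betw_def)
    then have "biset_class G (disjoint_union_biset M M) = biset_class G M"
      by (rule biset_class_eqI[OF finite_biset_disjoint_union[OF M M]])
    then have "(\<lambda>C. - delta (biset_class G M) C) \<in> L"
      using relation_mem[OF M M] rels by auto
    from LD(4)[OF Z_closed(4) this] show ?thesis
      by (intro exI[of _ "\<lambda>_. 0"]) (simp add: combination_def Z_closed)
  next
    case False
    then obtain m' where m': "m' \<in> points M" by blast
    obtain a b \<tau> where \<tau>: "\<tau> \<in> set rel_types" and conj: "stab M m' = conj_rel a b (std_rel \<tau>)"
      using subgroup_rel_conj_std[OF subgroup_rel_stab[OF M m']] by blast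
    \<comment> \<open>Moving the base point within its orbit undoes the conjugation, so the
      stabiliser becomes the standard subgroup itself.\<close>
    define m where "m = ract M (lact M (e (- a)) m') (e b)"
    have m: "m \<in> points M"
      using m' by (simp add: m_def finite_bisetD[OF M])
    have stab_m: "stab M m = std_rel \<tau>"
      unfolding m_def stab_act[OF M m'] conj by (simp add: conj_rel_conj_rel)
    define M1 where "M1 = M\<lparr>points := range (bact M m)\<rparr>"
    define M2 where "M2 = M\<lparr>points := points M - range (bact M m)\<rparr>"
    note split = split_orbit[OF M m, folded M1_def M2_def]
    have m_bact: "m = bact M m (0, 0)"
      using m by (simp add: bact_def finite_bisetD[OF M])
    then have m1: "m \<in> points M1"
      unfolding M1_def by simp
    have bact1: "bact M1 m = bact M m" "stab M1 m = stab M m"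
      by (simp_all add: bact_def stab_def M1_def)
    have points1: "points M1 = range (bact M1 m)"
      unfolding bact1(1) by (simp add: M1_def)
    have "biset_isomorphic G M1 (coset_biset (std_rel \<tau>))"
      by (rule transitive_isomorphic[OF split(1) m1 points1 finite_biset_coset_biset
            base_point_coset_biset points_coset_biset])
        (simp add: bact1 stab_m stab_coset_biset[OF subgroup_rel_std_rel[OF \<tau>]])
    then have class1: "biset_class G M1 = biset_class G (coset_biset (std_rel \<tau>))"
      by (rule biset_class_eqI[OF split(1)])
    have class_M: "biset_class G (disjoint_union_biset M1 M2) = biset_class G M"
      using biset_class_eqI[OF M split(3)] by simp
    have "card (points M2) < card (points M)"
      unfolding M2_def using m m_bact finite_bisetD(1)[OF M]
      by (intro psubset_card_mono) auto
    then obtain r where r: "\<forall>\<tau>\<in>set rel_types. r \<tau> \<in> Z_loc p"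
      and L2: "(\<lambda>C. delta (biset_class G M2) C - combination r C) \<in> L"
      using less(1)[OF _ split(2)] by blast
    define r' where "r' = (\<lambda>\<sigma>. r \<sigma> + (if \<sigma> = \<tau> then 1 else 0))"
    have comb: "combination r' C = combination r C + delta (biset_class G M1) C" for C
      using \<tau> by (simp add: combination_def r'_def distrib_right sum.distrib class1 if_distrib[of "\<lambda>x. x * _"] cong: if_cong)
    have "(\<lambda>C. delta (biset_class G M) C - (delta (biset_class G M1) C + delta (biset_class G M2) C)) \<in> L"
      using relation_mem[OF split(1,2)] rels unfolding class_M by blast
    from LD(3)[OF this L2] have "(\<lambda>C. delta (biset_class G M) C - combination r' C) \<in> L"
      by (simp add: comb algebra_simps)
    moreover have "\<forall>\<tau>\<in>set rel_types. r' \<tau> \<in> Z_loc p"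
      using r by (auto simp: r'_def Z_closed)
    ultimately show ?thesis by blast
  qed
qed

lemma decompose:
  assumes f: "f \<in> carrier B"
  shows "\<exists>r. (\<forall>\<tau>\<in>set rel_types. r \<tau> \<in> Z_loc p) \<and> (\<lambda>C. f C - combination r C) \<in> L"
proof -
  let ?S = "{C. f C \<noteq> 0}"
  have "\<forall>C\<in>?S. \<exists>r. (\<forall>\<tau>\<in>set rel_types. r \<tau> \<in> Z_loc p) \<and> (\<lambda>D. delta C D - combination r D) \<in> L"
  proof
    fix C assume "C \<in> ?S"
    then obtain M :: "('g, nat) biset" where "finite_biset G M" "C = biset_class G M"
      using B_support[OF f, of C] unfolding biset_classes_def by blast
    then show "\<exists>r. (\<forall>\<tau>\<in>set rel_types. r \<tau> \<in> Z_loc p) \<and> (\<lambda>D. delta C D - combination r D) \<in> L"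
      using decompose_class by simp
  qed
  from bchoice[OF this] obtain r
    where "\<forall>C\<in>?S. (\<forall>\<tau>\<in>set rel_types. r C \<tau> \<in> Z_loc p) \<and> (\<lambda>D. delta C D - combination (r C) D) \<in> L"
    by (rule exE)
  then have r: "\<And>C \<tau>. C \<in> ?S \<Longrightarrow> \<tau> \<in> set rel_types \<Longrightarrow> r C \<tau> \<in> Z_loc p"
    and L: "\<And>C. C \<in> ?S \<Longrightarrow> (\<lambda>D. delta C D - combination (r C) D) \<in> L"
    by simp_all
  define r' where "r' \<tau> = (\<Sum>C\<in>?S. f C * r C \<tau>)" for \<tau>
  have fZ: "f C \<in> Z_loc p" for C
    using f by (simp add: carrier_B)
  have "(\<lambda>D. \<Sum>C\<in>?S. f C * (delta C D - combination (r C) D)) \<in> L"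
    using LD(4)[OF fZ L] by (intro L_sum finite_support[OF f]) blast
  moreover have "(\<Sum>C\<in>?S. f C * (delta C D - combination (r C) D)) = f D - combination r' D" for D
  proof -
    have "(\<Sum>C\<in>?S. f C * delta C D) = f D"
      using finite_support[OF f] by (simp add: delta_def sum.delta' if_distrib[of "\<lambda>x. _ * x"] cong: if_cong)
    moreover have "(\<Sum>C\<in>?S. f C * combination (r C) D) = combination r' D"
      unfolding combination_def r'_def sum_distrib_left sum_distrib_right
      by (subst sum.swap) (simp add: mult.assoc)
    ultimately show ?thesis
      by (simp add: right_diff_distrib sum_subtractf)
  qed
  ultimately have "(\<lambda>D. f D - combination r' D) \<in> L" by simp
  moreover have "\<forall>\<tau>\<in>set rel_types. r' \<tau> \<in> Z_loc p"
    unfolding r'_def by (auto intro!: Z_loc_sum[OF p] Z_closed(8) fZ r)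
  ultimately show ?thesis by blast
qed

end

section \<open>The relations generate the kernel\<close>

lemma submodule_kernel: "submodule {f \<in> carrier B. lin_theta f = 0} (Z_loc_ring p) B"
proof (rule submodule_negI[OF abelian_group_B, where r = "- 1"])
  show "\<zero>\<^bsub>B\<^esub> \<in> {f \<in> carrier B. lin_theta f = 0}"
    by (simp add: B_simps carrier_B Z_closed lin_theta_def)
qed (auto simp: B_simps Z_loc_ring_simps Z_closed lin_theta_add lin_theta_smult add_mem_B smult_mem_B)

lemma relations_kernel: "biset_relations (Z_loc_ring p) G \<subseteq> {f \<in> carrier B. lin_theta f = 0}"
proof
  fix f assume "f \<in> biset_relations (Z_loc_ring p) G"
  then obtain M N :: "('g, nat) biset" where M: "finite_biset G M" and N: "finite_biset G N"
    and f: "f = delta (biset_class G (disjoint_union_biset M N)) \<ominus>\<^bsub>B\<^esub>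
      (\<lambda>C. delta (biset_class G M) C + delta (biset_class G N) C)"
    unfolding biset_relations_def class_delta_eq B_simps by blast
  note U = finite_biset_disjoint_union[OF M N]
  have mem: "delta (biset_class G P) \<in> carrier B" if "finite_biset G P" for P
    by (rule delta_mem_B[OF biset_class_mem[OF that]])
  let ?g = "\<lambda>C. delta (biset_class G M) C + delta (biset_class G N) C"
  have g: "?g \<in> carrier B"
    by (rule add_mem_B[OF mem[OF M] mem[OF N]])
  have f_eq: "f = (\<lambda>C. delta (biset_class G (disjoint_union_biset M N)) C + - 1 * ?g C)"
    unfolding f minus_B[OF mem[OF U] g] by (simp add: fun_eq_iff algebra_simps)
  have ng: "(\<lambda>C. - 1 * ?g C) \<in> carrier B"
    by (rule smult_mem_B[OF Z_closed(4) g])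
  have "lin_theta ?g = theta psi (disjoint_union_biset M N)"
    using lin_theta_add[OF mem[OF M] mem[OF N]]
    by (simp add: lin_theta_delta class_theta M N theta_disjoint_union)
  then have "lin_theta f = 0"
    unfolding f_eq lin_theta_add[OF mem[OF U] ng] lin_theta_smult[OF g]
    using arr.scale_left_distrib[of 1 "- 1" "theta psi (disjoint_union_biset M N)"]
    by (simp add: lin_theta_delta class_theta[OF U])
  then show "f \<in> {f \<in> carrier B. lin_theta f = 0}"
    using add_mem_B[OF mem[OF U] ng] unfolding f_eq by blast
qed

text \<open>Decomposing modulo the intersection of \<open>L\<close> with the kernel of
  \<open>lin_theta\<close> makes one choice of coefficients valid both modulo \<open>L\<close> and
  for the value of \<open>lin_theta\<close>.\<close>

lemma decompose_Int_kernel: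
  assumes L: "submodule L (Z_loc_ring p) B" and rels: "biset_relations (Z_loc_ring p) G \<subseteq> L"
    and f: "f \<in> carrier B"
  shows "\<exists>r. (\<forall>\<tau>\<in>set rel_types. r \<tau> \<in> Z_loc p) \<and> (\<lambda>C. f C - combination r C) \<in> L \<and>
    lin_theta f = (\<Sum>\<tau>\<in>set rel_types. arr_smult (r \<tau>) (class_arr \<tau>))"
proof -
  let ?K = "{f \<in> carrier B. lin_theta f = 0}"
  note LD = submoduleD[OF L, unfolded B_simps Z_loc_ring_simps]
    and KD = submoduleD[OF submodule_kernel, unfolded B_simps Z_loc_ring_simps]
  have "submodule (L \<inter> ?K) (Z_loc_ring p) B"
  proof (rule submodule_negI[OF abelian_group_B])
    show "L \<inter> ?K \<subseteq> carrier B"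
      by blast
    show "- 1 \<in> carrier (Z_loc_ring p)"
      by (simp add: Z_loc_ring_simps Z_closed)
    show "(- 1 \<odot>\<^bsub>B\<^esub> x) \<oplus>\<^bsub>B\<^esub> x = \<zero>\<^bsub>B\<^esub>" for x
      by (simp add: B_simps)
  qed (use LD(2-4) KD(2) in \<open>auto simp: B_simps Z_loc_ring_simps lin_theta_add lin_theta_smult add_mem_B smult_mem_B\<close>)
  then obtain r where r: "\<forall>\<tau>\<in>set rel_types. r \<tau> \<in> Z_loc p"
    and L: "(\<lambda>C. f C - combination r C) \<in> L" and K: "(\<lambda>C. f C - combination r C) \<in> ?K"
    using decompose[of "L \<inter> ?K" f] rels relations_kernel f by blast
  note comb = combination[of r, OF r[rule_format]]
  have "lin_theta f = lin_theta (combination r)"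
    using lin_theta_add[of "\<lambda>C. f C - combination r C" "combination r"] K comb(1) by simp
  with r L show ?thesis
    using comb(2) by auto
qed

text \<open>For an element of the kernel the coefficients of its decomposition vanish by
  \<open>class_arr_independent\<close>, which puts it into every submodule \<open>L\<close> that
  contains the relations.\<close>

lemma kernel: "J = {f \<in> carrier B. lin_theta f = 0}"
proof
  show "J \<subseteq> {f \<in> carrier B. lin_theta f = 0}"
    using submodule_kernel relations_kernel unfolding subset_iff mem_generated_submodule by blast
  show "{f \<in> carrier B. lin_theta f = 0} \<subseteq> J"
  proof
    fix f assume "f \<in> {f \<in> carrier B. lin_theta f = 0}"
    then have f: "f \<in> carrier B" "lin_theta f = 0" by auto
    have "f \<in> L" if L: "submodule L (Z_loc_ring p) B" "biset_relations (Z_loc_ring p) G \<subseteq> L" for L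
    proof -
      obtain r where "(\<lambda>C. f C - combination r C) \<in> L"
        "lin_theta f = (\<Sum>\<tau>\<in>set rel_types. arr_smult (r \<tau>) (class_arr \<tau>))"
        using decompose_Int_kernel[OF L f(1)] by blast
      moreover from this(2) have "r \<tau> = 0" if "\<tau> \<in> set rel_types" for \<tau>
        using class_arr_independent[of r \<tau>] that f(2) by simp
      then have "combination r = (\<lambda>C. 0)"
        by (simp add: combination_def fun_eq_iff)
      ultimately show ?thesis by simp
    qed
    then show "f \<in> J"
      unfolding mem_generated_submodule by blast
  qed
qed

section \<open>The quotient and its map to \<open>A\<close>\<close>

abbreviation "Q \<equiv> double_burnside (Z_loc_ring p) G"

lemma coset_eq:
  assumes a: "a \<in> carrier B"
  shows "J +>\<^bsub>B\<^esub> a = {f \<in> carrier B. lin_theta f = lin_theta a}"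
proof -
  have J: "J +>\<^bsub>B\<^esub> a = {\<lambda>C. h C + a C | h. h \<in> carrier B \<and> lin_theta h = 0}"
    unfolding a_r_coset_def' kernel B_simps by blast
  show ?thesis
  proof
    show "J +>\<^bsub>B\<^esub> a \<subseteq> {f \<in> carrier B. lin_theta f = lin_theta a}"
      unfolding J using lin_theta_add add_mem_B a by auto
    show "{f \<in> carrier B. lin_theta f = lin_theta a} \<subseteq> J +>\<^bsub>B\<^esub> a"
    proof
      fix f assume "f \<in> {f \<in> carrier B. lin_theta f = lin_theta a}"
      then have f: "f \<in> carrier B" "lin_theta f = lin_theta a" by auto
      let ?h = "\<lambda>C. f C + - 1 * a C"
      have na: "(\<lambda>C. - 1 * a C) \<in> carrier B"
        by (rule smult_mem_B[OF Z_closed(4) a])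
      have "?h \<in> carrier B"
        by (rule add_mem_B[OF f(1) na])
      moreover have "lin_theta ?h = 0"
        using lin_theta_add[OF f(1) na] lin_theta_smult[OF a, of "- 1"] f(2) arr.scale_left_distrib[of 1 "- 1" "lin_theta a"]
        by simp
      moreover have "f = (\<lambda>C. ?h C + a C)"
        by simp
      ultimately show "f \<in> J +>\<^bsub>B\<^esub> a"
        unfolding J by (intro CollectI exI[of _ ?h]) simp
    qed
  qed
qed

definition quot_hom :: "(('g, nat) biset set \<Rightarrow> rat) set \<Rightarrow> arr" where
  "quot_hom Y = lin_theta (SOME f. f \<in> Y)"

text \<open>Products and scalar multiples in the quotient are unions over all representatives;
  constancy of \<open>lin_theta\<close> on such a union settles the value without knowing which
  representative \<open>SOME\<close> picks.\<close>

lemma quot_hom_eqI: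
  assumes "Y \<noteq> {}" "\<And>f. f \<in> Y \<Longrightarrow> lin_theta f = v"
  shows "quot_hom Y = v"
  unfolding quot_hom_def using assms some_in_eq by blast

lemma quot_hom_coset:
  assumes "a \<in> carrier B"
  shows "quot_hom (J +>\<^bsub>B\<^esub> a) = lin_theta a"
  unfolding coset_eq[OF assms] using assms by (intro quot_hom_eqI) auto

lemma Q_simps:
  "carrier Q = (\<lambda>a. J +>\<^bsub>B\<^esub> a) ` carrier B"
  "Y \<otimes>\<^bsub>Q\<^esub> Z = (\<Union>a\<in>Y. \<Union>b\<in>Z. J +>\<^bsub>B\<^esub> (a \<otimes>\<^bsub>B\<^esub> b))"
  "Y \<oplus>\<^bsub>Q\<^esub> Z = (\<Union>a\<in>Y. \<Union>b\<in>Z. {a \<oplus>\<^bsub>B\<^esub> b})" "\<one>\<^bsub>Q\<^esub> = J +>\<^bsub>B\<^esub> \<one>\<^bsub>B\<^esub>"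
  "r \<odot>\<^bsub>Q\<^esub> Y = (\<Union>a\<in>Y. J +>\<^bsub>B\<^esub> (r \<odot>\<^bsub>B\<^esub> a))"
  by (auto simp: double_burnside_def quotient_algebra_def FactRing_def A_RCOSETS_def RCOSETS_def
      a_r_coset_def rcoset_mult_def set_add_def set_mult_def)

lemma one_mem_B: "\<one>\<^bsub>B\<^esub> \<in> carrier B"
  unfolding B_simps by (rule delta_mem_B[OF biset_class_mem[OF finite_biset_regular]])

lemma quot_hom_ops:
  assumes Y: "Y \<in> carrier Q" and Z: "Z \<in> carrier Q"
  shows "quot_hom (Y \<otimes>\<^bsub>Q\<^esub> Z) = quot_hom Y * quot_hom Z"
    "quot_hom (Y \<oplus>\<^bsub>Q\<^esub> Z) = quot_hom Y + quot_hom Z"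
    "r \<in> Z_loc p \<Longrightarrow> quot_hom (r \<odot>\<^bsub>Q\<^esub> Y) = arr_smult r (quot_hom Y)"
proof -
  obtain a where a: "a \<in> carrier B" "Y = J +>\<^bsub>B\<^esub> a"
    using Y unfolding Q_simps by blast
  obtain b where b: "b \<in> carrier B" "Z = J +>\<^bsub>B\<^esub> b"
    using Z unfolding Q_simps by blast
  have Y': "Y = {f \<in> carrier B. lin_theta f = quot_hom Y}" and Z': "Z = {f \<in> carrier B. lin_theta f = quot_hom Z}"
    using coset_eq[OF a(1)] coset_eq[OF b(1)] quot_hom_coset[OF a(1)] quot_hom_coset[OF b(1)] a(2) b(2) by auto
  have aY: "a \<in> Y" and bZ: "b \<in> Z"
    using a b coset_eq[OF a(1)] coset_eq[OF b(1)] by auto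
  have Yf: "f \<in> carrier B" "lin_theta f = quot_hom Y" if "f \<in> Y" for f
    using that Y' by blast+
  have Zf: "f \<in> carrier B" "lin_theta f = quot_hom Z" if "f \<in> Z" for f
    using that Z' by blast+
  have self: "f \<in> J +>\<^bsub>B\<^esub> f" if "f \<in> carrier B" for f
    using coset_eq[OF that] that by simp
  show "quot_hom (Y \<otimes>\<^bsub>Q\<^esub> Z) = quot_hom Y * quot_hom Z"
  proof (rule quot_hom_eqI)
    show "Y \<otimes>\<^bsub>Q\<^esub> Z \<noteq> {}"
      unfolding Q_simps using aY bZ self[OF mult_mem_B[OF Yf(1)[OF aY] Zf(1)[OF bZ]]] by blast
    fix f assume "f \<in> Y \<otimes>\<^bsub>Q\<^esub> Z"
    then obtain c d where cd: "c \<in> Y" "d \<in> Z" "f \<in> J +>\<^bsub>B\<^esub> (c \<otimes>\<^bsub>B\<^esub> d)"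
      unfolding Q_simps by blast
    then show "lin_theta f = quot_hom Y * quot_hom Z"
      using coset_eq[OF mult_mem_B[OF Yf(1)[OF cd(1)] Zf(1)[OF cd(2)]]]
        lin_theta_mult[OF Yf(1)[OF cd(1)] Zf(1)[OF cd(2)]] Yf(2)[OF cd(1)] Zf(2)[OF cd(2)] by simp
  qed
  show "quot_hom (Y \<oplus>\<^bsub>Q\<^esub> Z) = quot_hom Y + quot_hom Z"
  proof (rule quot_hom_eqI)
    show "Y \<oplus>\<^bsub>Q\<^esub> Z \<noteq> {}"
      unfolding Q_simps using aY bZ by blast
    fix f assume "f \<in> Y \<oplus>\<^bsub>Q\<^esub> Z"
    then obtain c d where cd: "c \<in> Y" "d \<in> Z" "f = (\<lambda>C. c C + d C)"
      unfolding Q_simps B_simps by blast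
    then show "lin_theta f = quot_hom Y + quot_hom Z"
      using lin_theta_add[OF Yf(1)[OF cd(1)] Zf(1)[OF cd(2)]] Yf(2)[OF cd(1)] Zf(2)[OF cd(2)] by simp
  qed
  show "quot_hom (r \<odot>\<^bsub>Q\<^esub> Y) = arr_smult r (quot_hom Y)" if r: "r \<in> Z_loc p"
  proof (rule quot_hom_eqI)
    show "r \<odot>\<^bsub>Q\<^esub> Y \<noteq> {}"
      unfolding Q_simps B_simps using aY self[OF smult_mem_B[OF r Yf(1)[OF aY]]] by blast
    fix f assume "f \<in> r \<odot>\<^bsub>Q\<^esub> Y"
    then obtain c where c: "c \<in> Y" "f \<in> J +>\<^bsub>B\<^esub> (\<lambda>C. r * c C)"
      unfolding Q_simps B_simps by blast
    then show "lin_theta f = arr_smult r (quot_hom Y)"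
      using coset_eq[OF smult_mem_B[OF r Yf(1)[OF c(1)]]] lin_theta_smult[OF Yf(1)[OF c(1)]] Yf(2)[OF c(1)] by simp
  qed
qed

end

text \<open>The homomorphism and its injectivity are available for every prime \<open>p\<close>; the
  prime 2 enters in identifying the image, the span of the table, with the localisation.\<close>

lemma (in s3_model) algebra_isomorphic_Lambda_two:
  assumes two: "p = 2"
  shows "algebra_isomorphic (Z_loc_ring p) Q (alg_A\<lparr>carrier := Lambda_loc p\<rparr>)"
  unfolding algebra_isomorphic_def
proof (intro bexI[of _ quot_hom] ballI)
  let ?A = "alg_A\<lparr>carrier := Lambda_loc p\<rparr>"
  have A: "carrier ?A = Lambda_loc p" "x \<oplus>\<^bsub>?A\<^esub> y = x + y" "x \<otimes>\<^bsub>?A\<^esub> y = x * y" "\<one>\<^bsub>?A\<^esub> = 1"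
    "r \<odot>\<^bsub>?A\<^esub> x = arr_smult r x" for x y r
    using alg_A_simps by simp_all
  show "quot_hom (r \<odot>\<^bsub>Q\<^esub> x) = r \<odot>\<^bsub>?A\<^esub> quot_hom x" if "r \<in> carrier (Z_loc_ring p)" "x \<in> carrier Q" for r x
    using quot_hom_ops(3)[OF that(2) that(2)] that(1) unfolding A Z_loc_ring_simps by blast
  have mem: "lin_theta f \<in> Lambda_loc p" if "f \<in> carrier B" for f
    using decompose_Int_kernel[OF submodule_kernel relations_kernel that] combination_mem_Lambda_loc
    unfolding two by metis
  have "bij_betw quot_hom (carrier Q) (Lambda_loc p)"
    unfolding bij_betw_def
  proof
    show "inj_on quot_hom (carrier Q)"
    proof (rule inj_onI)
      fix Y Z assume "Y \<in> carrier Q" "Z \<in> carrier Q" and eq: "quot_hom Y = quot_hom Z"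
      then obtain a b where ab: "a \<in> carrier B" "Y = J +>\<^bsub>B\<^esub> a" "b \<in> carrier B" "Z = J +>\<^bsub>B\<^esub> b"
        unfolding Q_simps by blast
      then have "lin_theta a = lin_theta b"
        using eq quot_hom_coset by simp
      then show "Y = Z"
        unfolding ab(2,4) coset_eq[OF ab(1)] coset_eq[OF ab(3)] by simp
    qed
    have "v \<in> quot_hom ` carrier Q" if v: "v \<in> Lambda_loc p" for v
    proof -
      obtain r where r: "\<forall>\<tau>\<in>set rel_types. r \<tau> \<in> Z_loc p"
        "v = (\<Sum>\<tau>\<in>set rel_types. arr_smult (r \<tau>) (class_arr \<tau>))"
        using v Lambda_two_span[of v] unfolding two Lambda_loc_two by blast
      note comb = combination[of r, OF r(1)[rule_format]]
      show ?thesis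
        unfolding Q_simps image_image using quot_hom_coset[OF comb(1)] comb r(2) by (metis (no_types, lifting) image_eqI)
    qed
    then show "quot_hom ` carrier Q = Lambda_loc p"
      unfolding Q_simps using mem by (auto simp: quot_hom_coset)
  qed
  moreover from this have "quot_hom \<in> ring_hom Q ?A"
    unfolding ring_hom_def A
    using quot_hom_ops(1,2) quot_hom_coset[OF one_mem_B] class_theta_regular
    by (auto simp: bij_betw_def Q_simps(4) B_simps(4) lin_theta_delta)
  ultimately show "quot_hom \<in> ring_iso Q ?A"
    unfolding ring_iso_def A by blast
qed

subsection \<open>The symmetric group\<close>

text \<open>Here \<open>R1\<close> is the cycle (1 2 3), \<open>S0\<close> the transposition (1 2),
  and \<open>Si\<close> the composite of \<open>Ri\<close> after \<open>S0\<close>, in accordance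
  with the addition table.\<close>

fun s3_perm :: "s3 \<Rightarrow> nat \<Rightarrow> nat" where
  "s3_perm R0 n = n"
| "s3_perm R1 n = (if n = 1 then 2 else if n = 2 then 3 else if n = 3 then 1 else n)"
| "s3_perm R2 n = (if n = 1 then 3 else if n = 2 then 1 else if n = 3 then 2 else n)"
| "s3_perm S0 n = (if n = 1 then 2 else if n = 2 then 1 else n)"
| "s3_perm S1 n = (if n = 1 then 3 else if n = 3 then 1 else n)"
| "s3_perm S2 n = (if n = 2 then 3 else if n = 3 then 2 else n)"

lemma s3_perm_add: "s3_perm (x + y) = s3_perm x \<circ> s3_perm y"
  by (cases x; cases y; simp add: fun_eq_iff)

lemma s3_perm_permutes: "s3_perm x permutes {1..3}"
  unfolding permutes_def bij_iff[symmetric]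
proof (intro conjI allI impI)
  have "s3_perm x \<circ> s3_perm (- x) = id" "s3_perm (- x) \<circ> s3_perm x = id"
    by (simp_all flip: s3_perm_add) (simp_all add: zero_s3_def fun_eq_iff)
  then show "bij (s3_perm x)"
    using o_bij by blast
  show "s3_perm x n = n" if "n \<notin> {1..3}" for n
    using that by (cases x) auto
qed

lemma inj_s3_perm: "inj s3_perm"
proof (rule injI)
  fix x y assume "s3_perm x = s3_perm y"
  then have "s3_perm x 1 = s3_perm y 1" "s3_perm x 2 = s3_perm y 2"
    by simp_all
  then show "x = y"
    by (cases x; cases y; simp)
qed

lemma range_s3_perm: "range s3_perm = {q. q permutes {1..3}}"
proof (rule card_subset_eq)
  show "finite {q. q permutes {1..3 :: nat}}"
    by (rule finite_permutations) simp
  show "range s3_perm \<subseteq> {q. q permutes {1..3}}"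
    using s3_perm_permutes by blast
  show "card (range s3_perm) = card {q. q permutes {1..3 :: nat}}"
    by (simp add: card_image[OF inj_s3_perm] card_s3 card_permutations[OF refl] fact_numeral)
qed

interpretation sym3: s3_model "sym_group 3" s3_perm 2
proof (intro s3_model.intro burnside_model.intro group_model.intro burnside_model_axioms.intro)
  show "group (sym_group 3)"
    by (rule sym_group_is_group)
  show "bij_betw s3_perm UNIV (carrier (sym_group 3))"
    unfolding bij_betw_def sym_group_def using inj_s3_perm range_s3_perm by simp
  show "s3_perm (x + y) = s3_perm x \<otimes>\<^bsub>sym_group 3\<^esub> s3_perm y" for x y
    by (simp add: sym_group_mult s3_perm_add)
  show "prime (2 :: nat)"
    by (rule two_is_prime_nat)
qed

theorem corollary9:
  shows "Lambda_loc 2 =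
      {Arr s t u v w x y (Eta_Xi z1 z2 z3) | s t u v w x y z1 z2 z3.
        Arr s t u v w x y (Eta_Xi z1 z2 z3) \<in> A_over (Z_loc 2) \<and>
        cong_in (Z_loc 2) 8 (2 * w - 2 * z1) z2 \<and>
        cong_in (Z_loc 2) 4 z2 z3 \<and>
        cong_in (Z_loc 2) 4 z3 0 \<and>
        (\<forall>i. cong_in (Z_loc 2) 4 (x $ i) 0) \<and>
        cong_in (Z_loc 2) 2 y 0 \<and>
        (\<forall>i. cong_in (Z_loc 2) 2 (t $ i) 0) \<and>
        cong_in (Z_loc 2) 2 v 0}
    \<and> algebra_isomorphic (Z_loc_ring 2)
        (double_burnside (Z_loc_ring 2) (sym_group 3))
        (alg_A\<lparr>carrier := Lambda_loc 2\<rparr>)"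
  using Lambda_loc_two sym3.algebra_isomorphic_Lambda_two[OF refl] unfolding Lambda_two_def by blast

end
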